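(* Let $\Lambda$ be an integral domain endowed with a ring involution. Fix a pushout for each span of $\Lambda$-modules. Then Hermitian $\Lambda$-modules, as objects, Lagrangian cospans, as $1$-morphisms, and isomorphism classes of $2$-cospans, as $2$-morphisms, form a bicategory (with the horizontal and vertical compositions, identities, and associativity and unit isomorphisms given by the chosen pushouts as described in the context).
   Context: "Bicategory" is meant in the sense of Bénabou. Hermitian modules. A skew-Hermitian form on a $\Lambda$-module $H$ is a map $\omega\colon H\times H\to\Lambda$, $\Lambda$-linear in the first variable, with $\omega(x,y)=-\overline{\omega(y,x)}$, and such that $\omega(x,y)=0$ for all $y$ implies $x=0$. A Hermitian $\Lambda$-module is a finitely generated $\Lambda$-module with a skew-Hermitian form; $-H$ is $H$ with the opposite form. A submodule $A\subset H$ is Lagrangian if $A=\{x\in H\mid\omega(v,x)=0\ \forall v\in A\}$; and $\overline{A}=\{x\in H\mid\lambda x\in A\text{ for some non-zero }\lambda\in\Lambda\}$. $1$-morphisms. A cospan from $H$ to $H'$ is a diagram of $\Lambda$-modules $H\xrightarrow{i}T\xleftarrow{i'}H'$. It is Lagrangian if $H,H'$ are Hermitian and $\overline{N_T}$ is a Lagrangian submodule of $(-H)\oplus H'$, where $N_T=\{(x,y)\mid i'(y)=i(x)\}$. The composition of $H\xrightarrow{i_1}T_1\xleftarrow{i_1'}H'$ and $H'\xrightarrow{i_3'}T_3\xleftarrow{i_3''}H''$ is $H\xrightarrow{j_1i_1}T_3\circ T_1\xleftarrow{j_3i_3''}H''$, where $T_1\xrightarrow{j_1}T_3\circ T_1\xleftarrow{j_3}T_3$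 is the fixed pushout of $T_1\xleftarrow{i_1'}H'\xrightarrow{i_3'}T_3$. The identity of $H$ is $I_H=(H\xrightarrow{\mathrm{id}}H\xleftarrow{\mathrm{id}}H)$. $2$-morphisms. A $2$-cospan from $H\xrightarrow{i_1}T_1\xleftarrow{i_1'}H'$ to $H\xrightarrow{i_2}T_2\xleftarrow{i_2'}H'$ is a cospan of $\Lambda$-modules $T_1\xrightarrow{\alpha_1}A\xleftarrow{\alpha_2}T_2$ with $\alpha_1i_1=\alpha_2i_2$ and $\alpha_1i_1'=\alpha_2i_2'$. Two such, $(A,\alpha_1,\alpha_2)$ and $(A',\alpha_1',\alpha_2')$, are isomorphic if there is an isomorphism $f\colon A\to A'$ with $f\alpha_1=\alpha_1'$ and $f\alpha_2=\alpha_2'$. The isomorphism class is written $A\colon T_1\Rightarrow T_2$. The identity $2$-morphism of $T$ is $T\xrightarrow{\mathrm{id}}T\xleftarrow{\mathrm{id}}T$. Vertical composition of $T_1\xrightarrow{\alpha_1}A\xleftarrow{\alpha_2}T_2$ and $T_2\xrightarrow{\beta_2}B\xleftarrow{\beta_3}T_3$: the class of $T_1\xrightarrow{v_A\alpha_1}B\star A\xleftarrow{v_B\beta_3}T_3$, where $A\xrightarrow{v_A}B\star A\xleftarrow{v_B}B$ is the pushout of $A\xleftarrow{\alpha_2}T_2\xrightarrow{\beta_2}B$. Horizontal composition of $A\colon T_1\Rightarrow T_2$ (between cospans $(T_k,i_k,i_k')$ from $H$ to $H'$, $k=1,2$, with structure maps $\alpha_1,\alpha_2$) and $B\colon T_3\Rightarrow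 T_4$ (between cospans $(T_k,i_k',i_k'')$ from $H'$ to $H''$, $k=3,4$, with structure maps $\beta_3,\beta_4$): let $A\xrightarrow{h_A}B\bullet A\xleftarrow{h_B}B$ be the pushout of $A\xleftarrow{\alpha_2i_2'}H'\xrightarrow{\beta_3i_3'}B$. The composite is the class of $T_3\circ T_1\xrightarrow{h_{31}}B\bullet A\xleftarrow{h_{42}}T_4\circ T_2$, where $h_{31}$ is the unique map with $h_{31}j_1=h_A\alpha_1$, $h_{31}j_3=h_B\beta_3$, and $h_{42}$ is the unique map with $h_{42}j_2=h_A\alpha_2$, $h_{42}j_4=h_B\beta_4$ (the $j$'s being the pushout maps into $T_3\circ T_1$ and $T_4\circ T_2$). Associativity and unit isomorphisms. The universal property of pushouts gives canonical isomorphisms of cospans $(T_3\circ T_2)\circ T_1\cong T_3\circ(T_2\circ T_1)$, $I_{H'}\circ T\cong T$ and $T\circ I_H\cong T$; an isomorphism of cospans $f\colon T\to T'$ is viewed as the invertible $2$-morphism $T\xrightarrow{f}T'\xleftarrow{\mathrm{id}}T'$. *)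

theory Defs
  imports "HOL-Algebra.Module"
begin

section \<open>Bicategories\<close>

locale category =
  fixes Ob :: "'o set"
    and Hom :: "'o \<Rightarrow> 'o \<Rightarrow> 'm set"
    and Id :: "'o \<Rightarrow> 'm"
    and Comp :: "'m \<Rightarrow> 'm \<Rightarrow> 'm"
  assumes Id_hom: "x \<in> Ob \<Longrightarrow> Id x \<in> Hom x x"
    and Comp_hom: "\<lbrakk>x \<in> Ob; y \<in> Ob; z \<in> Ob; f \<in> Hom x y; g \<in> Hom y z\<rbrakk> \<Longrightarrow> Comp g f \<in> Hom x z"
    and Comp_Id: "\<lbrakk>x \<in> Ob; y \<in> Ob; f \<in> Hom x y\<rbrakk> \<Longrightarrow> Comp f (Id x) = f"
    and Id_Comp: "\<lbrakk>x \<in> Ob; y \<in> Ob; f \<in> Hom x y\<rbrakk> \<Longrightarrow> Comp (Id y) f = f"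
    and Comp_assoc:
      "\<lbrakk>w \<in> Ob; x \<in> Ob; y \<in> Ob; z \<in> Ob; f \<in> Hom w x; g \<in> Hom x y; h \<in> Hom y z\<rbrakk>
        \<Longrightarrow> Comp (Comp h g) f = Comp h (Comp g f)"

definition iso_arrow ::
    "('o \<Rightarrow> 'o \<Rightarrow> 'm set) \<Rightarrow> ('o \<Rightarrow> 'm) \<Rightarrow> ('m \<Rightarrow> 'm \<Rightarrow> 'm) \<Rightarrow> 'o \<Rightarrow> 'o \<Rightarrow> 'm \<Rightarrow> bool" where
  "iso_arrow Hom ide cmp x y f \<longleftrightarrow>
     f \<in> Hom x y \<and> (\<exists>g \<in> Hom y x. cmp g f = ide x \<and> cmp f g = ide y)"

text \<open>
  Benabou's definition: \<open>Mor a b\<close> and \<open>Cell\<close> are the objects and arrows of the category of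
  \<open>1\<close>-cells from \<open>a\<close> to \<open>b\<close>; \<open>g \<cdot> f\<close> and \<open>\<beta> \<bullet> \<alpha>\<close> are the composition functor on
  \<open>1\<close>-cells and on \<open>2\<close>-cells; \<open>\<beta> \<star> \<alpha>\<close> is vertical composition.  All compositions are written
  in the order of composition of maps.
\<close>

locale bicategory =
  fixes Obj :: "'o set"
    and Mor :: "'o \<Rightarrow> 'o \<Rightarrow> 'm set"
    and Cell :: "'m \<Rightarrow> 'm \<Rightarrow> 'c set"
    and id1 :: "'o \<Rightarrow> 'm"
    and comp1 :: "'m \<Rightarrow> 'm \<Rightarrow> 'm"  (infixl "\<cdot>" 75)
    and id2 :: "'m \<Rightarrow> 'c"
    and vcomp :: "'c \<Rightarrow> 'c \<Rightarrow> 'c"  (infixl "\<star>" 65)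
    and hcomp :: "'c \<Rightarrow> 'c \<Rightarrow> 'c"  (infixl "\<bullet>" 70)
    and assoc :: "'m \<Rightarrow> 'm \<Rightarrow> 'm \<Rightarrow> 'c"
    and lunit :: "'m \<Rightarrow> 'c"
    and runit :: "'m \<Rightarrow> 'c"
  assumes hom_category: "\<lbrakk>a \<in> Obj; b \<in> Obj\<rbrakk> \<Longrightarrow> category (Mor a b) Cell id2 vcomp"
    and id1_mor: "a \<in> Obj \<Longrightarrow> id1 a \<in> Mor a a"
    and comp1_mor:
      "\<lbrakk>a \<in> Obj; b \<in> Obj; c \<in> Obj; f \<in> Mor a b; g \<in> Mor b c\<rbrakk> \<Longrightarrow> g \<cdot> f \<in> Mor a c"
    and hcomp_cell:
      "\<lbrakk>a \<in> Obj; b \<in> Obj; c \<in> Obj; f \<in> Mor a b; f' \<in> Mor a b; g \<in> Mor b c; g' \<in> Mor b c;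
        \<alpha> \<in> Cell f f'; \<beta> \<in> Cell g g'\<rbrakk> \<Longrightarrow> \<beta> \<bullet> \<alpha> \<in> Cell (g \<cdot> f) (g' \<cdot> f')"
    and hcomp_id2:
      "\<lbrakk>a \<in> Obj; b \<in> Obj; c \<in> Obj; f \<in> Mor a b; g \<in> Mor b c\<rbrakk>
        \<Longrightarrow> id2 g \<bullet> id2 f = id2 (g \<cdot> f)"
    and interchange:
      "\<lbrakk>a \<in> Obj; b \<in> Obj; c \<in> Obj;
        f \<in> Mor a b; f' \<in> Mor a b; f'' \<in> Mor a b; g \<in> Mor b c; g' \<in> Mor b c; g'' \<in> Mor b c;
        \<alpha> \<in> Cell f f'; \<alpha>' \<in> Cell f' f''; \<beta> \<in> Cell g g'; \<beta>' \<in> Cell g' g''\<rbrakk>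
        \<Longrightarrow> (\<beta>' \<star> \<beta>) \<bullet> (\<alpha>' \<star> \<alpha>) = (\<beta>' \<bullet> \<alpha>') \<star> (\<beta> \<bullet> \<alpha>)"
    and assoc_iso:
      "\<lbrakk>a \<in> Obj; b \<in> Obj; c \<in> Obj; d \<in> Obj; f \<in> Mor a b; g \<in> Mor b c; h \<in> Mor c d\<rbrakk>
        \<Longrightarrow> iso_arrow Cell id2 vcomp ((h \<cdot> g) \<cdot> f) (h \<cdot> (g \<cdot> f)) (assoc h g f)"
    and assoc_natural:
      "\<lbrakk>a \<in> Obj; b \<in> Obj; c \<in> Obj; d \<in> Obj;
        f \<in> Mor a b; f' \<in> Mor a b; g \<in> Mor b c; g' \<in> Mor b c; h \<in> Mor c d; h' \<in> Mor c d;
        \<alpha> \<in> Cell f f'; \<beta> \<in> Cell g g'; \<gamma> \<in> Cell h h'\<rbrakk>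
        \<Longrightarrow> assoc h' g' f' \<star> ((\<gamma> \<bullet> \<beta>) \<bullet> \<alpha>) = (\<gamma> \<bullet> (\<beta> \<bullet> \<alpha>)) \<star> assoc h g f"
    and lunit_iso:
      "\<lbrakk>a \<in> Obj; b \<in> Obj; f \<in> Mor a b\<rbrakk>
        \<Longrightarrow> iso_arrow Cell id2 vcomp (id1 b \<cdot> f) f (lunit f)"
    and lunit_natural:
      "\<lbrakk>a \<in> Obj; b \<in> Obj; f \<in> Mor a b; f' \<in> Mor a b; \<alpha> \<in> Cell f f'\<rbrakk>
        \<Longrightarrow> lunit f' \<star> (id2 (id1 b) \<bullet> \<alpha>) = \<alpha> \<star> lunit f"
    and runit_iso:
      "\<lbrakk>a \<in> Obj; b \<in> Obj; f \<in> Mor a b\<rbrakk>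
        \<Longrightarrow> iso_arrow Cell id2 vcomp (f \<cdot> id1 a) f (runit f)"
    and runit_natural:
      "\<lbrakk>a \<in> Obj; b \<in> Obj; f \<in> Mor a b; f' \<in> Mor a b; \<alpha> \<in> Cell f f'\<rbrakk>
        \<Longrightarrow> runit f' \<star> (\<alpha> \<bullet> id2 (id1 a)) = \<alpha> \<star> runit f"
    and pentagon:
      "\<lbrakk>a \<in> Obj; b \<in> Obj; c \<in> Obj; d \<in> Obj; e \<in> Obj;
        f \<in> Mor a b; g \<in> Mor b c; h \<in> Mor c d; k \<in> Mor d e\<rbrakk>
        \<Longrightarrow> assoc k h (g \<cdot> f) \<star> assoc (k \<cdot> h) g f
          = (id2 k \<bullet> assoc h g f) \<star> assoc k (h \<cdot> g) f \<star> (assoc k h g \<bullet> id2 f)"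
    and triangle:
      "\<lbrakk>a \<in> Obj; b \<in> Obj; c \<in> Obj; f \<in> Mor a b; g \<in> Mor b c\<rbrakk>
        \<Longrightarrow> (id2 g \<bullet> lunit f) \<star> assoc g (id1 b) f = runit g \<bullet> id2 f"


section \<open>Modules, spans, cospans and pushouts\<close>

text \<open>
  Modules have their carrier in a type \<open>'u\<close>, which plays the role of the universe; it is an
  arbitrary type.  The results quantify over a choice of pushouts for the spans of modules in
  \<open>'u\<close>.  Such a choice exists whenever \<open>'u\<close> is infinite, since a quotient of a product of two
  subsets of \<open>'u\<close> then injects into \<open>'u\<close>.

  Homomorphisms are \<open>undefined\<close> off the carrier of their domain, so that equality of functions
  is equality of homomorphisms.
\<close>

definition mod_hom ::
    "('a, 'r) ring_scheme \<Rightarrow> ('a, 'u) module \<Rightarrow> ('a, 'v) module \<Rightarrow> ('u \<Rightarrow> 'v) set" where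
  "mod_hom R M N = {f \<in> carrier M \<rightarrow>\<^sub>E carrier N.
     (\<forall>x \<in> carrier M. \<forall>y \<in> carrier M. f (x \<oplus>\<^bsub>M\<^esub> y) = f x \<oplus>\<^bsub>N\<^esub> f y) \<and>
     (\<forall>r \<in> carrier R. \<forall>x \<in> carrier M. f (r \<odot>\<^bsub>M\<^esub> x) = r \<odot>\<^bsub>N\<^esub> f x)}"

definition mod_iso ::
    "('a, 'r) ring_scheme \<Rightarrow> ('a, 'u) module \<Rightarrow> ('a, 'v) module \<Rightarrow> ('u \<Rightarrow> 'v) set" where
  "mod_iso R M N = {f \<in> mod_hom R M N. bij_betw f (carrier M) (carrier N)}"

definition id_hom :: "('a, 'u) module \<Rightarrow> 'u \<Rightarrow> 'u" where
  "id_hom M = (\<lambda>x \<in> carrier M. x)"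

definition finitely_generated :: "('a, 'r) ring_scheme \<Rightarrow> ('a, 'u) module \<Rightarrow> bool" where
  "finitely_generated R M \<longleftrightarrow>
     (\<exists>S. finite S \<and> S \<subseteq> carrier M \<and>
        (\<forall>x \<in> carrier M. \<exists>c \<in> S \<rightarrow> carrier R. x = (\<Oplus>\<^bsub>M\<^esub>s\<in>S. c s \<odot>\<^bsub>M\<^esub> s)))"

record ('a, 'u) span =
  centre :: "('a, 'u) module"
  lfoot :: "('a, 'u) module"
  rfoot :: "('a, 'u) module"
  lmap :: "'u \<Rightarrow> 'u"
  rmap :: "'u \<Rightarrow> 'u"

record ('a, 'u) cospan =
  apex :: "('a, 'u) module"
  lleg :: "'u \<Rightarrow> 'u"
  rleg :: "'u \<Rightarrow> 'u"

definition is_span :: "('a, 'r) ring_scheme \<Rightarrow> ('a, 'u) span \<Rightarrow> bool" where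
  "is_span R S \<longleftrightarrow> module R (centre S) \<and> module R (lfoot S) \<and> module R (rfoot S) \<and>
     lmap S \<in> mod_hom R (centre S) (lfoot S) \<and> rmap S \<in> mod_hom R (centre S) (rfoot S)"

definition is_cospan ::
    "('a, 'r) ring_scheme \<Rightarrow> ('a, 'u) module \<Rightarrow> ('a, 'u) module \<Rightarrow> ('a, 'u) cospan \<Rightarrow> bool" where
  "is_cospan R X Y C \<longleftrightarrow> module R X \<and> module R Y \<and> module R (apex C) \<and>
     lleg C \<in> mod_hom R X (apex C) \<and> rleg C \<in> mod_hom R Y (apex C)"

definition is_cocone :: "('a, 'r) ring_scheme \<Rightarrow> ('a, 'u) span \<Rightarrow> ('a, 'u) cospan \<Rightarrow> bool" where
  "is_cocone R S C \<longleftrightarrow> is_cospan R (lfoot S) (rfoot S) C \<and>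
     compose (carrier (centre S)) (lleg C) (lmap S) = compose (carrier (centre S)) (rleg C) (rmap S)"

definition cospan_map ::
    "('a, 'r) ring_scheme \<Rightarrow> ('a, 'u) module \<Rightarrow> ('a, 'u) module \<Rightarrow>
     ('a, 'u) cospan \<Rightarrow> ('a, 'u) cospan \<Rightarrow> ('u \<Rightarrow> 'u) \<Rightarrow> bool" where
  "cospan_map R X Y C D u \<longleftrightarrow> u \<in> mod_hom R (apex C) (apex D) \<and>
     compose (carrier X) u (lleg C) = lleg D \<and> compose (carrier Y) u (rleg C) = rleg D"

definition is_pushout :: "('a, 'r) ring_scheme \<Rightarrow> ('a, 'u) span \<Rightarrow> ('a, 'u) cospan \<Rightarrow> bool" where
  "is_pushout R S C \<longleftrightarrow> is_cocone R S C \<and>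
     (\<forall>D. is_cocone R S D \<longrightarrow> (\<exists>!u. cospan_map R (lfoot S) (rfoot S) C D u))"

definition pushout_choice ::
    "('a, 'r) ring_scheme \<Rightarrow> (('a, 'u) span \<Rightarrow> ('a, 'u) cospan) \<Rightarrow> bool" where
  "pushout_choice R po \<longleftrightarrow> (\<forall>S. is_span R S \<longrightarrow> is_pushout R S (po S))"

definition induced_map ::
    "('a, 'r) ring_scheme \<Rightarrow> (('a, 'u) span \<Rightarrow> ('a, 'u) cospan) \<Rightarrow> ('a, 'u) span \<Rightarrow>
     ('a, 'u) cospan \<Rightarrow> 'u \<Rightarrow> 'u" where
  "induced_map R po S D = (THE u. cospan_map R (lfoot S) (rfoot S) (po S) D u)"


section \<open>Hermitian modules\<close>

definition ring_involution :: "('a, 'r) ring_scheme \<Rightarrow> ('a \<Rightarrow> 'a) \<Rightarrow> bool" where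
  "ring_involution R bar \<longleftrightarrow> bar \<in> ring_hom R R \<and> (\<forall>r \<in> carrier R. bar (bar r) = r)"

record ('a, 'u) herm =
  umod :: "('a, 'u) module"
  form :: "'u \<Rightarrow> 'u \<Rightarrow> 'a"

definition skew_hermitian_form ::
    "('a, 'r) ring_scheme \<Rightarrow> ('a \<Rightarrow> 'a) \<Rightarrow> ('a, 'u) module \<Rightarrow> ('u \<Rightarrow> 'u \<Rightarrow> 'a) \<Rightarrow> bool" where
  "skew_hermitian_form R bar M \<omega> \<longleftrightarrow>
     \<omega> \<in> carrier M \<rightarrow> carrier M \<rightarrow> carrier R \<and>
     (\<forall>x \<in> carrier M. \<forall>y \<in> carrier M. \<forall>z \<in> carrier M. \<omega> (x \<oplus>\<^bsub>M\<^esub> y) z = \<omega> x z \<oplus>\<^bsub>R\<^esub> \<omega> y z) \<and>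
     (\<forall>r \<in> carrier R. \<forall>x \<in> carrier M. \<forall>y \<in> carrier M. \<omega> (r \<odot>\<^bsub>M\<^esub> x) y = r \<otimes>\<^bsub>R\<^esub> \<omega> x y) \<and>
     (\<forall>x \<in> carrier M. \<forall>y \<in> carrier M. \<omega> x y = \<ominus>\<^bsub>R\<^esub> bar (\<omega> y x)) \<and>
     (\<forall>x \<in> carrier M. (\<forall>y \<in> carrier M. \<omega> x y = \<zero>\<^bsub>R\<^esub>) \<longrightarrow> x = \<zero>\<^bsub>M\<^esub>)"

definition hermitian_modules ::
    "('a, 'r) ring_scheme \<Rightarrow> ('a \<Rightarrow> 'a) \<Rightarrow> ('a, 'u) herm set" where
  "hermitian_modules R bar = {H. module R (umod H) \<and> finitely_generated R (umod H) \<and>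
     skew_hermitian_form R bar (umod H) (form H)}"

definition herm_opp :: "('a, 'r) ring_scheme \<Rightarrow> ('a, 'u) herm \<Rightarrow> ('a, 'u) herm" where
  "herm_opp R H = H\<lparr>form := \<lambda>x y. \<ominus>\<^bsub>R\<^esub> form H x y\<rparr>"

text \<open>The fields \<open>mult\<close> and \<open>one\<close> of a module record are irrelevant to the module structure.\<close>

definition mod_sum :: "('a, 'u) module \<Rightarrow> ('a, 'v) module \<Rightarrow> ('a, 'u \<times> 'v) module" where
  "mod_sum M N = \<lparr>carrier = carrier M \<times> carrier N, mult = undefined, one = undefined,
     zero = (\<zero>\<^bsub>M\<^esub>, \<zero>\<^bsub>N\<^esub>), add = (\<lambda>(x, y) (x', y'). (x \<oplus>\<^bsub>M\<^esub> x', y \<oplus>\<^bsub>N\<^esub> y')),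
     smult = (\<lambda>r (x, y). (r \<odot>\<^bsub>M\<^esub> x, r \<odot>\<^bsub>N\<^esub> y))\<rparr>"

definition herm_sum ::
    "('a, 'r) ring_scheme \<Rightarrow> ('a, 'u) herm \<Rightarrow> ('a, 'v) herm \<Rightarrow> ('a, 'u \<times> 'v) herm" where
  "herm_sum R H K = \<lparr>umod = mod_sum (umod H) (umod K),
     form = (\<lambda>(x, y) (x', y'). form H x x' \<oplus>\<^bsub>R\<^esub> form K y y')\<rparr>"

definition lagrangian :: "('a, 'r) ring_scheme \<Rightarrow> ('a, 'u) herm \<Rightarrow> 'u set \<Rightarrow> bool" where
  "lagrangian R H A \<longleftrightarrow> submodule A R (umod H) \<and>
     A = {x \<in> carrier (umod H). \<forall>v \<in> A. form H v x = \<zero>\<^bsub>R\<^esub>}"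

definition saturation :: "('a, 'r) ring_scheme \<Rightarrow> ('a, 'u) module \<Rightarrow> 'u set \<Rightarrow> 'u set" where
  "saturation R M A = {x \<in> carrier M. \<exists>r \<in> carrier R. r \<noteq> \<zero>\<^bsub>R\<^esub> \<and> r \<odot>\<^bsub>M\<^esub> x \<in> A}"


section \<open>Lagrangian cospans\<close>

record ('a, 'u) mor1 =
  src1 :: "('a, 'u) herm"
  tgt1 :: "('a, 'u) herm"
  csp :: "('a, 'u) cospan"

definition cospan_relation ::
    "('a, 'u) module \<Rightarrow> ('a, 'u) module \<Rightarrow> ('a, 'u) cospan \<Rightarrow> ('u \<times> 'u) set" where
  "cospan_relation X Y C = {(x, y). x \<in> carrier X \<and> y \<in> carrier Y \<and> rleg C y = lleg C x}"

definition lagrangian_cospans ::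
    "('a, 'r) ring_scheme \<Rightarrow> ('a \<Rightarrow> 'a) \<Rightarrow> ('a, 'u) herm \<Rightarrow> ('a, 'u) herm \<Rightarrow> ('a, 'u) mor1 set" where
  "lagrangian_cospans R bar H H' = {T. src1 T = H \<and> tgt1 T = H' \<and>
     H \<in> hermitian_modules R bar \<and> H' \<in> hermitian_modules R bar \<and>
     is_cospan R (umod H) (umod H') (csp T) \<and>
     lagrangian R (herm_sum R (herm_opp R H) H')
       (saturation R (umod (herm_sum R (herm_opp R H) H'))
         (cospan_relation (umod H) (umod H') (csp T)))}"

text \<open>The span \<open>A \<leftarrow> Y \<rightarrow> B\<close> formed by the inner legs of \<open>X \<rightarrow> A \<leftarrow> Y\<close> and \<open>Y \<rightarrow> B \<leftarrow> Z\<close>.\<close>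

definition inner_span ::
    "('a, 'u) module \<Rightarrow> ('a, 'u) cospan \<Rightarrow> ('a, 'u) cospan \<Rightarrow> ('a, 'u) span" where
  "inner_span Y B A =
     \<lparr>centre = Y, lfoot = apex A, rfoot = apex B, lmap = rleg A, rmap = lleg B\<rparr>"

definition cospan_comp ::
    "(('a, 'u) span \<Rightarrow> ('a, 'u) cospan) \<Rightarrow> ('a, 'u) module \<Rightarrow> ('a, 'u) module \<Rightarrow> ('a, 'u) module \<Rightarrow>
     ('a, 'u) cospan \<Rightarrow> ('a, 'u) cospan \<Rightarrow> ('a, 'u) cospan" where
  "cospan_comp po X Y Z B A = (let P = po (inner_span Y B A) in
     \<lparr>apex = apex P, lleg = compose (carrier X) (lleg P) (lleg A),
      rleg = compose (carrier Z) (rleg P) (rleg B)\<rparr>)"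

definition id_mor1 :: "('a, 'u) herm \<Rightarrow> ('a, 'u) mor1" where
  "id_mor1 H = \<lparr>src1 = H, tgt1 = H,
     csp = \<lparr>apex = umod H, lleg = id_hom (umod H), rleg = id_hom (umod H)\<rparr>\<rparr>"

definition comp_mor1 ::
    "(('a, 'u) span \<Rightarrow> ('a, 'u) cospan) \<Rightarrow> ('a, 'u) mor1 \<Rightarrow> ('a, 'u) mor1 \<Rightarrow> ('a, 'u) mor1" where
  "comp_mor1 po T3 T1 = \<lparr>src1 = src1 T1, tgt1 = tgt1 T3,
     csp = cospan_comp po (umod (src1 T1)) (umod (tgt1 T1)) (umod (tgt1 T3)) (csp T3) (csp T1)\<rparr>"

definition mor1_span :: "('a, 'u) mor1 \<Rightarrow> ('a, 'u) mor1 \<Rightarrow> ('a, 'u) span" where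
  "mor1_span T3 T1 = inner_span (umod (tgt1 T1)) (csp T3) (csp T1)"

abbreviation mod1 :: "('a, 'u) mor1 \<Rightarrow> ('a, 'u) module" where
  "mod1 T \<equiv> apex (csp T)"


section \<open>Isomorphism classes of 2-cospans\<close>

definition two_cospans ::
    "('a, 'r) ring_scheme \<Rightarrow> ('a, 'u) mor1 \<Rightarrow> ('a, 'u) mor1 \<Rightarrow> ('a, 'u) cospan set" where
  "two_cospans R T1 T2 = {A. src1 T1 = src1 T2 \<and> tgt1 T1 = tgt1 T2 \<and>
     is_cospan R (mod1 T1) (mod1 T2) A \<and>
     compose (carrier (umod (src1 T1))) (lleg A) (lleg (csp T1))
       = compose (carrier (umod (src1 T1))) (rleg A) (lleg (csp T2)) \<and>
     compose (carrier (umod (tgt1 T1))) (lleg A) (rleg (csp T1))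
       = compose (carrier (umod (tgt1 T1))) (rleg A) (rleg (csp T2))}"

record ('a, 'u) mor2 =
  src2 :: "('a, 'u) mor1"
  tgt2 :: "('a, 'u) mor1"
  cls :: "('a, 'u) cospan set"

definition iso_class ::
    "('a, 'r) ring_scheme \<Rightarrow> ('a, 'u) mor1 \<Rightarrow> ('a, 'u) mor1 \<Rightarrow> ('a, 'u) cospan \<Rightarrow>
     ('a, 'u) cospan set" where
  "iso_class R T1 T2 A = {A' \<in> two_cospans R T1 T2.
     \<exists>f \<in> mod_iso R (apex A) (apex A'). cospan_map R (mod1 T1) (mod1 T2) A A' f}"

definition two_cospan_class ::
    "('a, 'r) ring_scheme \<Rightarrow> ('a, 'u) mor1 \<Rightarrow> ('a, 'u) mor1 \<Rightarrow> ('a, 'u) cospan \<Rightarrow>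
     ('a, 'u) mor2" where
  "two_cospan_class R T1 T2 A = \<lparr>src2 = T1, tgt2 = T2, cls = iso_class R T1 T2 A\<rparr>"

definition two_cospan_classes ::
    "('a, 'r) ring_scheme \<Rightarrow> ('a, 'u) mor1 \<Rightarrow> ('a, 'u) mor1 \<Rightarrow> ('a, 'u) mor2 set" where
  "two_cospan_classes R T1 T2 = two_cospan_class R T1 T2 ` two_cospans R T1 T2"

text \<open>
  Compositions of classes are defined as the union of the classes of the composites of all
  representatives.  This is an isomorphism class exactly because the composite class does not
  depend on the representatives, which is thus part of the closure axioms of a bicategory.
\<close>

definition vcomp_mor2 ::
    "('a, 'r) ring_scheme \<Rightarrow> (('a, 'u) span \<Rightarrow> ('a, 'u) cospan) \<Rightarrow>
     ('a, 'u) mor2 \<Rightarrow> ('a, 'u) mor2 \<Rightarrow> ('a, 'u) mor2" where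
  "vcomp_mor2 R po \<beta> \<alpha> = \<lparr>src2 = src2 \<alpha>, tgt2 = tgt2 \<beta>,
     cls = (\<Union>A \<in> cls \<alpha>. \<Union>B \<in> cls \<beta>. iso_class R (src2 \<alpha>) (tgt2 \<beta>)
       (cospan_comp po (mod1 (src2 \<alpha>)) (mod1 (tgt2 \<alpha>)) (mod1 (tgt2 \<beta>)) B A))\<rparr>"

text \<open>
  The horizontal composite \<open>T3 \<circ> T1 \<rightarrow> B \<bullet> A \<leftarrow> T4 \<circ> T2\<close> of \<open>T1 \<rightarrow> A \<leftarrow> T2\<close> and
  \<open>T3 \<rightarrow> B \<leftarrow> T4\<close>.
\<close>

definition hcomp_cospan ::
    "('a, 'r) ring_scheme \<Rightarrow> (('a, 'u) span \<Rightarrow> ('a, 'u) cospan) \<Rightarrow>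
     ('a, 'u) mor1 \<Rightarrow> ('a, 'u) mor1 \<Rightarrow> ('a, 'u) mor1 \<Rightarrow> ('a, 'u) mor1 \<Rightarrow>
     ('a, 'u) cospan \<Rightarrow> ('a, 'u) cospan \<Rightarrow> ('a, 'u) cospan" where
  "hcomp_cospan R po T1 T2 T3 T4 B A =
     (let H' = umod (tgt1 T1);
          P = po \<lparr>centre = H', lfoot = apex A, rfoot = apex B,
                  lmap = compose (carrier H') (rleg A) (rleg (csp T2)),
                  rmap = compose (carrier H') (lleg B) (lleg (csp T3))\<rparr>
      in \<lparr>apex = apex P,
          lleg = induced_map R po (mor1_span T3 T1)
            \<lparr>apex = apex P, lleg = compose (carrier (mod1 T1)) (lleg P) (lleg A),
             rleg = compose (carrier (mod1 T3)) (rleg P) (lleg B)\<rparr>,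
          rleg = induced_map R po (mor1_span T4 T2)
            \<lparr>apex = apex P, lleg = compose (carrier (mod1 T2)) (lleg P) (rleg A),
             rleg = compose (carrier (mod1 T4)) (rleg P) (rleg B)\<rparr>\<rparr>)"

definition hcomp_mor2 ::
    "('a, 'r) ring_scheme \<Rightarrow> (('a, 'u) span \<Rightarrow> ('a, 'u) cospan) \<Rightarrow>
     ('a, 'u) mor2 \<Rightarrow> ('a, 'u) mor2 \<Rightarrow> ('a, 'u) mor2" where
  "hcomp_mor2 R po \<beta> \<alpha> =
     (let S = comp_mor1 po (src2 \<beta>) (src2 \<alpha>); T = comp_mor1 po (tgt2 \<beta>) (tgt2 \<alpha>)
      in \<lparr>src2 = S, tgt2 = T,
          cls = (\<Union>A \<in> cls \<alpha>. \<Union>B \<in> cls \<beta>. iso_class R S T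
            (hcomp_cospan R po (src2 \<alpha>) (tgt2 \<alpha>) (src2 \<beta>) (tgt2 \<beta>) B A))\<rparr>)"

definition mor2_of_map ::
    "('a, 'r) ring_scheme \<Rightarrow> ('a, 'u) mor1 \<Rightarrow> ('a, 'u) mor1 \<Rightarrow> ('u \<Rightarrow> 'u) \<Rightarrow> ('a, 'u) mor2" where
  "mor2_of_map R T T' f =
     two_cospan_class R T T' \<lparr>apex = mod1 T', lleg = f, rleg = id_hom (mod1 T')\<rparr>"

definition id_mor2 :: "('a, 'r) ring_scheme \<Rightarrow> ('a, 'u) mor1 \<Rightarrow> ('a, 'u) mor2" where
  "id_mor2 R T = mor2_of_map R T T (id_hom (mod1 T))"


section \<open>Associativity and unit isomorphisms\<close>

text \<open>
  The canonical map \<open>(T3 \<circ> T2) \<circ> T1 \<rightarrow> T3 \<circ> (T2 \<circ> T1)\<close> is compatible with the three maps from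
  \<open>T1\<close>, \<open>T2\<close> and \<open>T3\<close>; its restriction to \<open>T3 \<circ> T2\<close> is \<open>u\<close>.
\<close>

definition assoc_map ::
    "('a, 'r) ring_scheme \<Rightarrow> (('a, 'u) span \<Rightarrow> ('a, 'u) cospan) \<Rightarrow>
     ('a, 'u) mor1 \<Rightarrow> ('a, 'u) mor1 \<Rightarrow> ('a, 'u) mor1 \<Rightarrow> 'u \<Rightarrow> 'u" where
  "assoc_map R po T3 T2 T1 =
     (let J = po (mor1_span T2 T1);
          K = po (mor1_span T3 (comp_mor1 po T2 T1));
          u = induced_map R po (mor1_span T3 T2)
                \<lparr>apex = apex K, lleg = compose (carrier (mod1 T2)) (lleg K) (rleg J),
                 rleg = rleg K\<rparr>
      in induced_map R po (mor1_span (comp_mor1 po T3 T2) T1)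
           \<lparr>apex = apex K, lleg = compose (carrier (mod1 T1)) (lleg K) (lleg J), rleg = u\<rparr>)"

definition assoc_mor2 ::
    "('a, 'r) ring_scheme \<Rightarrow> (('a, 'u) span \<Rightarrow> ('a, 'u) cospan) \<Rightarrow>
     ('a, 'u) mor1 \<Rightarrow> ('a, 'u) mor1 \<Rightarrow> ('a, 'u) mor1 \<Rightarrow> ('a, 'u) mor2" where
  "assoc_mor2 R po T3 T2 T1 =
     mor2_of_map R (comp_mor1 po (comp_mor1 po T3 T2) T1) (comp_mor1 po T3 (comp_mor1 po T2 T1))
       (assoc_map R po T3 T2 T1)"

definition lunit_mor2 ::
    "('a, 'r) ring_scheme \<Rightarrow> (('a, 'u) span \<Rightarrow> ('a, 'u) cospan) \<Rightarrow> ('a, 'u) mor1 \<Rightarrow> ('a, 'u) mor2" where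
  "lunit_mor2 R po T = mor2_of_map R (comp_mor1 po (id_mor1 (tgt1 T)) T) T
     (induced_map R po (mor1_span (id_mor1 (tgt1 T)) T)
       \<lparr>apex = mod1 T, lleg = id_hom (mod1 T), rleg = rleg (csp T)\<rparr>)"

definition runit_mor2 ::
    "('a, 'r) ring_scheme \<Rightarrow> (('a, 'u) span \<Rightarrow> ('a, 'u) cospan) \<Rightarrow> ('a, 'u) mor1 \<Rightarrow> ('a, 'u) mor2" where
  "runit_mor2 R po T = mor2_of_map R (comp_mor1 po T (id_mor1 (src1 T))) T
     (induced_map R po (mor1_span T (id_mor1 (src1 T)))
       \<lparr>apex = mod1 T, lleg = lleg (csp T), rleg = id_hom (mod1 T)\<rparr>)"

end

theory Submission
  imports Defs
begin

text \<open>
  The proof has three independent ingredients.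

  Lagrangian relations compose.  Over a field this is a count of dimensions.  Over a domain its
  substitute is \<open>lin_functional_representable\<close>: a linear functional on any submodule of a finitely
  generated module with a non-degenerate form \<open>\<omega>\<close> becomes, after multiplication by a non-zero
  scalar, \<open>\<omega>(-, y)\<close> for some \<open>y\<close>.  If \<open>(x, z)\<close> is orthogonal to the composite of the Lagrangian
  relations \<open>A\<close> and \<open>A'\<close>, then \<open>\<omega>(u, x) - \<omega>''(w, z)\<close>, for \<open>(u, v) \<in> A\<close> and \<open>(v', w) \<in> A'\<close>, vanishes
  whenever \<open>v = v'\<close>, so it is a functional of \<open>v - v'\<close>; an element \<open>y\<close> representing it is the middle
  term which shows that a multiple of \<open>(x, z)\<close> lies in the composite (\<open>lagrangian_relcomp\<close>).

  The relation of a composite cospan is the composite relation.  This needs that two elements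
  identified in a pushout come from the centre of the span.  A chosen pushout is only universal
  among the modules with carrier in the given type, so a cocone with such a carrier has to be
  found that separates all other pairs.  The chosen pushout over a zero module is a biproduct
  inside that type, and choosing representatives of cosets keeps its quotients inside too
  (\<open>pushout_square_kernel\<close>).

  The axioms of a bicategory.  Whether a composite is formed in one order or another, the result
  is a colimit of the same diagram of modules.  Two facts turn this into a proof.  The class of a
  composite can be computed with any pushout square, not only with the chosen one
  (\<open>vcomp_class\<close>, \<open>hcomp_class\<close>).  And pushouts over two spans sharing a foot can be taken in either
  order (\<open>pushout_square_assoc\<close>), and so can those along the rows and the columns of a grid
  (\<open>pushout_square_interchange\<close>).  The first of these gives associativity in the vertical
  direction, and existence and naturality of the associativity isomorphism in the horizontal one.
  For the coherence axioms, compositions of \<open>2\<close>-morphisms coming from maps of cospans come from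
  maps again (\<open>vcomp_map\<close>, \<open>hcomp_map\<close>), so that the pentagon and the triangle are equations
  between maps out of an iterated pushout, which hold because they hold on each of the glued
  modules.
\<close>

section \<open>Linear functionals on modules over a domain\<close>

lemma (in abelian_group) minus_eq_zero_iff:
  assumes "a \<in> carrier G" "b \<in> carrier G"
  shows "a \<ominus> b = \<zero> \<longleftrightarrow> a = b"
  using assms by (metis add.inv_closed minus_eq minus_equality minus_minus r_neg)

context module
begin

inductive_set lin_span :: "'c set \<Rightarrow> 'c set" for S where
  lin_span_zero: "\<zero>\<^bsub>M\<^esub> \<in> lin_span S"
| lin_span_step: "\<lbrakk>x \<in> lin_span S; s \<in> S; r \<in> carrier R\<rbrakk> \<Longrightarrow> x \<oplus>\<^bsub>M\<^esub> r \<odot>\<^bsub>M\<^esub> s \<in> lin_span S"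

lemma lin_span_closed: "\<lbrakk>x \<in> lin_span S; S \<subseteq> carrier M\<rbrakk> \<Longrightarrow> x \<in> carrier M"
  by (induction rule: lin_span.induct) auto

lemma lin_span_mono: "\<lbrakk>x \<in> lin_span S; S \<subseteq> T\<rbrakk> \<Longrightarrow> x \<in> lin_span T"
  by (induction rule: lin_span.induct) (auto intro: lin_span.intros)

lemma lin_span_add:
  assumes S: "S \<subseteq> carrier M" and x: "x \<in> lin_span S" and y: "y \<in> lin_span S"
  shows "x \<oplus>\<^bsub>M\<^esub> y \<in> lin_span S"
  using y
proof (induction rule: lin_span.induct)
  case lin_span_zero
  then show ?case using lin_span_closed[OF x S] x by simp
next
  case (lin_span_step y s r)
  have "x \<oplus>\<^bsub>M\<^esub> (y \<oplus>\<^bsub>M\<^esub> r \<odot>\<^bsub>M\<^esub> s) = (x \<oplus>\<^bsub>M\<^esub> y) \<oplus>\<^bsub>M\<^esub> r \<odot>\<^bsub>M\<^esub> s"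
    using lin_span_closed[OF _ S] x lin_span_step S by (simp add: M.a_assoc subset_iff)
  then show ?case using lin_span.lin_span_step[of "x \<oplus>\<^bsub>M\<^esub> y" S s r] lin_span_step by simp
qed

lemma lin_span_smult:
  assumes S: "S \<subseteq> carrier M" and x: "x \<in> lin_span S" and c: "c \<in> carrier R"
  shows "c \<odot>\<^bsub>M\<^esub> x \<in> lin_span S"
  using x
proof (induction rule: lin_span.induct)
  case lin_span_zero
  then show ?case using c by (simp add: lin_span.lin_span_zero)
next
  case (lin_span_step y s r)
  have "c \<odot>\<^bsub>M\<^esub> (y \<oplus>\<^bsub>M\<^esub> r \<odot>\<^bsub>M\<^esub> s) = c \<odot>\<^bsub>M\<^esub> y \<oplus>\<^bsub>M\<^esub> (c \<otimes> r) \<odot>\<^bsub>M\<^esub> s"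
    using lin_span_closed[OF _ S] c lin_span_step S by (simp add: smult_r_distr smult_assoc1 subset_iff)
  then show ?case using lin_span.lin_span_step[of "c \<odot>\<^bsub>M\<^esub> y" S s "c \<otimes> r"] lin_span_step c by simp
qed

lemma lin_span_insertE:
  assumes x: "x \<in> lin_span (insert e S)" and S: "insert e S \<subseteq> carrier M"
  obtains r z where "r \<in> carrier R" "z \<in> lin_span S" "x = z \<oplus>\<^bsub>M\<^esub> r \<odot>\<^bsub>M\<^esub> e"
proof -
  have "\<exists>r z. r \<in> carrier R \<and> z \<in> lin_span S \<and> x = z \<oplus>\<^bsub>M\<^esub> r \<odot>\<^bsub>M\<^esub> e"
    using x
  proof (induction rule: lin_span.induct)
    case lin_span_zero
    have "\<zero>\<^bsub>M\<^esub> = \<zero>\<^bsub>M\<^esub> \<oplus>\<^bsub>M\<^esub> \<zero> \<odot>\<^bsub>M\<^esub> e" using S by simp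
    then show ?case using lin_span.lin_span_zero R.zero_closed by blast
  next
    case (lin_span_step x s r')
    then obtain r z where rz: "r \<in> carrier R" "z \<in> lin_span S" "x = z \<oplus>\<^bsub>M\<^esub> r \<odot>\<^bsub>M\<^esub> e" by blast
    have c: "z \<in> carrier M" "e \<in> carrier M" "s \<in> carrier M"
      using lin_span_closed rz S lin_span_step by auto
    show ?case
    proof (cases "s = e")
      case True
      then have "x \<oplus>\<^bsub>M\<^esub> r' \<odot>\<^bsub>M\<^esub> s = z \<oplus>\<^bsub>M\<^esub> (r \<oplus> r') \<odot>\<^bsub>M\<^esub> e"
        using c rz lin_span_step by (simp add: M.a_assoc smult_l_distr)
      then show ?thesis using rz lin_span_step by blast
    next
      case False
      then have "x \<oplus>\<^bsub>M\<^esub> r' \<odot>\<^bsub>M\<^esub> s = (z \<oplus>\<^bsub>M\<^esub> r' \<odot>\<^bsub>M\<^esub> s) \<oplus>\<^bsub>M\<^esub> r \<odot>\<^bsub>M\<^esub> e"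
        using c rz lin_span_step by (simp add: M.a_ac)
      moreover have "z \<oplus>\<^bsub>M\<^esub> r' \<odot>\<^bsub>M\<^esub> s \<in> lin_span S"
        using False rz lin_span_step by (auto intro: lin_span.lin_span_step)
      ultimately show ?thesis using rz by blast
    qed
  qed
  then show ?thesis using that by blast
qed

lemma submoduleI_smult:
  assumes "H \<subseteq> carrier M" "\<zero>\<^bsub>M\<^esub> \<in> H"
    and "\<And>a b. \<lbrakk>a \<in> H; b \<in> H\<rbrakk> \<Longrightarrow> a \<oplus>\<^bsub>M\<^esub> b \<in> H"
    and smult: "\<And>a x. \<lbrakk>a \<in> carrier R; x \<in> H\<rbrakk> \<Longrightarrow> a \<odot>\<^bsub>M\<^esub> x \<in> H"
  shows "submodule H R M"
proof (rule submoduleI)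
  fix a assume a: "a \<in> H"
  then have "(\<ominus> \<one>) \<odot>\<^bsub>M\<^esub> a = \<ominus>\<^bsub>M\<^esub> a" using assms(1) by (subst smult_l_minus) auto
  then show "\<ominus>\<^bsub>M\<^esub> a \<in> H" using smult[OF _ a, of "\<ominus> \<one>"] by simp
qed (use assms in auto)

lemma submodule_zero:
  assumes "submodule H R M" shows "\<zero>\<^bsub>M\<^esub> \<in> H"
proof -
  note H = submoduleE[OF assms]
  obtain d where "d \<in> H" using H(2) by blast
  then have "\<zero> \<odot>\<^bsub>M\<^esub> d = \<zero>\<^bsub>M\<^esub>" "\<zero> \<odot>\<^bsub>M\<^esub> d \<in> H" using H by auto
  then show ?thesis by simp
qed

text \<open>
  A submodule \<open>D\<close> of a finitely generated module need not be finitely generated, but up to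
  saturation it is.  One removes the generators of the ambient module one at a time: if some
  \<open>d1 \<in> D\<close> has a non-zero coefficient \<open>a1\<close> at the generator \<open>e\<close>, then for every other \<open>d \<in> D\<close>, with
  coefficient \<open>a\<close>, the combination \<open>a1 d - a d1\<close> is in the span of the remaining generators.
\<close>

lemma finite_rank:
  assumes "domain R" "finite S" "S \<subseteq> carrier M" "submodule D R M" "D \<subseteq> lin_span S"
  obtains S0 where "finite S0" "S0 \<subseteq> D"
    "\<And>d. d \<in> D \<Longrightarrow> \<exists>r\<in>carrier R. r \<noteq> \<zero> \<and> r \<odot>\<^bsub>M\<^esub> d \<in> lin_span S0"
proof -
  interpret R: domain R by fact
  have "\<exists>S0. finite S0 \<and> S0 \<subseteq> D \<and> (\<forall>d\<in>D. \<exists>r\<in>carrier R. r \<noteq> \<zero> \<and> r \<odot>\<^bsub>M\<^esub> d \<in> lin_span S0)"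
    using assms(2-)
  proof (induction S arbitrary: D rule: finite_induct)
    case empty
    have "x = \<zero>\<^bsub>M\<^esub>" if "x \<in> lin_span {}" for x
      using that by (induction rule: lin_span.induct) auto
    then have "\<forall>d\<in>D. \<exists>r\<in>carrier R. r \<noteq> \<zero> \<and> r \<odot>\<^bsub>M\<^esub> d \<in> lin_span {}"
      using empty R.one_closed R.one_not_zero by (metis lin_span.lin_span_zero smult_r_null subsetD)
    then show ?case by blast
  next
    case (insert e S)
    note D = submoduleE[OF insert.prems(2)]
    have S: "S \<subseteq> carrier M" "e \<in> carrier M" using insert by auto
    define D0 where "D0 = D \<inter> lin_span S"
    have "submodule D0 R M"
    proof (rule submoduleI_smult)
      show "\<zero>\<^bsub>M\<^esub> \<in> D0" using submodule_zero[OF insert.prems(2)] by (simp add: D0_def lin_span.lin_span_zero)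
    qed (use D S in \<open>auto simp: D0_def intro: lin_span_add lin_span_smult\<close>)
    then obtain S0 where S0: "finite S0" "S0 \<subseteq> D0"
      "\<And>d. d \<in> D0 \<Longrightarrow> \<exists>r\<in>carrier R. r \<noteq> \<zero> \<and> r \<odot>\<^bsub>M\<^esub> d \<in> lin_span S0"
      using insert.IH[of D0] S unfolding D0_def by auto
    show ?case
    proof (cases "D \<subseteq> lin_span S")
      case True
      then have "D0 = D" by (auto simp: D0_def)
      then show ?thesis using S0 by blast
    next
      case False
      then obtain d1 where d1: "d1 \<in> D" "d1 \<notin> lin_span S" by blast
      then obtain a1 z1 where az1: "a1 \<in> carrier R" "z1 \<in> lin_span S" "d1 = z1 \<oplus>\<^bsub>M\<^esub> a1 \<odot>\<^bsub>M\<^esub> e"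
        using lin_span_insertE[of d1 e S] insert.prems by blast
      have a1: "a1 \<noteq> \<zero>"
        using az1 d1 S lin_span_closed by auto
      have "\<exists>r\<in>carrier R. r \<noteq> \<zero> \<and> r \<odot>\<^bsub>M\<^esub> d \<in> lin_span (insert d1 S0)" if d: "d \<in> D" for d
      proof -
        obtain a z where az: "a \<in> carrier R" "z \<in> lin_span S" "d = z \<oplus>\<^bsub>M\<^esub> a \<odot>\<^bsub>M\<^esub> e"
          using lin_span_insertE[of d e S] d insert.prems by blast
        have c: "z \<in> carrier M" "z1 \<in> carrier M" "e \<in> carrier M" "d \<in> carrier M" "d1 \<in> carrier M"
          using lin_span_closed S az az1 d d1 D by auto
        let ?c = "a1 \<odot>\<^bsub>M\<^esub> d \<oplus>\<^bsub>M\<^esub> (\<ominus> a) \<odot>\<^bsub>M\<^esub> d1"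
        have "?c = (a1 \<odot>\<^bsub>M\<^esub> z \<oplus>\<^bsub>M\<^esub> (\<ominus> a) \<odot>\<^bsub>M\<^esub> z1) \<oplus>\<^bsub>M\<^esub> (a1 \<otimes> a \<oplus> (\<ominus> a) \<otimes> a1) \<odot>\<^bsub>M\<^esub> e"
          unfolding az(3) az1(3) using c(1-3) az az1
          by (simp add: smult_r_distr smult_l_distr smult_assoc1 M.a_ac)
        also have "a1 \<otimes> a \<oplus> (\<ominus> a) \<otimes> a1 = \<zero>"
          using az az1 by (simp add: R.l_minus R.m_comm[of a a1] R.r_neg)
        finally have "?c \<in> lin_span S"
          using c az az1 S by (auto intro!: lin_span_add lin_span_smult)
        then have "?c \<in> D0" unfolding D0_def using d d1 az az1 D by auto
        then obtain r where r: "r \<in> carrier R" "r \<noteq> \<zero>" "r \<odot>\<^bsub>M\<^esub> ?c \<in> lin_span S0" using S0 by blast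
        have "(r \<otimes> a1) \<odot>\<^bsub>M\<^esub> d = r \<odot>\<^bsub>M\<^esub> ?c \<oplus>\<^bsub>M\<^esub> (r \<otimes> a) \<odot>\<^bsub>M\<^esub> d1"
        proof -
          have "r \<odot>\<^bsub>M\<^esub> ?c \<oplus>\<^bsub>M\<^esub> (r \<otimes> a) \<odot>\<^bsub>M\<^esub> d1
            = (r \<otimes> a1) \<odot>\<^bsub>M\<^esub> d \<oplus>\<^bsub>M\<^esub> (r \<otimes> (\<ominus> a) \<oplus> r \<otimes> a) \<odot>\<^bsub>M\<^esub> d1"
            using c(4,5) r(1) az(1) az1(1) by (simp add: smult_r_distr smult_l_distr smult_assoc1 M.a_assoc)
          also have "r \<otimes> (\<ominus> a) \<oplus> r \<otimes> a = \<zero>" using r az by (simp add: R.r_minus R.l_neg)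
          finally show ?thesis using c r az1 by simp
        qed
        moreover have "r \<odot>\<^bsub>M\<^esub> ?c \<oplus>\<^bsub>M\<^esub> (r \<otimes> a) \<odot>\<^bsub>M\<^esub> d1 \<in> lin_span (insert d1 S0)"
          using r az by (intro lin_span.lin_span_step) (auto elim: lin_span_mono)
        moreover have "r \<otimes> a1 \<noteq> \<zero>" using r az1 a1 by (simp add: R.integral_iff)
        ultimately show ?thesis using r az1 by (metis R.m_closed)
      qed
      then show ?thesis using S0 d1 by (intro exI[of _ "insert d1 S0"]) (auto simp: D0_def)
    qed
  qed
  then show ?thesis using that by blast
qed

end

lemma finitely_generated_lin_span:
  fixes R (structure) and M :: "('a, 'u) module" (structure)
  assumes "module R M" "finitely_generated R M"
  obtains S where "finite S" "S \<subseteq> carrier M" "carrier M \<subseteq> module.lin_span R M S"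
proof -
  interpret module R M by fact
  from assms obtain S where S: "finite S" "S \<subseteq> carrier M"
    and gen: "\<And>x. x \<in> carrier M \<Longrightarrow> \<exists>c \<in> S \<rightarrow> carrier R. x = (\<Oplus>\<^bsub>M\<^esub>s\<in>S. c s \<odot>\<^bsub>M\<^esub> s)"
    unfolding finitely_generated_def by blast
  have "(\<Oplus>\<^bsub>M\<^esub>s\<in>T. c s \<odot>\<^bsub>M\<^esub> s) \<in> lin_span S" if "finite T" "T \<subseteq> S" "c \<in> S \<rightarrow> carrier R" for T c
    using that
  proof (induction T rule: finite_induct)
    case empty
    then show ?case by (simp add: lin_span.lin_span_zero)
  next
    case (insert t T)
    have "(\<Oplus>\<^bsub>M\<^esub>s\<in>insert t T. c s \<odot>\<^bsub>M\<^esub> s) = c t \<odot>\<^bsub>M\<^esub> t \<oplus>\<^bsub>M\<^esub> (\<Oplus>\<^bsub>M\<^esub>s\<in>T. c s \<odot>\<^bsub>M\<^esub> s)"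
      using insert S by (intro M.finsum_insert) auto
    also have "\<dots> = (\<Oplus>\<^bsub>M\<^esub>s\<in>T. c s \<odot>\<^bsub>M\<^esub> s) \<oplus>\<^bsub>M\<^esub> c t \<odot>\<^bsub>M\<^esub> t"
      using insert S by (intro M.a_comm M.finsum_closed) auto
    finally show ?case
      using insert by (auto intro: lin_span.lin_span_step)
  qed
  then have "carrier M \<subseteq> lin_span S" using gen S(1) by fastforce
  then show ?thesis using that S by blast
qed

lemma submodule_saturation:
  assumes "domain R" "module R M" "submodule A R M"
  shows "submodule (saturation R M A) R M"
proof -
  interpret R: domain R by fact
  interpret module R M by fact
  note A = submoduleE[OF assms(3)]
  have sm: "s \<odot>\<^bsub>M\<^esub> x \<in> saturation R M A" if x: "x \<in> saturation R M A" and s: "s \<in> carrier R" for s x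
  proof -
    obtain r where r: "x \<in> carrier M" "r \<in> carrier R" "r \<noteq> \<zero>\<^bsub>R\<^esub>" "r \<odot>\<^bsub>M\<^esub> x \<in> A"
      using x unfolding saturation_def by blast
    then have "r \<odot>\<^bsub>M\<^esub> (s \<odot>\<^bsub>M\<^esub> x) = s \<odot>\<^bsub>M\<^esub> (r \<odot>\<^bsub>M\<^esub> x)"
      using s by (simp add: R.m_comm flip: smult_assoc1)
    then show ?thesis using A(4) r s unfolding saturation_def by auto
  qed
  show ?thesis
  proof (rule submoduleI_smult)
    show "\<zero>\<^bsub>M\<^esub> \<in> saturation R M A"
      unfolding saturation_def using submodule_zero[OF assms(3)] R.one_closed R.one_not_zero
      by (force intro: bexI[of _ "\<one>\<^bsub>R\<^esub>"])
    fix a b assume "a \<in> saturation R M A" "b \<in> saturation R M A"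
    then obtain r s where r: "a \<in> carrier M" "r \<in> carrier R" "r \<noteq> \<zero>\<^bsub>R\<^esub>" "r \<odot>\<^bsub>M\<^esub> a \<in> A"
      and s: "b \<in> carrier M" "s \<in> carrier R" "s \<noteq> \<zero>\<^bsub>R\<^esub>" "s \<odot>\<^bsub>M\<^esub> b \<in> A"
      unfolding saturation_def by blast
    have "(r \<otimes>\<^bsub>R\<^esub> s) \<odot>\<^bsub>M\<^esub> (a \<oplus>\<^bsub>M\<^esub> b) = s \<odot>\<^bsub>M\<^esub> (r \<odot>\<^bsub>M\<^esub> a) \<oplus>\<^bsub>M\<^esub> r \<odot>\<^bsub>M\<^esub> (s \<odot>\<^bsub>M\<^esub> b)"
      using r s by (simp add: smult_r_distr R.m_comm flip: smult_assoc1)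
    also have "\<dots> \<in> A" using r s A by auto
    finally show "a \<oplus>\<^bsub>M\<^esub> b \<in> saturation R M A"
      unfolding saturation_def using r s
      by (auto simp: R.integral_iff intro!: bexI[of _ "r \<otimes>\<^bsub>R\<^esub> s"])
  qed (use sm in \<open>auto simp: saturation_def\<close>)
qed

locale hermitian_module = module R M + domain R
  for R :: "('a, 'r) ring_scheme" (structure) and M :: "('a, 'u) module" (structure) +
  fixes bar :: "'a \<Rightarrow> 'a" and \<omega> :: "'u \<Rightarrow> 'u \<Rightarrow> 'a"
  assumes invol: "ring_involution R bar" and skew: "skew_hermitian_form R bar M \<omega>"
begin

lemma bar_closed [simp]: "r \<in> carrier R \<Longrightarrow> bar r \<in> carrier R"
  using invol unfolding ring_involution_def by (auto dest: ring_hom_closed)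

lemma bar_bar [simp]: "r \<in> carrier R \<Longrightarrow> bar (bar r) = r"
  using invol unfolding ring_involution_def by auto

lemma bar_mult: "\<lbrakk>r \<in> carrier R; s \<in> carrier R\<rbrakk> \<Longrightarrow> bar (r \<otimes> s) = bar r \<otimes> bar s"
  using invol unfolding ring_involution_def by (auto dest: ring_hom_mult)

lemma bar_add: "\<lbrakk>r \<in> carrier R; s \<in> carrier R\<rbrakk> \<Longrightarrow> bar (r \<oplus> s) = bar r \<oplus> bar s"
  using invol unfolding ring_involution_def by (auto dest: ring_hom_add)

lemma bar_zero [simp]: "bar \<zero> = \<zero>"
  using invol unfolding ring_involution_def by (auto intro: ring_hom_zero R.ring_axioms)

lemma bar_nonzero: "\<lbrakk>r \<in> carrier R; r \<noteq> \<zero>\<rbrakk> \<Longrightarrow> bar r \<noteq> \<zero>"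
  by (metis bar_bar bar_zero)

lemma form_closed [simp]: "\<lbrakk>x \<in> carrier M; y \<in> carrier M\<rbrakk> \<Longrightarrow> \<omega> x y \<in> carrier R"
  using skew unfolding skew_hermitian_form_def by blast

lemma form_add_left: "\<lbrakk>x \<in> carrier M; y \<in> carrier M; z \<in> carrier M\<rbrakk> \<Longrightarrow>
    \<omega> (x \<oplus>\<^bsub>M\<^esub> y) z = \<omega> x z \<oplus> \<omega> y z"
  using skew unfolding skew_hermitian_form_def by blast

lemma form_smult_left: "\<lbrakk>r \<in> carrier R; x \<in> carrier M; y \<in> carrier M\<rbrakk> \<Longrightarrow>
    \<omega> (r \<odot>\<^bsub>M\<^esub> x) y = r \<otimes> \<omega> x y"
  using skew unfolding skew_hermitian_form_def by blast

lemma form_skew: "\<lbrakk>x \<in> carrier M; y \<in> carrier M\<rbrakk> \<Longrightarrow> \<omega> x y = \<ominus> bar (\<omega> y x)"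
  using skew unfolding skew_hermitian_form_def by blast

lemma form_nondegenerate: "\<lbrakk>x \<in> carrier M; \<And>y. y \<in> carrier M \<Longrightarrow> \<omega> x y = \<zero>\<rbrakk> \<Longrightarrow> x = \<zero>\<^bsub>M\<^esub>"
  using skew unfolding skew_hermitian_form_def by blast

lemma form_add_right: "\<lbrakk>x \<in> carrier M; y \<in> carrier M; z \<in> carrier M\<rbrakk> \<Longrightarrow>
    \<omega> x (y \<oplus>\<^bsub>M\<^esub> z) = \<omega> x y \<oplus> \<omega> x z"
  by (simp add: form_skew[of x] form_add_left bar_add R.minus_add)

lemma form_smult_right: "\<lbrakk>r \<in> carrier R; x \<in> carrier M; y \<in> carrier M\<rbrakk> \<Longrightarrow>
    \<omega> x (r \<odot>\<^bsub>M\<^esub> y) = bar r \<otimes> \<omega> x y"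
  by (simp add: form_skew[of x] form_smult_left bar_mult R.r_minus)

lemma form_zero_left [simp]: "y \<in> carrier M \<Longrightarrow> \<omega> \<zero>\<^bsub>M\<^esub> y = \<zero>"
  using form_smult_left[of \<zero> "\<zero>\<^bsub>M\<^esub>" y] by simp

lemma form_minus_left: "\<lbrakk>x \<in> carrier M; y \<in> carrier M\<rbrakk> \<Longrightarrow> \<omega> (\<ominus>\<^bsub>M\<^esub> x) y = \<ominus> \<omega> x y"
  using form_smult_left[of "\<ominus> \<one>" x y] by (simp add: smult_l_minus R.l_minus)

text \<open>
  The values of the form lie in a domain, so non-degeneracy excludes torsion.
\<close>

lemma torsion_free:
  assumes "r \<in> carrier R" "r \<noteq> \<zero>" "x \<in> carrier M" "r \<odot>\<^bsub>M\<^esub> x = \<zero>\<^bsub>M\<^esub>"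
  shows "x = \<zero>\<^bsub>M\<^esub>"
proof (rule form_nondegenerate)
  fix y assume y: "y \<in> carrier M"
  have "r \<otimes> \<omega> x y = \<omega> (r \<odot>\<^bsub>M\<^esub> x) y" using assms(1,3) y by (simp add: form_smult_left)
  then show "\<omega> x y = \<zero>" using assms y integral_iff[of r "\<omega> x y"] by simp
qed (use assms in auto)

text \<open>
  This is a statement about the functionals \<open>\<omega> s\<close>: a functional that vanishes on the common kernel of
  finitely many others is, up to a scalar, a combination of them.  In the induction step, a vector
  \<open>y0\<close> of the common kernel with \<open>\<omega> e y0 \<noteq> 0\<close> serves to project the kernel for \<open>S\<close> onto the kernel for
  \<open>insert e S\<close>; evaluating \<open>\<omega> d\<close> on the projection shows that \<open>t d - c e\<close> satisfies the hypothesis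
  for \<open>S\<close>.  Non-degeneracy is what turns a relation between functionals into one between elements.
\<close>

lemma double_orthogonal:
  assumes "finite S" "S \<subseteq> carrier M" "d \<in> carrier M"
    and "\<And>y. \<lbrakk>y \<in> carrier M; \<And>s. s \<in> S \<Longrightarrow> \<omega> s y = \<zero>\<rbrakk> \<Longrightarrow> \<omega> d y = \<zero>"
  shows "\<exists>r\<in>carrier R. r \<noteq> \<zero> \<and> r \<odot>\<^bsub>M\<^esub> d \<in> lin_span S"
  using assms
proof (induction S arbitrary: d rule: finite_induct)
  case empty
  then have "d = \<zero>\<^bsub>M\<^esub>" using form_nondegenerate by blast
  then show ?case by (intro bexI[of _ \<one>]) (auto intro: lin_span.intros)
next
  case (insert e S)
  have e: "e \<in> carrier M" and S: "S \<subseteq> carrier M" using insert by auto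
  show ?case
  proof (cases "\<forall>y\<in>carrier M. (\<forall>s\<in>S. \<omega> s y = \<zero>) \<longrightarrow> \<omega> e y = \<zero>")
    case True
    then have "\<exists>r\<in>carrier R. r \<noteq> \<zero> \<and> r \<odot>\<^bsub>M\<^esub> d \<in> lin_span S"
    proof (intro insert.IH)
      fix y assume "y \<in> carrier M" "\<And>s. s \<in> S \<Longrightarrow> \<omega> s y = \<zero>"
      then show "\<omega> d y = \<zero>" using True by (intro insert.prems(3)) auto
    qed (use insert in auto)
    then show ?thesis by (auto intro: lin_span_mono)
  next
    case False
    then obtain y0 where y0: "y0 \<in> carrier M" "\<And>s. s \<in> S \<Longrightarrow> \<omega> s y0 = \<zero>" "\<omega> e y0 \<noteq> \<zero>" by blast
    define t where "t = \<omega> e y0"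
    define c where "c = \<omega> d y0"
    have tc: "t \<in> carrier R" "c \<in> carrier R" "t \<noteq> \<zero>"
      using y0 e insert by (auto simp: t_def c_def)
    let ?d = "t \<odot>\<^bsub>M\<^esub> d \<oplus>\<^bsub>M\<^esub> (\<ominus> c) \<odot>\<^bsub>M\<^esub> e"
    have "\<exists>r\<in>carrier R. r \<noteq> \<zero> \<and> r \<odot>\<^bsub>M\<^esub> ?d \<in> lin_span S"
    proof (rule insert.IH[OF S])
      show "?d \<in> carrier M" using tc e insert by simp
      fix y assume y: "y \<in> carrier M" and Sy: "\<And>s. s \<in> S \<Longrightarrow> \<omega> s y = \<zero>"
      let ?b = "\<omega> e y"
      let ?y = "bar t \<odot>\<^bsub>M\<^esub> y \<oplus>\<^bsub>M\<^esub> bar (\<ominus> ?b) \<odot>\<^bsub>M\<^esub> y0"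
      have b: "?b \<in> carrier R" using e y by simp
      have y': "?y \<in> carrier M" using tc b y y0 by simp
      have expand: "\<omega> x ?y = t \<otimes> \<omega> x y \<oplus> (\<ominus> ?b) \<otimes> \<omega> x y0" if "x \<in> carrier M" for x
        using that tc b y y0 by (simp add: form_add_right form_smult_right)
      have "\<omega> s ?y = \<zero>" if "s \<in> insert e S" for s
      proof (cases "s = e")
        case True
        show ?thesis unfolding True expand[OF e] t_def[symmetric]
          using b tc by (simp add: R.l_minus R.r_minus R.m_comm[of _ t] R.r_neg)
      next
        case False
        then have s: "s \<in> S" "s \<in> carrier M" using that S by auto
        show ?thesis unfolding expand[OF s(2)] using y0 Sy s b tc by simp
      qed
      then have "\<omega> d ?y = \<zero>" using insert.prems(3) y' by blast
      then have "t \<otimes> \<omega> d y \<oplus> (\<ominus> ?b) \<otimes> c = \<zero>" using expand insert by (simp add: c_def)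
      moreover have "\<omega> ?d y = t \<otimes> \<omega> d y \<oplus> (\<ominus> c) \<otimes> ?b"
        using tc insert e y by (simp add: form_add_left form_smult_left)
      ultimately show "\<omega> ?d y = \<zero>"
        using b tc by (simp add: R.l_minus R.r_minus R.m_comm[of _ c])
    qed
    then obtain r where r: "r \<in> carrier R" "r \<noteq> \<zero>" "r \<odot>\<^bsub>M\<^esub> ?d \<in> lin_span S" by blast
    have d: "d \<in> carrier M" using insert by simp
    have "r \<odot>\<^bsub>M\<^esub> ?d \<oplus>\<^bsub>M\<^esub> (r \<otimes> c) \<odot>\<^bsub>M\<^esub> e
        = (r \<otimes> t) \<odot>\<^bsub>M\<^esub> d \<oplus>\<^bsub>M\<^esub> (r \<otimes> (\<ominus> c) \<oplus> r \<otimes> c) \<odot>\<^bsub>M\<^esub> e"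
      using d e r tc by (simp add: smult_r_distr smult_l_distr smult_assoc1 M.a_assoc)
    also have "r \<otimes> (\<ominus> c) \<oplus> r \<otimes> c = \<zero>" using r tc by (simp add: R.r_minus R.l_neg)
    finally have "(r \<otimes> t) \<odot>\<^bsub>M\<^esub> d = r \<odot>\<^bsub>M\<^esub> ?d \<oplus>\<^bsub>M\<^esub> (r \<otimes> c) \<odot>\<^bsub>M\<^esub> e"
      using d e r tc by simp
    then have "(r \<otimes> t) \<odot>\<^bsub>M\<^esub> d \<in> lin_span (insert e S)"
      using r tc by (auto intro!: lin_span.lin_span_step elim: lin_span_mono)
    then show ?thesis using r tc by (intro bexI[of _ "r \<otimes> t"]) (auto simp: integral_iff)
  qed
qed

text \<open>
  A functional is given by its graph \<open>G\<close>.  If \<open>y0\<close> represents it on the span of \<open>S\<close> and is off by \<open>p\<close>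
  at a further element \<open>e\<close>, it is corrected by a multiple of a vector orthogonal to \<open>S\<close> but not to
  \<open>e\<close>.  Such a vector exists by \<open>double_orthogonal\<close>, because otherwise a multiple of \<open>e\<close> would lie
  in the span of \<open>S\<close>, where the error is zero.
\<close>

lemma lin_functional_on_finite:
  assumes "finite S" "S \<subseteq> fst ` G" and G: "G \<subseteq> carrier M \<times> carrier R"
    and add: "\<And>h c h' c'. \<lbrakk>(h, c) \<in> G; (h', c') \<in> G\<rbrakk> \<Longrightarrow> (h \<oplus>\<^bsub>M\<^esub> h', c \<oplus> c') \<in> G"
    and smult: "\<And>r h c. \<lbrakk>r \<in> carrier R; (h, c) \<in> G\<rbrakk> \<Longrightarrow> (r \<odot>\<^bsub>M\<^esub> h, r \<otimes> c) \<in> G"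
    and zero: "(\<zero>\<^bsub>M\<^esub>, \<zero>) \<in> G"
    and single: "\<And>h c c'. \<lbrakk>(h, c) \<in> G; (h, c') \<in> G\<rbrakk> \<Longrightarrow> c = c'"
  shows "\<exists>s\<in>carrier R. \<exists>y\<in>carrier M. s \<noteq> \<zero> \<and> (\<forall>h\<in>lin_span S. \<exists>c. (h, c) \<in> G \<and> s \<otimes> c = \<omega> h y)"
proof -
  have Gc: "h \<in> carrier M" "c \<in> carrier R" if "(h, c) \<in> G" for h c using G that by auto
  have to_span: "\<exists>c. (h, c) \<in> G \<and> s \<otimes> c = \<omega> h y"
    if "h \<in> lin_span S" "s \<in> carrier R" "y \<in> carrier M"
      and S: "\<And>d. d \<in> S \<Longrightarrow> \<exists>c. (d, c) \<in> G \<and> s \<otimes> c = \<omega> d y" for h s y S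
    using that(1)
  proof (induction rule: lin_span.induct)
    case lin_span_zero
    then show ?case using zero that by auto
  next
    case (lin_span_step x d r)
    obtain c where c: "(x, c) \<in> G" "s \<otimes> c = \<omega> x y" using lin_span_step by blast
    obtain c' where c': "(d, c') \<in> G" "s \<otimes> c' = \<omega> d y" using S lin_span_step by blast
    have "s \<otimes> (c \<oplus> r \<otimes> c') = s \<otimes> c \<oplus> r \<otimes> (s \<otimes> c')"
      using Gc c c' that lin_span_step by (simp add: R.r_distr R.m_lcomm)
    also have "\<dots> = \<omega> (x \<oplus>\<^bsub>M\<^esub> r \<odot>\<^bsub>M\<^esub> d) y"
      using Gc c c' that lin_span_step by (simp add: form_add_left form_smult_left)
    finally show ?case using add smult c c' lin_span_step by blast
  qed
  have "\<exists>s\<in>carrier R. \<exists>y\<in>carrier M. s \<noteq> \<zero> \<and> (\<forall>d\<in>S. \<exists>c. (d, c) \<in> G \<and> s \<otimes> c = \<omega> d y)"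
    using assms(1,2)
  proof (induction S rule: finite_induct)
    case empty
    show ?case by (intro bexI[of _ \<one>] bexI[of _ "\<zero>\<^bsub>M\<^esub>"]) auto
  next
    case (insert e S)
    then obtain s0 y0 where sy: "s0 \<in> carrier R" "y0 \<in> carrier M" "s0 \<noteq> \<zero>"
      "\<And>d. d \<in> S \<Longrightarrow> \<exists>c. (d, c) \<in> G \<and> s0 \<otimes> c = \<omega> d y0" by auto
    obtain ce where ce: "(e, ce) \<in> G" using insert by auto
    have e: "e \<in> carrier M" "ce \<in> carrier R" using Gc ce by auto
    have S: "S \<subseteq> carrier M" using insert G by auto
    define p where "p = s0 \<otimes> ce \<ominus> \<omega> e y0"
    have p: "p \<in> carrier R" using sy e by (simp add: p_def)
    have ep: "s0 \<otimes> ce = \<omega> e y0 \<oplus> p" using sy e unfolding p_def R.minus_eq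
      by (metis R.a_lcomm R.a_inv_closed R.m_closed R.r_neg R.r_zero form_closed)
    show ?case
    proof (cases "p = \<zero>")
      case True
      then have "\<exists>c. (e, c) \<in> G \<and> s0 \<otimes> c = \<omega> e y0" using ep ce sy e by auto
      then show ?thesis using sy by auto
    next
      case False
      have "\<exists>y1\<in>carrier M. (\<forall>s\<in>S. \<omega> s y1 = \<zero>) \<and> \<omega> e y1 \<noteq> \<zero>"
      proof (rule ccontr)
        assume "\<not> ?thesis"
        then have "\<exists>r\<in>carrier R. r \<noteq> \<zero> \<and> r \<odot>\<^bsub>M\<^esub> e \<in> lin_span S"
          using insert S e by (intro double_orthogonal) auto
        then obtain r where r: "r \<in> carrier R" "r \<noteq> \<zero>" "r \<odot>\<^bsub>M\<^esub> e \<in> lin_span S" by blast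
        obtain c where "(r \<odot>\<^bsub>M\<^esub> e, c) \<in> G" "s0 \<otimes> c = \<omega> (r \<odot>\<^bsub>M\<^esub> e) y0"
          using to_span[OF r(3) sy(1,2) sy(4)] by blast
        moreover have "c = r \<otimes> ce" using single smult[OF r(1) ce] calculation by blast
        ultimately have "r \<otimes> (s0 \<otimes> ce) = r \<otimes> \<omega> e y0"
          using r sy e by (simp add: form_smult_left R.m_lcomm)
        then have "s0 \<otimes> ce = \<omega> e y0" using m_lcancel[of r "s0 \<otimes> ce" "\<omega> e y0"] r sy e by simp
        then show False using False sy e by (simp add: p_def R.minus_eq R.r_neg)
      qed
      then obtain y1 where y1: "y1 \<in> carrier M" "\<And>s. s \<in> S \<Longrightarrow> \<omega> s y1 = \<zero>" "\<omega> e y1 \<noteq> \<zero>" by blast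
      define t where "t = \<omega> e y1"
      have t: "t \<in> carrier R" "t \<noteq> \<zero>" using y1 e by (auto simp: t_def)
      let ?y = "bar t \<odot>\<^bsub>M\<^esub> y0 \<oplus>\<^bsub>M\<^esub> bar p \<odot>\<^bsub>M\<^esub> y1"
      have expand: "\<omega> x ?y = t \<otimes> \<omega> x y0 \<oplus> p \<otimes> \<omega> x y1" if "x \<in> carrier M" for x
        using that t p y1 sy by (simp add: form_add_right form_smult_right)
      have "\<exists>c. (d, c) \<in> G \<and> (t \<otimes> s0) \<otimes> c = \<omega> d ?y" if "d \<in> insert e S" for d
      proof (cases "d = e")
        case True
        have "(t \<otimes> s0) \<otimes> ce = t \<otimes> (\<omega> e y0 \<oplus> p)" using t sy e ep by (simp add: R.m_assoc)
        also have "\<dots> = \<omega> e ?y"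
          unfolding expand[OF e(1)] t_def[symmetric] using t p sy e
          by (simp add: R.r_distr R.m_comm[of p t])
        finally show ?thesis using ce True by blast
      next
        case False
        then have d: "d \<in> S" "d \<in> carrier M" using that S by auto
        obtain c where c: "(d, c) \<in> G" "s0 \<otimes> c = \<omega> d y0" using sy d by blast
        have "(t \<otimes> s0) \<otimes> c = \<omega> d ?y"
          unfolding expand[OF d(2)] using c t p sy d y1 Gc[OF c(1)] by (simp add: R.m_assoc)
        then show ?thesis using c by blast
      qed
      moreover have "t \<otimes> s0 \<noteq> \<zero>" using t sy by (simp add: integral_iff)
      moreover have "?y \<in> carrier M" using t p sy y1 by simp
      ultimately show ?thesis using t sy by (meson R.m_closed)
    qed
  qed
  then show ?thesis using to_span by meson
qed

text \<open>
  An equation between scalars can be tested after multiplying by a non-zero scalar, so it is enough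
  to represent the functional on a finite set such that every element of the domain of \<open>G\<close> has a
  non-zero multiple in its span.
\<close>

lemma lin_functional_representable:
  assumes fg: "finitely_generated R M" and G: "G \<subseteq> carrier M \<times> carrier R"
    and add: "\<And>h c h' c'. \<lbrakk>(h, c) \<in> G; (h', c') \<in> G\<rbrakk> \<Longrightarrow> (h \<oplus>\<^bsub>M\<^esub> h', c \<oplus> c') \<in> G"
    and smult: "\<And>r h c. \<lbrakk>r \<in> carrier R; (h, c) \<in> G\<rbrakk> \<Longrightarrow> (r \<odot>\<^bsub>M\<^esub> h, r \<otimes> c) \<in> G"
    and zero: "(\<zero>\<^bsub>M\<^esub>, \<zero>) \<in> G"
    and single: "\<And>c. (\<zero>\<^bsub>M\<^esub>, c) \<in> G \<Longrightarrow> c = \<zero>"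
  shows "\<exists>s\<in>carrier R. \<exists>y\<in>carrier M. s \<noteq> \<zero> \<and> (\<forall>(h, c)\<in>G. s \<otimes> c = \<omega> h y)"
proof -
  have Gc: "h \<in> carrier M" "c \<in> carrier R" if "(h, c) \<in> G" for h c using G that by auto
  have single': "c = c'" if "(h, c) \<in> G" "(h, c') \<in> G" for h c c'
  proof -
    have "(h \<oplus>\<^bsub>M\<^esub> (\<ominus> \<one>) \<odot>\<^bsub>M\<^esub> h, c \<oplus> (\<ominus> \<one>) \<otimes> c') \<in> G"
      using that by (intro add smult) auto
    moreover have "h \<oplus>\<^bsub>M\<^esub> (\<ominus> \<one>) \<odot>\<^bsub>M\<^esub> h = \<zero>\<^bsub>M\<^esub>" using Gc that by (simp add: smult_l_minus M.r_neg)
    ultimately have "c \<oplus> (\<ominus> \<one>) \<otimes> c' = \<zero>" using single by simp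
    then have "c \<ominus> c' = \<zero>" using Gc[OF that(2)] by (simp add: R.minus_eq R.l_minus)
    then show ?thesis using R.minus_eq_zero_iff Gc(2)[OF that(1)] Gc(2)[OF that(2)] by blast
  qed
  obtain S where S: "finite S" "S \<subseteq> carrier M" "carrier M \<subseteq> lin_span S"
    using finitely_generated_lin_span[OF module_axioms fg] by blast
  have D: "submodule (fst ` G) R M"
  proof (rule submoduleI_smult)
    show "fst ` G \<subseteq> carrier M" using G by auto
    show "\<zero>\<^bsub>M\<^esub> \<in> fst ` G" using zero by (rule image_eqI[rotated]) simp
    show "a \<oplus>\<^bsub>M\<^esub> b \<in> fst ` G" if "a \<in> fst ` G" "b \<in> fst ` G" for a b
    proof -
      obtain c d where "(a, c) \<in> G" "(b, d) \<in> G" using \<open>a \<in> fst ` G\<close> \<open>b \<in> fst ` G\<close> by auto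
      from add[OF this] show ?thesis by (rule image_eqI[rotated]) simp
    qed
    show "a \<odot>\<^bsub>M\<^esub> x \<in> fst ` G" if "a \<in> carrier R" "x \<in> fst ` G" for a x
    proof -
      obtain c where "(x, c) \<in> G" using \<open>x \<in> fst ` G\<close> by auto
      from smult[OF that(1) this] show ?thesis by (rule image_eqI[rotated]) simp
    qed
  qed
  have "fst ` G \<subseteq> lin_span S" using S(3) G by auto
  from finite_rank[OF domain_axioms S(1,2) D this]
  obtain S0 where S0: "finite S0" "S0 \<subseteq> fst ` G"
    "\<And>d. d \<in> fst ` G \<Longrightarrow> \<exists>r\<in>carrier R. r \<noteq> \<zero> \<and> r \<odot>\<^bsub>M\<^esub> d \<in> lin_span S0"
    by blast
  have "\<exists>s\<in>carrier R. \<exists>y\<in>carrier M. s \<noteq> \<zero> \<and>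
      (\<forall>h\<in>lin_span S0. \<exists>c. (h, c) \<in> G \<and> s \<otimes> c = \<omega> h y)"
    using add smult zero single' by (rule lin_functional_on_finite[OF S0(1,2) G])
  then obtain s y where sy: "s \<in> carrier R" "y \<in> carrier M" "s \<noteq> \<zero>"
    "\<And>h. h \<in> lin_span S0 \<Longrightarrow> \<exists>c. (h, c) \<in> G \<and> s \<otimes> c = \<omega> h y"
    by blast
  have "s \<otimes> c = \<omega> h y" if hc: "(h, c) \<in> G" for h c
  proof -
    obtain r where r: "r \<in> carrier R" "r \<noteq> \<zero>" "r \<odot>\<^bsub>M\<^esub> h \<in> lin_span S0"
      using S0(3)[of h] hc by force
    obtain c' where c': "(r \<odot>\<^bsub>M\<^esub> h, c') \<in> G" "s \<otimes> c' = \<omega> (r \<odot>\<^bsub>M\<^esub> h) y" using sy r by blast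
    have "c' = r \<otimes> c" using single' smult[OF r(1) hc] c' by blast
    then have "r \<otimes> (s \<otimes> c) = r \<otimes> \<omega> h y"
      using c' r sy Gc[OF hc] by (simp add: form_smult_left R.m_lcomm)
    then show ?thesis using m_lcancel[of r "s \<otimes> c" "\<omega> h y"] r sy Gc[OF hc] by simp
  qed
  then show ?thesis using sy by blast
qed

end

section \<open>Composition of Lagrangian relations\<close>

lemma mod_sum_simps [simp]:
  "carrier (mod_sum M N) = carrier M \<times> carrier N"
  "(x, y) \<oplus>\<^bsub>mod_sum M N\<^esub> (x', y') = (x \<oplus>\<^bsub>M\<^esub> x', y \<oplus>\<^bsub>N\<^esub> y')"
  "r \<odot>\<^bsub>mod_sum M N\<^esub> (x, y) = (r \<odot>\<^bsub>M\<^esub> x, r \<odot>\<^bsub>N\<^esub> y)"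
  "\<zero>\<^bsub>mod_sum M N\<^esub> = (\<zero>\<^bsub>M\<^esub>, \<zero>\<^bsub>N\<^esub>)"
  by (simp_all add: mod_sum_def)

lemma module_mod_sum:
  assumes "module R M" "module R N"
  shows "module R (mod_sum M N)"
proof -
  interpret M: module R M by fact
  interpret N: module R N by fact
  have "abelian_group (mod_sum M N)"
  proof (rule abelian_groupI)
    fix p assume "p \<in> carrier (mod_sum M N)"
    then show "\<exists>q\<in>carrier (mod_sum M N). q \<oplus>\<^bsub>mod_sum M N\<^esub> p = \<zero>\<^bsub>mod_sum M N\<^esub>"
      by (intro bexI[of _ "(\<ominus>\<^bsub>M\<^esub> fst p, \<ominus>\<^bsub>N\<^esub> snd p)"]) (auto simp: M.M.l_neg N.M.l_neg)
  qed (auto simp: M.M.a_ac N.M.a_ac)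
  then show ?thesis
    by (intro moduleI M.R.cring_axioms)
       (auto simp: M.smult_l_distr N.smult_l_distr M.smult_r_distr N.smult_r_distr
          M.smult_assoc1 N.smult_assoc1)
qed

lemma hermitian_moduleI:
  assumes "domain R" "ring_involution R bar" "H \<in> hermitian_modules R bar"
  shows "hermitian_module R (umod H) bar (form H)"
  using assms unfolding hermitian_modules_def hermitian_module_def hermitian_module_axioms_def by blast

lemma umod_herm_sum_opp: "umod (herm_sum R (herm_opp R H) K) = mod_sum (umod H) (umod K)"
  by (simp add: herm_sum_def herm_opp_def)

text \<open>
  With the opposite form on the first summand, orthogonality of two pairs is an equality between
  the values of the two forms; in this shape it can be chained through a middle module.
\<close>

lemma lagrangian_herm_sum_iff:
  assumes dom: "domain R" "ring_involution R bar"
    and H: "H \<in> hermitian_modules R bar" "K \<in> hermitian_modules R bar"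
  shows "lagrangian R (herm_sum R (herm_opp R H) K) L \<longleftrightarrow>
    submodule L R (mod_sum (umod H) (umod K)) \<and>
    (\<forall>x\<in>carrier (umod H). \<forall>y\<in>carrier (umod K).
      (x, y) \<in> L \<longleftrightarrow> (\<forall>(u, v)\<in>L. form H u x = form K v y))"
proof -
  interpret H: hermitian_module R "umod H" bar "form H" using hermitian_moduleI dom H by blast
  interpret K: hermitian_module R "umod K" bar "form K" using hermitian_moduleI dom H by blast
  interpret S: module R "mod_sum (umod H) (umod K)"
    by (intro module_mod_sum H.module_axioms K.module_axioms)
  have "L = {p \<in> carrier (mod_sum (umod H) (umod K)).
            \<forall>v\<in>L. form (herm_sum R (herm_opp R H) K) v p = \<zero>\<^bsub>R\<^esub>} \<longleftrightarrow>
      (\<forall>x\<in>carrier (umod H). \<forall>y\<in>carrier (umod K).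
        (x, y) \<in> L \<longleftrightarrow> (\<forall>(u, v)\<in>L. form H u x = form K v y))"
    if "submodule L R (mod_sum (umod H) (umod K))"
  proof -
    have L: "L \<subseteq> carrier (umod H) \<times> carrier (umod K)" using S.submoduleE(1)[OF that] by simp
    have "form (herm_sum R (herm_opp R H) K) (u, v) (x, y) = \<zero>\<^bsub>R\<^esub> \<longleftrightarrow> form H u x = form K v y"
      if "(u, v) \<in> L" "x \<in> carrier (umod H)" "y \<in> carrier (umod K)" for u v x y
    proof -
      have c: "u \<in> carrier (umod H)" "v \<in> carrier (umod K)" using that L by auto
      then have "form (herm_sum R (herm_opp R H) K) (u, v) (x, y) = form K v y \<ominus>\<^bsub>R\<^esub> form H u x"
        using that by (simp add: herm_sum_def herm_opp_def H.R.minus_eq H.R.a_comm)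
      then show ?thesis
        using H.R.minus_eq_zero_iff[of "form K v y" "form H u x"] that c by auto
    qed
    then have "{p \<in> carrier (mod_sum (umod H) (umod K)).
            \<forall>v\<in>L. form (herm_sum R (herm_opp R H) K) v p = \<zero>\<^bsub>R\<^esub>} =
       {(x, y). x \<in> carrier (umod H) \<and> y \<in> carrier (umod K) \<and> (\<forall>(u, v)\<in>L. form H u x = form K v y)}"
      by fastforce
    moreover have "L = {(x, y). x \<in> X \<and> y \<in> Y \<and> P x y} \<longleftrightarrow>
        (\<forall>x\<in>X. \<forall>y\<in>Y. (x, y) \<in> L \<longleftrightarrow> P x y)" if "L \<subseteq> X \<times> Y" for X Y P
      using that by blast
    ultimately show ?thesis using L by simp
  qed
  then show ?thesis unfolding lagrangian_def umod_herm_sum_opp by blast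
qed

lemma in_saturation_sum:
  "(x, y) \<in> saturation R (mod_sum M N) A \<longleftrightarrow> x \<in> carrier M \<and> y \<in> carrier N \<and>
    (\<exists>r\<in>carrier R. r \<noteq> \<zero>\<^bsub>R\<^esub> \<and> (r \<odot>\<^bsub>M\<^esub> x, r \<odot>\<^bsub>N\<^esub> y) \<in> A)"
  by (auto simp: saturation_def)

lemma submodule_relcomp:
  assumes "module R X" "module R Y" "module R Z"
    and "submodule N R (mod_sum X Y)" "submodule N' R (mod_sum Y Z)"
  shows "submodule (N O N') R (mod_sum X Z)"
proof -
  interpret XY: module R "mod_sum X Y" by (intro module_mod_sum assms)
  interpret YZ: module R "mod_sum Y Z" by (intro module_mod_sum assms)
  interpret XZ: module R "mod_sum X Z" by (intro module_mod_sum assms)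
  note N = XY.submoduleE[OF assms(4)] XY.submodule_zero[OF assms(4)]
  note N' = YZ.submoduleE[OF assms(5)] YZ.submodule_zero[OF assms(5)]
  show ?thesis
  proof (rule XZ.submoduleI_smult)
    show "N O N' \<subseteq> carrier (mod_sum X Z)" using N(1) N'(1) by auto
    show "\<zero>\<^bsub>mod_sum X Z\<^esub> \<in> N O N'" using N(7) N'(7) by auto
    fix p q assume "p \<in> N O N'" "q \<in> N O N'"
    then obtain x y z x' y' z' where p: "p = (x, z)" "(x, y) \<in> N" "(y, z) \<in> N'"
      and q: "q = (x', z')" "(x', y') \<in> N" "(y', z') \<in> N'" by blast
    show "p \<oplus>\<^bsub>mod_sum X Z\<^esub> q \<in> N O N'"
      using N(5)[OF p(2) q(2)] N'(5)[OF p(3) q(3)] p q by auto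
  next
    fix a p assume a: "a \<in> carrier R" and "p \<in> N O N'"
    then obtain x y z where p: "p = (x, z)" "(x, y) \<in> N" "(y, z) \<in> N'" by blast
    show "a \<odot>\<^bsub>mod_sum X Z\<^esub> p \<in> N O N'"
      using N(4)[OF a p(2)] N'(4)[OF a p(3)] p by auto
  qed
qed

text \<open>
  The saturations \<open>A\<close>, \<open>A'\<close> and \<open>K\<close> of \<open>N\<close>, \<open>N'\<close> and \<open>N O N'\<close> are used throughout, so that \<open>A\<close> and \<open>A'\<close>
  are their own orthogonals.  That \<open>K\<close> is isotropic follows by inserting a common middle term.  For
  the converse, \<open>G\<close> is the graph of the functional \<open>v - v' \<mapsto> \<omega>(u, x) - \<omega>''(w, z)\<close>, and a representing
  element \<open>y\<close> is the middle term for a multiple of \<open>(x, z)\<close>: pairs with \<open>v' = w = 0\<close> show that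
  \<open>(bar s x, y)\<close> is orthogonal to \<open>A\<close>, pairs with \<open>u = v = 0\<close> that \<open>(y, bar s z)\<close> is orthogonal to \<open>A'\<close>.
\<close>

lemma lagrangian_relcomp:
  assumes dom: "domain R" "ring_involution R bar"
    and H: "H \<in> hermitian_modules R bar" "H' \<in> hermitian_modules R bar"
      "H'' \<in> hermitian_modules R bar"
    and N: "submodule N R (mod_sum (umod H) (umod H'))"
    and N': "submodule N' R (mod_sum (umod H') (umod H''))"
    and L: "lagrangian R (herm_sum R (herm_opp R H) H')
      (saturation R (mod_sum (umod H) (umod H')) N)"
    and L': "lagrangian R (herm_sum R (herm_opp R H') H'')
      (saturation R (mod_sum (umod H') (umod H'')) N')"
  shows "lagrangian R (herm_sum R (herm_opp R H) H'')
    (saturation R (mod_sum (umod H) (umod H'')) (N O N'))"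
proof -
  interpret H: hermitian_module R "umod H" bar "form H" using hermitian_moduleI dom H by blast
  interpret H': hermitian_module R "umod H'" bar "form H'" using hermitian_moduleI dom H by blast
  interpret H'': hermitian_module R "umod H''" bar "form H''" using hermitian_moduleI dom H by blast
  interpret S: module R "mod_sum (umod H) (umod H')"
    by (intro module_mod_sum H.module_axioms H'.module_axioms)
  interpret S': module R "mod_sum (umod H') (umod H'')"
    by (intro module_mod_sum H'.module_axioms H''.module_axioms)
  interpret S'': module R "mod_sum (umod H) (umod H'')"
    by (intro module_mod_sum H.module_axioms H''.module_axioms)
  define A where "A = saturation R (mod_sum (umod H) (umod H')) N"
  define A' where "A' = saturation R (mod_sum (umod H') (umod H'')) N'"
  define K where "K = saturation R (mod_sum (umod H) (umod H'')) (N O N')"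
  have sN: "(r \<odot>\<^bsub>umod H\<^esub> x, r \<odot>\<^bsub>umod H'\<^esub> y) \<in> N" if "(x, y) \<in> N" "r \<in> carrier R" for r x y
    using S.submoduleE(4)[OF N that(2,1)] by simp
  have sN': "(r \<odot>\<^bsub>umod H'\<^esub> x, r \<odot>\<^bsub>umod H''\<^esub> y) \<in> N'" if "(x, y) \<in> N'" "r \<in> carrier R" for r x y
    using S'.submoduleE(4)[OF N' that(2,1)] by simp
  have subA: "submodule A R (mod_sum (umod H) (umod H'))"
    and A: "\<And>x y. \<lbrakk>x \<in> carrier (umod H); y \<in> carrier (umod H')\<rbrakk> \<Longrightarrow>
      (x, y) \<in> A \<longleftrightarrow> (\<forall>(u, v)\<in>A. form H u x = form H' v y)"
    using L[unfolded lagrangian_herm_sum_iff[OF dom H(1,2)], folded A_def] by simp_all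
  have subA': "submodule A' R (mod_sum (umod H') (umod H''))"
    and A': "\<And>x y. \<lbrakk>x \<in> carrier (umod H'); y \<in> carrier (umod H'')\<rbrakk> \<Longrightarrow>
      (x, y) \<in> A' \<longleftrightarrow> (\<forall>(u, v)\<in>A'. form H' u x = form H'' v y)"
    using L'[unfolded lagrangian_herm_sum_iff[OF dom H(2,3)], folded A'_def] by simp_all
  have subK: "submodule K R (mod_sum (umod H) (umod H''))"
    unfolding K_def
    by (intro submodule_saturation submodule_relcomp[of _ _ "umod H'"] dom N N' S''.module_axioms
        H.module_axioms H'.module_axioms H''.module_axioms)
  have Ac: "x \<in> carrier (umod H)" "y \<in> carrier (umod H')" if "(x, y) \<in> A" for x y
    using that by (auto simp: A_def in_saturation_sum)
  have A'c: "x \<in> carrier (umod H')" "y \<in> carrier (umod H'')" if "(x, y) \<in> A'" for x y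
    using that by (auto simp: A'_def in_saturation_sum)
  have Kc: "x \<in> carrier (umod H)" "y \<in> carrier (umod H'')" if "(x, y) \<in> K" for x y
    using that by (auto simp: K_def in_saturation_sum)
  have NA: "(x, y) \<in> A" if "(x, y) \<in> N" for x y
    using that S.submoduleE(1)[OF N] H.R.one_closed H.one_not_zero unfolding A_def in_saturation_sum
    by (auto intro!: bexI[of _ "\<one>\<^bsub>R\<^esub>"])
  have NA': "(x, y) \<in> A'" if "(x, y) \<in> N'" for x y
    using that S'.submoduleE(1)[OF N'] H.R.one_closed H.one_not_zero unfolding A'_def in_saturation_sum
    by (auto intro!: bexI[of _ "\<one>\<^bsub>R\<^esub>"])
  have AK: "(x, z) \<in> K" if xy: "(x, y) \<in> A" and yz: "(y, z) \<in> A'" for x y z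
  proof -
    obtain r where r: "r \<in> carrier R" "r \<noteq> \<zero>\<^bsub>R\<^esub>" "(r \<odot>\<^bsub>umod H\<^esub> x, r \<odot>\<^bsub>umod H'\<^esub> y) \<in> N"
      using xy unfolding A_def in_saturation_sum by blast
    obtain s where s: "s \<in> carrier R" "s \<noteq> \<zero>\<^bsub>R\<^esub>" "(s \<odot>\<^bsub>umod H'\<^esub> y, s \<odot>\<^bsub>umod H''\<^esub> z) \<in> N'"
      using yz unfolding A'_def in_saturation_sum by blast
    have "((s \<otimes>\<^bsub>R\<^esub> r) \<odot>\<^bsub>umod H\<^esub> x, (s \<otimes>\<^bsub>R\<^esub> r) \<odot>\<^bsub>umod H'\<^esub> y) \<in> N"
      using sN[OF r(3) s(1)] Ac[OF xy] r s by (simp add: H.smult_assoc1 H'.smult_assoc1)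
    moreover have "((s \<otimes>\<^bsub>R\<^esub> r) \<odot>\<^bsub>umod H'\<^esub> y, (s \<otimes>\<^bsub>R\<^esub> r) \<odot>\<^bsub>umod H''\<^esub> z) \<in> N'"
      using sN'[OF s(3) r(1)] A'c[OF yz] r s
      by (simp add: H.R.m_comm[of s r] H'.smult_assoc1 H''.smult_assoc1)
    moreover have "s \<otimes>\<^bsub>R\<^esub> r \<noteq> \<zero>\<^bsub>R\<^esub>" "s \<otimes>\<^bsub>R\<^esub> r \<in> carrier R" using r s H.integral_iff by auto
    ultimately show ?thesis
      unfolding K_def in_saturation_sum using Ac[OF xy] A'c[OF yz] by blast
  qed
  have KK: "(x, z) \<in> K" if "x \<in> carrier (umod H)" "z \<in> carrier (umod H'')" "r \<in> carrier R"
      "r \<noteq> \<zero>\<^bsub>R\<^esub>" and rK: "(r \<odot>\<^bsub>umod H\<^esub> x, r \<odot>\<^bsub>umod H''\<^esub> z) \<in> K" for r x z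
  proof -
    obtain s where s: "s \<in> carrier R" "s \<noteq> \<zero>\<^bsub>R\<^esub>"
      "(s \<odot>\<^bsub>umod H\<^esub> (r \<odot>\<^bsub>umod H\<^esub> x), s \<odot>\<^bsub>umod H''\<^esub> (r \<odot>\<^bsub>umod H''\<^esub> z)) \<in> N O N'"
      using rK unfolding K_def in_saturation_sum by blast
    then have "((s \<otimes>\<^bsub>R\<^esub> r) \<odot>\<^bsub>umod H\<^esub> x, (s \<otimes>\<^bsub>R\<^esub> r) \<odot>\<^bsub>umod H''\<^esub> z) \<in> N O N'"
      using that by (simp add: H.smult_assoc1 H''.smult_assoc1)
    then show ?thesis
      unfolding K_def in_saturation_sum using that s H.integral_iff[of s r] by (metis H.R.m_closed)
  qed
  have isotropic: "form H u x = form H'' w z" if uw: "(u, w) \<in> K" and xz: "(x, z) \<in> K" for u w x z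
  proof -
    obtain r y where r: "r \<in> carrier R" "r \<noteq> \<zero>\<^bsub>R\<^esub>" "(r \<odot>\<^bsub>umod H\<^esub> x, y) \<in> N" "(y, r \<odot>\<^bsub>umod H''\<^esub> z) \<in> N'"
      using xz unfolding K_def in_saturation_sum by blast
    obtain s v where s: "s \<in> carrier R" "s \<noteq> \<zero>\<^bsub>R\<^esub>" "(s \<odot>\<^bsub>umod H\<^esub> u, v) \<in> N" "(v, s \<odot>\<^bsub>umod H''\<^esub> w) \<in> N'"
      using uw unfolding K_def in_saturation_sum by blast
    note c = Kc[OF uw] Kc[OF xz]
    have "form H (s \<odot>\<^bsub>umod H\<^esub> u) (r \<odot>\<^bsub>umod H\<^esub> x) = form H' v y"
      using A[of "r \<odot>\<^bsub>umod H\<^esub> x" y] NA[OF r(3)] NA[OF s(3)] Ac[OF NA[OF r(3)]] by auto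
    also have "\<dots> = form H'' (s \<odot>\<^bsub>umod H''\<^esub> w) (r \<odot>\<^bsub>umod H''\<^esub> z)"
      using A'[of y "r \<odot>\<^bsub>umod H''\<^esub> z"] NA'[OF r(4)] NA'[OF s(4)] A'c[OF NA'[OF r(4)]] by auto
    finally have "bar r \<otimes>\<^bsub>R\<^esub> (s \<otimes>\<^bsub>R\<^esub> form H u x) = bar r \<otimes>\<^bsub>R\<^esub> (s \<otimes>\<^bsub>R\<^esub> form H'' w z)"
      using c r(1) s(1)
      by (simp add: H.form_smult_left H''.form_smult_left H.form_smult_right H''.form_smult_right
          H.R.m_lcomm)
    then have "s \<otimes>\<^bsub>R\<^esub> form H u x = s \<otimes>\<^bsub>R\<^esub> form H'' w z"
      using H.m_lcancel[of "bar r"] H.bar_nonzero[of r] c r s by simp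
    then show ?thesis using H.m_lcancel[of s] c s by simp
  qed
  have coisotropic: "(x, z) \<in> K"
    if x: "x \<in> carrier (umod H)" and z: "z \<in> carrier (umod H'')"
      and perp: "\<And>u w. (u, w) \<in> K \<Longrightarrow> form H u x = form H'' w z" for x z
  proof -
    define G where "G = {(v \<ominus>\<^bsub>umod H'\<^esub> v', form H u x \<ominus>\<^bsub>R\<^esub> form H'' w z) | u v v' w. (u, v) \<in> A \<and> (v', w) \<in> A'}"
    have fg: "finitely_generated R (umod H')" using H unfolding hermitian_modules_def by blast
    have "G \<subseteq> carrier (umod H') \<times> carrier R"
      unfolding G_def using Ac A'c x z by auto
    moreover have "(h \<oplus>\<^bsub>umod H'\<^esub> h', c \<oplus>\<^bsub>R\<^esub> c') \<in> G" if g: "(h, c) \<in> G" "(h', c') \<in> G" for h c h' c'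
    proof -
      obtain u v v' w where 1: "h = v \<ominus>\<^bsub>umod H'\<^esub> v'" "c = form H u x \<ominus>\<^bsub>R\<^esub> form H'' w z"
        "(u, v) \<in> A" "(v', w) \<in> A'" using g(1) unfolding G_def by blast
      obtain u1 v1 v1' w1 where 2: "h' = v1 \<ominus>\<^bsub>umod H'\<^esub> v1'" "c' = form H u1 x \<ominus>\<^bsub>R\<^esub> form H'' w1 z"
        "(u1, v1) \<in> A" "(v1', w1) \<in> A'" using g(2) unfolding G_def by blast
      note c = Ac[OF 1(3)] A'c[OF 1(4)] Ac[OF 2(3)] A'c[OF 2(4)]
      have "h \<oplus>\<^bsub>umod H'\<^esub> h' = (v \<oplus>\<^bsub>umod H'\<^esub> v1) \<ominus>\<^bsub>umod H'\<^esub> (v' \<oplus>\<^bsub>umod H'\<^esub> v1')"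
        using c 1 2 by (simp add: H'.M.minus_eq H'.M.minus_add H'.M.a_ac)
      moreover have "c \<oplus>\<^bsub>R\<^esub> c' = form H (u \<oplus>\<^bsub>umod H\<^esub> u1) x \<ominus>\<^bsub>R\<^esub> form H'' (w \<oplus>\<^bsub>umod H''\<^esub> w1) z"
        using c 1 2 x z by (simp add: H.form_add_left H''.form_add_left H.R.minus_eq H.R.minus_add H.R.a_ac)
      moreover have "(u \<oplus>\<^bsub>umod H\<^esub> u1, v \<oplus>\<^bsub>umod H'\<^esub> v1) \<in> A"
        using S.submoduleE(5)[OF subA 1(3) 2(3)] by simp
      moreover have "(v' \<oplus>\<^bsub>umod H'\<^esub> v1', w \<oplus>\<^bsub>umod H''\<^esub> w1) \<in> A'"
        using S'.submoduleE(5)[OF subA' 1(4) 2(4)] by simp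
      ultimately show ?thesis unfolding G_def by blast
    qed
    moreover have "(r \<odot>\<^bsub>umod H'\<^esub> h, r \<otimes>\<^bsub>R\<^esub> c) \<in> G" if r: "r \<in> carrier R" and g: "(h, c) \<in> G" for r h c
    proof -
      obtain u v v' w where 1: "h = v \<ominus>\<^bsub>umod H'\<^esub> v'" "c = form H u x \<ominus>\<^bsub>R\<^esub> form H'' w z"
        "(u, v) \<in> A" "(v', w) \<in> A'" using g unfolding G_def by blast
      note c = Ac[OF 1(3)] A'c[OF 1(4)]
      have "r \<odot>\<^bsub>umod H'\<^esub> h = r \<odot>\<^bsub>umod H'\<^esub> v \<ominus>\<^bsub>umod H'\<^esub> r \<odot>\<^bsub>umod H'\<^esub> v'"
        using c 1 r by (simp add: H'.M.minus_eq H'.smult_r_distr H'.smult_r_minus)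
      moreover have "r \<otimes>\<^bsub>R\<^esub> c = form H (r \<odot>\<^bsub>umod H\<^esub> u) x \<ominus>\<^bsub>R\<^esub> form H'' (r \<odot>\<^bsub>umod H''\<^esub> w) z"
        using c 1 x z r
        by (simp add: H.form_smult_left H''.form_smult_left H.R.minus_eq H.R.r_distr H.R.r_minus)
      moreover have "(r \<odot>\<^bsub>umod H\<^esub> u, r \<odot>\<^bsub>umod H'\<^esub> v) \<in> A"
        using S.submoduleE(4)[OF subA r 1(3)] by simp
      moreover have "(r \<odot>\<^bsub>umod H'\<^esub> v', r \<odot>\<^bsub>umod H''\<^esub> w) \<in> A'"
        using S'.submoduleE(4)[OF subA' r 1(4)] by simp
      ultimately show ?thesis unfolding G_def by blast
    qed
    moreover have zA: "(\<zero>\<^bsub>umod H\<^esub>, \<zero>\<^bsub>umod H'\<^esub>) \<in> A" "(\<zero>\<^bsub>umod H'\<^esub>, \<zero>\<^bsub>umod H''\<^esub>) \<in> A'"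
      using S.submodule_zero[OF subA] S'.submodule_zero[OF subA'] by simp_all
    have zeros: "\<zero>\<^bsub>umod H'\<^esub> \<ominus>\<^bsub>umod H'\<^esub> \<zero>\<^bsub>umod H'\<^esub> = \<zero>\<^bsub>umod H'\<^esub>" "\<zero>\<^bsub>R\<^esub> \<ominus>\<^bsub>R\<^esub> \<zero>\<^bsub>R\<^esub> = \<zero>\<^bsub>R\<^esub>"
      by (simp_all add: H'.M.minus_eq H.R.minus_eq)
    have "(\<zero>\<^bsub>umod H'\<^esub>, \<zero>\<^bsub>R\<^esub>) \<in> G"
      unfolding G_def using zA zeros x z H.form_zero_left H''.form_zero_left by (smt (verit) mem_Collect_eq)
    moreover have "c = \<zero>\<^bsub>R\<^esub>" if g: "(\<zero>\<^bsub>umod H'\<^esub>, c) \<in> G" for c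
    proof -
      obtain u v v' w where 1: "\<zero>\<^bsub>umod H'\<^esub> = v \<ominus>\<^bsub>umod H'\<^esub> v'" "c = form H u x \<ominus>\<^bsub>R\<^esub> form H'' w z"
        "(u, v) \<in> A" "(v', w) \<in> A'" using g unfolding G_def by blast
      then have "v = v'" using Ac A'c H'.M.minus_eq_zero_iff by metis
      then have "(u, w) \<in> K" using AK 1 by blast
      then show ?thesis using perp 1 Kc z by (simp add: H.R.minus_eq H.R.r_neg)
    qed
    ultimately have "\<exists>s\<in>carrier R. \<exists>y\<in>carrier (umod H'). s \<noteq> \<zero>\<^bsub>R\<^esub> \<and>
        (\<forall>(h, c)\<in>G. s \<otimes>\<^bsub>R\<^esub> c = form H' h y)"
      by (rule H'.lin_functional_representable[OF fg])
    then obtain s y where sy: "s \<in> carrier R" "s \<noteq> \<zero>\<^bsub>R\<^esub>" "y \<in> carrier (umod H')"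
      "\<And>h c. (h, c) \<in> G \<Longrightarrow> s \<otimes>\<^bsub>R\<^esub> c = form H' h y" by fast
    have "(bar s \<odot>\<^bsub>umod H\<^esub> x, y) \<in> A"
    proof -
      have "form H u (bar s \<odot>\<^bsub>umod H\<^esub> x) = form H' v y" if uv: "(u, v) \<in> A" for u v
      proof -
        note c = Ac[OF uv]
        have "(v \<ominus>\<^bsub>umod H'\<^esub> \<zero>\<^bsub>umod H'\<^esub>, form H u x \<ominus>\<^bsub>R\<^esub> form H'' \<zero>\<^bsub>umod H''\<^esub> z) \<in> G"
          unfolding G_def using uv zA by blast
        then have "(v, form H u x) \<in> G"
          using c x z H'.M.minus_equality[of "\<zero>\<^bsub>umod H'\<^esub>" "\<zero>\<^bsub>umod H'\<^esub>"]
          by (simp add: H'.M.minus_eq H.R.minus_eq)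
        then show ?thesis using sy c x by (simp add: H.form_smult_right)
      qed
      then show ?thesis using A[of "bar s \<odot>\<^bsub>umod H\<^esub> x" y] sy x by auto
    qed
    moreover have "(y, bar s \<odot>\<^bsub>umod H''\<^esub> z) \<in> A'"
    proof -
      have "form H' v y = form H'' w (bar s \<odot>\<^bsub>umod H''\<^esub> z)" if vw: "(v, w) \<in> A'" for v w
      proof -
        note c = A'c[OF vw]
        have "(\<zero>\<^bsub>umod H'\<^esub> \<ominus>\<^bsub>umod H'\<^esub> v, form H \<zero>\<^bsub>umod H\<^esub> x \<ominus>\<^bsub>R\<^esub> form H'' w z) \<in> G"
          unfolding G_def using vw zA by blast
        then have "(\<ominus>\<^bsub>umod H'\<^esub> v, \<ominus>\<^bsub>R\<^esub> form H'' w z) \<in> G"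
          using c x z by (simp add: H'.M.minus_eq H.R.minus_eq)
        then have "s \<otimes>\<^bsub>R\<^esub> \<ominus>\<^bsub>R\<^esub> form H'' w z = form H' (\<ominus>\<^bsub>umod H'\<^esub> v) y" by (rule sy(4))
        then have "\<ominus>\<^bsub>R\<^esub> (s \<otimes>\<^bsub>R\<^esub> form H'' w z) = \<ominus>\<^bsub>R\<^esub> form H' v y"
          using c z sy by (simp add: H'.form_minus_left H.R.r_minus)
        then have "s \<otimes>\<^bsub>R\<^esub> form H'' w z = form H' v y"
          using c z sy by (metis H.R.m_closed H.R.minus_minus H'.form_closed H''.form_closed)
        then show ?thesis using sy c z by (simp add: H''.form_smult_right)
      qed
      then show ?thesis using A'[of y "bar s \<odot>\<^bsub>umod H''\<^esub> z"] sy z by auto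
    qed
    ultimately have "(bar s \<odot>\<^bsub>umod H\<^esub> x, bar s \<odot>\<^bsub>umod H''\<^esub> z) \<in> K" by (rule AK)
    then show ?thesis using KK[of x z "bar s"] sy x z H.bar_nonzero by simp
  qed
  have "(x, z) \<in> K \<longleftrightarrow> (\<forall>(u, w)\<in>K. form H u x = form H'' w z)"
    if "x \<in> carrier (umod H)" "z \<in> carrier (umod H'')" for x z
  proof
    assume "\<forall>(u, w)\<in>K. form H u x = form H'' w z"
    then show "(x, z) \<in> K" by (intro coisotropic[OF that]) auto
  qed (use isotropic in auto)
  then show ?thesis
    unfolding lagrangian_herm_sum_iff[OF dom H(1,3)] K_def[symmetric] using subK by simp
qed

text \<open>
  The diagonal is saturated because the module is torsion-free, and it is its own orthogonal by
  non-degeneracy.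
\<close>

lemma lagrangian_diagonal:
  assumes dom: "domain R" "ring_involution R bar" and H: "H \<in> hermitian_modules R bar"
  shows "lagrangian R (herm_sum R (herm_opp R H) H)
    (saturation R (mod_sum (umod H) (umod H)) (Id_on (carrier (umod H))))"
proof -
  interpret H: hermitian_module R "umod H" bar "form H" using hermitian_moduleI dom H by blast
  interpret S: module R "mod_sum (umod H) (umod H)"
    by (intro module_mod_sum H.module_axioms)
  let ?D = "Id_on (carrier (umod H))"
  have "x = y" if "x \<in> carrier (umod H)" "y \<in> carrier (umod H)" "r \<in> carrier R" "r \<noteq> \<zero>\<^bsub>R\<^esub>"
     "r \<odot>\<^bsub>umod H\<^esub> x = r \<odot>\<^bsub>umod H\<^esub> y" for r x y
  proof -
    have "r \<odot>\<^bsub>umod H\<^esub> (x \<ominus>\<^bsub>umod H\<^esub> y) = \<zero>\<^bsub>umod H\<^esub>"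
      using that by (simp add: H.M.minus_eq H.smult_r_distr H.smult_r_minus H.M.r_neg)
    then show ?thesis using H.torsion_free[of r "x \<ominus>\<^bsub>umod H\<^esub> y"] that H.M.minus_eq_zero_iff by simp
  qed
  then have "(x, y) \<in> saturation R (mod_sum (umod H) (umod H)) ?D \<longleftrightarrow> (x, y) \<in> ?D" for x y
    using H.R.one_closed H.one_not_zero H.smult_one unfolding in_saturation_sum Id_on_iff
    by (metis H.smult_closed)
  then have sat: "saturation R (mod_sum (umod H) (umod H)) ?D = ?D" by auto
  have "submodule ?D R (mod_sum (umod H) (umod H))"
    by (rule S.submoduleI_smult) auto
  moreover have "x = y" if "x \<in> carrier (umod H)" "y \<in> carrier (umod H)"
    "\<And>v. v \<in> carrier (umod H) \<Longrightarrow> form H v x = form H v y" for x y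
  proof -
    have "x \<ominus>\<^bsub>umod H\<^esub> y = \<zero>\<^bsub>umod H\<^esub>"
    proof (rule H.form_nondegenerate)
      fix v assume v: "v \<in> carrier (umod H)"
      have "form H x v = form H y v"
        using H.form_skew[of x v] H.form_skew[of y v] that v by simp
      then show "form H (x \<ominus>\<^bsub>umod H\<^esub> y) v = \<zero>\<^bsub>R\<^esub>"
        using that v by (simp add: H.M.minus_eq H.form_add_left H.form_minus_left H.R.r_neg)
    qed (use that in simp)
    then show ?thesis using that H.M.minus_eq_zero_iff by simp
  qed
  ultimately show ?thesis
    unfolding sat lagrangian_herm_sum_iff[OF dom H H] Id_on_iff
    by (auto simp: Id_on_iff Id_on_def)
qed

section \<open>Homomorphisms and pushout squares\<close>

lemma mod_hom_closed: "\<lbrakk>f \<in> mod_hom R M N; x \<in> carrier M\<rbrakk> \<Longrightarrow> f x \<in> carrier N"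
  by (auto simp: mod_hom_def)

lemma mod_hom_add: "\<lbrakk>f \<in> mod_hom R M N; x \<in> carrier M; y \<in> carrier M\<rbrakk> \<Longrightarrow>
    f (x \<oplus>\<^bsub>M\<^esub> y) = f x \<oplus>\<^bsub>N\<^esub> f y"
  by (auto simp: mod_hom_def)

lemma mod_hom_smult: "\<lbrakk>f \<in> mod_hom R M N; r \<in> carrier R; x \<in> carrier M\<rbrakk> \<Longrightarrow>
    f (r \<odot>\<^bsub>M\<^esub> x) = r \<odot>\<^bsub>N\<^esub> f x"
  by (auto simp: mod_hom_def)

lemma mod_hom_funcset: "f \<in> mod_hom R M N \<Longrightarrow> f \<in> carrier M \<rightarrow> carrier N"
  by (auto simp: mod_hom_def)

lemma mod_hom_eqI:
  assumes "f \<in> mod_hom R M N" "g \<in> mod_hom R M N'" "\<And>x. x \<in> carrier M \<Longrightarrow> f x = g x"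
  shows "f = g"
  using assms unfolding mod_hom_def by (intro extensionalityI[of _ "carrier M"]) (auto simp: PiE_def)

lemma mod_hom_restrictI:
  assumes "\<And>x. x \<in> carrier M \<Longrightarrow> f x \<in> carrier N"
    and "\<And>x y. \<lbrakk>x \<in> carrier M; y \<in> carrier M\<rbrakk> \<Longrightarrow> f (x \<oplus>\<^bsub>M\<^esub> y) = f x \<oplus>\<^bsub>N\<^esub> f y"
    and "\<And>r x. \<lbrakk>r \<in> carrier R; x \<in> carrier M\<rbrakk> \<Longrightarrow> f (r \<odot>\<^bsub>M\<^esub> x) = r \<odot>\<^bsub>N\<^esub> f x"
    and "module R M"
  shows "(\<lambda>x\<in>carrier M. f x) \<in> mod_hom R M N"
proof -
  interpret module R M by fact
  show ?thesis unfolding mod_hom_def using assms by auto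
qed

lemma compose_mod_hom:
  assumes "f \<in> mod_hom R L M" "g \<in> mod_hom R M N" "module R L"
  shows "compose (carrier L) g f \<in> mod_hom R L N"
  unfolding compose_def
  by (rule mod_hom_restrictI)
     (use assms in \<open>auto simp: mod_hom_add[OF assms(1)] mod_hom_add[OF assms(2)]
        mod_hom_smult[OF assms(1)] mod_hom_smult[OF assms(2)] mod_hom_closed[OF assms(1)]
        intro: mod_hom_closed[OF assms(2)]\<close>)

lemma compose_apply [simp]: "x \<in> A \<Longrightarrow> compose A g f x = g (f x)"
  by (rule compose_eq)

lemma compose_eq_iff: "compose A g f = compose A g' f' \<longleftrightarrow> (\<forall>x\<in>A. g (f x) = g' (f' x))"
  by (auto simp: compose_def fun_eq_iff)

lemma compose_eq_mod_hom_iff: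
  assumes "l \<in> mod_hom R X N"
  shows "compose (carrier X) g f = l \<longleftrightarrow> (\<forall>x\<in>carrier X. g (f x) = l x)"
  using assms by (auto simp: compose_def mod_hom_def PiE_def extensional_def fun_eq_iff)

lemma id_hom_apply [simp]: "x \<in> carrier M \<Longrightarrow> id_hom M x = x"
  by (simp add: id_hom_def)

lemma id_hom_mod_hom: "module R M \<Longrightarrow> id_hom M \<in> mod_hom R M M"
  unfolding id_hom_def by (rule mod_hom_restrictI) auto

lemma mod_hom_zero:
  assumes "module R M" "module R N" "f \<in> mod_hom R M N"
  shows "f \<zero>\<^bsub>M\<^esub> = \<zero>\<^bsub>N\<^esub>"
proof -
  interpret M: module R M by fact
  interpret N: module R N by fact
  have "f (\<zero>\<^bsub>R\<^esub> \<odot>\<^bsub>M\<^esub> \<zero>\<^bsub>M\<^esub>) = \<zero>\<^bsub>R\<^esub> \<odot>\<^bsub>N\<^esub> f \<zero>\<^bsub>M\<^esub>"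
    using assms by (intro mod_hom_smult) auto
  then show ?thesis using mod_hom_closed[OF assms(3), of "\<zero>\<^bsub>M\<^esub>"] by simp
qed

lemma mod_hom_minus:
  assumes "module R M" "module R N" "f \<in> mod_hom R M N" "x \<in> carrier M" "y \<in> carrier M"
  shows "f (x \<ominus>\<^bsub>M\<^esub> y) = f x \<ominus>\<^bsub>N\<^esub> f y"
proof -
  interpret M: module R M by fact
  interpret N: module R N by fact
  have "\<ominus>\<^bsub>M\<^esub> y = (\<ominus>\<^bsub>R\<^esub> \<one>\<^bsub>R\<^esub>) \<odot>\<^bsub>M\<^esub> y" using assms by (simp add: M.smult_l_minus)
  then have "f (x \<ominus>\<^bsub>M\<^esub> y) = f x \<oplus>\<^bsub>N\<^esub> (\<ominus>\<^bsub>R\<^esub> \<one>\<^bsub>R\<^esub>) \<odot>\<^bsub>N\<^esub> f y"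
    using assms by (simp add: M.M.minus_eq mod_hom_add[OF assms(3)] mod_hom_smult[OF assms(3)])
  then show ?thesis using mod_hom_closed[OF assms(3,5)] by (simp add: N.M.minus_eq N.smult_l_minus)
qed

text \<open>
  The universal property written on elements.  The maps \<open>f\<close> and \<open>g\<close> out of the centre enter only
  through their values on its carrier, so that composites can be put in their place as plain
  \<open>\<lambda>\<close>-terms.
\<close>

definition pushout_square ::
    "('a, 'r) ring_scheme \<Rightarrow> ('a, 'u) module \<Rightarrow> ('a, 'u) module \<Rightarrow> ('a, 'u) module \<Rightarrow>
     ('u \<Rightarrow> 'u) \<Rightarrow> ('u \<Rightarrow> 'u) \<Rightarrow> ('a, 'u) module \<Rightarrow> ('u \<Rightarrow> 'u) \<Rightarrow> ('u \<Rightarrow> 'u) \<Rightarrow> bool" where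
  "pushout_square R H A B f g P p q \<longleftrightarrow>
     module R A \<and> module R B \<and> module R P \<and> p \<in> mod_hom R A P \<and> q \<in> mod_hom R B P \<and>
     f \<in> carrier H \<rightarrow> carrier A \<and> g \<in> carrier H \<rightarrow> carrier B \<and>
     (\<forall>h\<in>carrier H. p (f h) = q (g h)) \<and>
     (\<forall>(X :: ('a, 'u) module) x y. module R X \<longrightarrow> x \<in> mod_hom R A X \<longrightarrow> y \<in> mod_hom R B X \<longrightarrow>
        (\<forall>h\<in>carrier H. x (f h) = y (g h)) \<longrightarrow>
        (\<exists>u\<in>mod_hom R P X. (\<forall>a\<in>carrier A. u (p a) = x a) \<and> (\<forall>b\<in>carrier B. u (q b) = y b))) \<and>
     (\<forall>(X :: ('a, 'u) module) u v. module R X \<longrightarrow> u \<in> mod_hom R P X \<longrightarrow> v \<in> mod_hom R P X \<longrightarrow>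
        (\<forall>a\<in>carrier A. u (p a) = v (p a)) \<longrightarrow> (\<forall>b\<in>carrier B. u (q b) = v (q b)) \<longrightarrow> u = v)"

lemma pushout_squareD:
  assumes "pushout_square R H A B f g P p q"
  shows "module R A" "module R B" "module R P" "p \<in> mod_hom R A P" "q \<in> mod_hom R B P"
    "\<And>a. a \<in> carrier A \<Longrightarrow> p a \<in> carrier P" "\<And>b. b \<in> carrier B \<Longrightarrow> q b \<in> carrier P"
    "\<And>h. h \<in> carrier H \<Longrightarrow> f h \<in> carrier A" "\<And>h. h \<in> carrier H \<Longrightarrow> g h \<in> carrier B"
    "\<And>h. h \<in> carrier H \<Longrightarrow> p (f h) = q (g h)"
  using assms unfolding pushout_square_def by (auto intro: mod_hom_closed)

lemma pushout_square_lift: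
  fixes A X :: "('a, 'u) module"
  assumes "pushout_square R H A B f g P p q"
    and "module R X" "x \<in> mod_hom R A X" "y \<in> mod_hom R B X"
    and "\<And>h. h \<in> carrier H \<Longrightarrow> x (f h) = y (g h)"
  obtains u where "u \<in> mod_hom R P X"
    "\<And>a. a \<in> carrier A \<Longrightarrow> u (p a) = x a" "\<And>b. b \<in> carrier B \<Longrightarrow> u (q b) = y b"
proof -
  have "\<exists>u\<in>mod_hom R P X. (\<forall>a\<in>carrier A. u (p a) = x a) \<and> (\<forall>b\<in>carrier B. u (q b) = y b)"
    using assms unfolding pushout_square_def by simp
  then show ?thesis using that by blast
qed

lemma pushout_square_eqI:
  fixes A X :: "('a, 'u) module"
  assumes "pushout_square R H A B f g P p q"
    and "module R X" "u \<in> mod_hom R P X" "v \<in> mod_hom R P X"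
    and "\<And>a. a \<in> carrier A \<Longrightarrow> u (p a) = v (p a)" "\<And>b. b \<in> carrier B \<Longrightarrow> u (q b) = v (q b)"
  shows "u = v"
  using assms unfolding pushout_square_def by simp

section \<open>Elements of chosen pushouts\<close>

lemma module_of_surjection:
  assumes "module R C" and q: "carrier Q = q ` carrier C" "\<zero>\<^bsub>Q\<^esub> = q \<zero>\<^bsub>C\<^esub>"
    "\<And>x y. \<lbrakk>x \<in> carrier C; y \<in> carrier C\<rbrakk> \<Longrightarrow> q x \<oplus>\<^bsub>Q\<^esub> q y = q (x \<oplus>\<^bsub>C\<^esub> y)"
    "\<And>r x. \<lbrakk>r \<in> carrier R; x \<in> carrier C\<rbrakk> \<Longrightarrow> r \<odot>\<^bsub>Q\<^esub> q x = q (r \<odot>\<^bsub>C\<^esub> x)"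
  shows "module R Q"
proof -
  interpret C: module R C by fact
  have "abelian_group Q"
  proof (rule abelian_groupI)
    fix x assume "x \<in> carrier Q"
    then obtain c where "c \<in> carrier C" "x = q c" using q by blast
    then show "\<exists>y\<in>carrier Q. y \<oplus>\<^bsub>Q\<^esub> x = \<zero>\<^bsub>Q\<^esub>"
      by (intro bexI[of _ "q (\<ominus>\<^bsub>C\<^esub> c)"]) (auto simp: q C.M.l_neg)
  qed (auto simp: q C.M.a_ac)
  then show ?thesis
    by (rule moduleI[OF C.R.cring_axioms])
       (auto simp: q C.smult_l_distr C.smult_r_distr C.smult_assoc1)
qed

text \<open>
  The cosets are replaced by chosen representatives, so that the carrier of the quotient stays in
  the type of the given module.
\<close>

lemma quotient_exists:
  fixes C :: "('a, 'u) module"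
  assumes "module R C" "submodule N R C"
  obtains Q :: "('a, 'u) module" and q
    where "module R Q" "q \<in> mod_hom R C Q" "\<And>c. c \<in> carrier C \<Longrightarrow> q c = \<zero>\<^bsub>Q\<^esub> \<longleftrightarrow> c \<in> N"
proof -
  interpret C: module R C by fact
  note N = C.submoduleE[OF assms(2)] C.submodule_zero[OF assms(2)]
  define rep where "rep x = (SOME y. y \<in> carrier C \<and> x \<ominus>\<^bsub>C\<^esub> y \<in> N)" for x
  have rep: "rep x \<in> carrier C \<and> x \<ominus>\<^bsub>C\<^esub> rep x \<in> N" if "x \<in> carrier C" for x
    unfolding rep_def
    by (rule someI[of "\<lambda>y. y \<in> carrier C \<and> x \<ominus>\<^bsub>C\<^esub> y \<in> N" x])
       (use that N(7) in \<open>simp add: C.M.minus_eq C.M.r_neg\<close>)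
  have trans: "x \<ominus>\<^bsub>C\<^esub> z \<in> N" if "x \<ominus>\<^bsub>C\<^esub> y \<in> N" "y \<ominus>\<^bsub>C\<^esub> z \<in> N"
    "x \<in> carrier C" "y \<in> carrier C" "z \<in> carrier C" for x y z
  proof -
    have "x \<ominus>\<^bsub>C\<^esub> z = (x \<ominus>\<^bsub>C\<^esub> y) \<oplus>\<^bsub>C\<^esub> (y \<ominus>\<^bsub>C\<^esub> z)"
      using that(3-5) by (simp add: C.M.minus_eq C.M.a_assoc C.M.r_neg1)
    then show ?thesis using N(5)[OF that(1,2)] by simp
  qed
  have sym: "y \<ominus>\<^bsub>C\<^esub> x \<in> N" if "x \<ominus>\<^bsub>C\<^esub> y \<in> N" "x \<in> carrier C" "y \<in> carrier C" for x y
  proof -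
    have "y \<ominus>\<^bsub>C\<^esub> x = \<ominus>\<^bsub>C\<^esub> (x \<ominus>\<^bsub>C\<^esub> y)"
      using that(2,3) by (simp add: C.M.minus_eq C.M.minus_add C.M.a_comm)
    then show ?thesis using N(3)[OF that(1)] by simp
  qed
  have rep_eq: "rep x = rep y \<longleftrightarrow> x \<ominus>\<^bsub>C\<^esub> y \<in> N" if x: "x \<in> carrier C" and y: "y \<in> carrier C" for x y
  proof
    assume "rep x = rep y"
    then show "x \<ominus>\<^bsub>C\<^esub> y \<in> N" using rep[OF x] rep[OF y] x y by (metis sym trans)
  next
    assume xy: "x \<ominus>\<^bsub>C\<^esub> y \<in> N"
    have "(\<lambda>z. z \<in> carrier C \<and> x \<ominus>\<^bsub>C\<^esub> z \<in> N) = (\<lambda>z. z \<in> carrier C \<and> y \<ominus>\<^bsub>C\<^esub> z \<in> N)"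
      using trans[OF xy _ x y] trans[OF sym[OF xy x y] _ y x] by blast
    then show "rep x = rep y" unfolding rep_def by simp
  qed
  define Q where "Q = C\<lparr>carrier := rep ` carrier C, zero := rep \<zero>\<^bsub>C\<^esub>,
    add := \<lambda>x y. rep (x \<oplus>\<^bsub>C\<^esub> y), smult := \<lambda>r x. rep (r \<odot>\<^bsub>C\<^esub> x)\<rparr>"
  have Q_simps: "carrier Q = rep ` carrier C" "\<zero>\<^bsub>Q\<^esub> = rep \<zero>\<^bsub>C\<^esub>"
    "x \<oplus>\<^bsub>Q\<^esub> y = rep (x \<oplus>\<^bsub>C\<^esub> y)" "r \<odot>\<^bsub>Q\<^esub> x = rep (r \<odot>\<^bsub>C\<^esub> x)" for r x y
    by (simp_all add: Q_def)
  have Qadd: "rep x \<oplus>\<^bsub>Q\<^esub> rep y = rep (x \<oplus>\<^bsub>C\<^esub> y)" if "x \<in> carrier C" "y \<in> carrier C" for x y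
  proof -
    have "(x \<oplus>\<^bsub>C\<^esub> y) \<ominus>\<^bsub>C\<^esub> (rep x \<oplus>\<^bsub>C\<^esub> rep y) = (x \<ominus>\<^bsub>C\<^esub> rep x) \<oplus>\<^bsub>C\<^esub> (y \<ominus>\<^bsub>C\<^esub> rep y)"
      using that rep by (simp add: C.M.minus_eq C.M.minus_add C.M.a_ac)
    then show ?thesis unfolding Q_simps
      using that rep N(5) rep_eq[of "x \<oplus>\<^bsub>C\<^esub> y" "rep x \<oplus>\<^bsub>C\<^esub> rep y"] by simp
  qed
  have Qsm: "r \<odot>\<^bsub>Q\<^esub> rep x = rep (r \<odot>\<^bsub>C\<^esub> x)" if "r \<in> carrier R" "x \<in> carrier C" for r x
  proof -
    have "r \<odot>\<^bsub>C\<^esub> x \<ominus>\<^bsub>C\<^esub> r \<odot>\<^bsub>C\<^esub> rep x = r \<odot>\<^bsub>C\<^esub> (x \<ominus>\<^bsub>C\<^esub> rep x)"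
      using that rep by (simp add: C.M.minus_eq C.smult_r_distr C.smult_r_minus)
    then show ?thesis unfolding Q_simps
      using that rep N(4) rep_eq[of "r \<odot>\<^bsub>C\<^esub> x" "r \<odot>\<^bsub>C\<^esub> rep x"] by simp
  qed
  have "module R Q"
    by (rule module_of_surjection[where q = rep, OF assms(1)]) (use Qadd Qsm in \<open>auto simp: Q_simps\<close>)
  moreover have "(\<lambda>x\<in>carrier C. rep x) \<in> mod_hom R C Q"
    by (rule mod_hom_restrictI) (use Qadd Qsm assms in \<open>auto simp: Q_simps(1)\<close>)
  moreover have "(\<lambda>x\<in>carrier C. rep x) c = \<zero>\<^bsub>Q\<^esub> \<longleftrightarrow> c \<in> N" if "c \<in> carrier C" for c
  proof -
    have "c \<ominus>\<^bsub>C\<^esub> \<zero>\<^bsub>C\<^esub> = c"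
      using that C.M.minus_equality[of "\<zero>\<^bsub>C\<^esub>" "\<zero>\<^bsub>C\<^esub>"] by (simp add: C.M.minus_eq)
    then show ?thesis using that rep_eq[of c "\<zero>\<^bsub>C\<^esub>"] by (simp add: Q_simps)
  qed
  ultimately show ?thesis using that by blast
qed

locale chosen_pushouts = cring R
  for R :: "('a, 'r) ring_scheme" (structure) +
  fixes po :: "('a, 'u) span \<Rightarrow> ('a, 'u) cospan"
  assumes choice: "pushout_choice R po"
begin

lemma chosen_square:
  assumes "module R H" "module R A" "module R B" "f \<in> mod_hom R H A" "g \<in> mod_hom R H B"
  defines "P \<equiv> po \<lparr>centre = H, lfoot = A, rfoot = B, lmap = f, rmap = g\<rparr>"
  shows "pushout_square R H A B f g (apex P) (lleg P) (rleg P)"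
proof -
  let ?S = "\<lparr>centre = H, lfoot = A, rfoot = B, lmap = f, rmap = g\<rparr>"
  have "is_span R ?S" using assms by (simp add: is_span_def)
  then have P: "is_cocone R ?S P" "\<And>D. is_cocone R ?S D \<Longrightarrow> \<exists>!u. cospan_map R A B P D u"
    using choice unfolding pushout_choice_def is_pushout_def P_def
    by (blast, metis span.select_convs(2,3))
  have legs: "module R (apex P)" "lleg P \<in> mod_hom R A (apex P)" "rleg P \<in> mod_hom R B (apex P)"
    and commute: "\<forall>h\<in>carrier H. lleg P (f h) = rleg P (g h)"
    using P(1) by (auto simp: is_cocone_def is_cospan_def compose_eq_iff)
  have uniq: "\<exists>!u. u \<in> mod_hom R (apex P) X \<and> (\<forall>a\<in>carrier A. u (lleg P a) = x a) \<and>
      (\<forall>b\<in>carrier B. u (rleg P b) = y b)"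
    if "module R X" "x \<in> mod_hom R A X" "y \<in> mod_hom R B X" "\<forall>h\<in>carrier H. x (f h) = y (g h)" for X :: "('a, 'u) module" and x y
  proof -
    have "is_cocone R ?S \<lparr>apex = X, lleg = x, rleg = y\<rparr>"
      using that assms by (simp add: is_cocone_def is_cospan_def compose_eq_iff)
    from P(2)[OF this] show ?thesis
      using that by (simp add: cospan_map_def compose_eq_mod_hom_iff)
  qed
  show ?thesis unfolding pushout_square_def
  proof (intro conjI allI impI)
    fix X :: "('a, 'u) module" and x y
    assume "module R X" "x \<in> mod_hom R A X" "y \<in> mod_hom R B X" "\<forall>h\<in>carrier H. x (f h) = y (g h)"
    from uniq[OF this] show "\<exists>u\<in>mod_hom R (apex P) X. (\<forall>a\<in>carrier A. u (lleg P a) = x a) \<and>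
      (\<forall>b\<in>carrier B. u (rleg P b) = y b)" by blast
  next
    fix X :: "('a, 'u) module" and u v
    assume X: "module R X" and u: "u \<in> mod_hom R (apex P) X" and v: "v \<in> mod_hom R (apex P) X"
      and eq: "\<forall>a\<in>carrier A. u (lleg P a) = v (lleg P a)" "\<forall>b\<in>carrier B. u (rleg P b) = v (rleg P b)"
    have "\<exists>!w. w \<in> mod_hom R (apex P) X \<and>
      (\<forall>a\<in>carrier A. w (lleg P a) = compose (carrier A) u (lleg P) a) \<and>
      (\<forall>b\<in>carrier B. w (rleg P b) = compose (carrier B) u (rleg P) b)"
      using assms commute
      by (intro uniq X compose_mod_hom[OF _ u] legs)
         (auto simp: mod_hom_closed[OF assms(4)] mod_hom_closed[OF assms(5)])
    then show "u = v" using u v eq by (auto simp: compose_eq)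
  qed (use assms legs commute in \<open>auto dest: mod_hom_funcset\<close>)
qed

lemma induced_map_props:
  assumes "module R H" "module R A" "module R B" "f \<in> mod_hom R H A" "g \<in> mod_hom R H B"
    and X: "module R X" "x \<in> mod_hom R A X" "y \<in> mod_hom R B X"
      "\<And>h. h \<in> carrier H \<Longrightarrow> x (f h) = y (g h)"
  defines "S \<equiv> \<lparr>centre = H, lfoot = A, rfoot = B, lmap = f, rmap = g\<rparr>"
  defines "u \<equiv> induced_map R po S \<lparr>apex = X, lleg = x, rleg = y\<rparr>"
  shows "u \<in> mod_hom R (apex (po S)) X" "\<And>a. a \<in> carrier A \<Longrightarrow> u (lleg (po S) a) = x a"
    "\<And>b. b \<in> carrier B \<Longrightarrow> u (rleg (po S) b) = y b"
proof -
  have "is_span R S" using assms by (simp add: is_span_def)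
  then have "is_pushout R S (po S)"
    using choice unfolding pushout_choice_def by blast
  moreover have "is_cocone R S \<lparr>apex = X, lleg = x, rleg = y\<rparr>"
    using assms by (simp add: is_cocone_def is_cospan_def compose_eq_iff)
  ultimately have "\<exists>!u. cospan_map R (lfoot S) (rfoot S) (po S) \<lparr>apex = X, lleg = x, rleg = y\<rparr> u"
    unfolding is_pushout_def by blast
  then have "\<exists>!u. cospan_map R A B (po S) \<lparr>apex = X, lleg = x, rleg = y\<rparr> u"
    by (simp add: S_def)
  from theI'[OF this] have "cospan_map R A B (po S) \<lparr>apex = X, lleg = x, rleg = y\<rparr> u"
    by (simp add: u_def induced_map_def S_def)
  then show "u \<in> mod_hom R (apex (po S)) X" "\<And>a. a \<in> carrier A \<Longrightarrow> u (lleg (po S) a) = x a"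
    "\<And>b. b \<in> carrier B \<Longrightarrow> u (rleg (po S) b) = y b"
    using X by (auto simp: cospan_map_def compose_eq_mod_hom_iff)
qed

text \<open>
  The chosen pushout over a zero module is a coproduct; its universal property supplies both
  projections.
\<close>

lemma biproduct_exists:
  fixes A B :: "('a, 'u) module"
  assumes "module R A" "module R B"
  shows "\<exists>(C :: ('a, 'u) module) i j p q. module R C \<and>
    i \<in> mod_hom R A C \<and> j \<in> mod_hom R B C \<and> p \<in> mod_hom R C A \<and> q \<in> mod_hom R C B \<and>
    (\<forall>a\<in>carrier A. p (i a) = a \<and> q (i a) = \<zero>\<^bsub>B\<^esub>) \<and> (\<forall>b\<in>carrier B. p (j b) = \<zero>\<^bsub>A\<^esub> \<and> q (j b) = b)"
proof -
  interpret A: module R A by fact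
  interpret B: module R B by fact
  define Z where "Z = A\<lparr>carrier := {\<zero>\<^bsub>A\<^esub>}\<rparr>"
  have "submodule {\<zero>\<^bsub>A\<^esub>} R A" by (rule A.submoduleI_smult) auto
  then have Z: "module R Z" unfolding Z_def by (rule submodule.submodule_is_module) fact
  have zero_hom: "(\<lambda>_\<in>carrier M. \<zero>\<^bsub>N\<^esub>) \<in> mod_hom R M N" if "module R M" "module R N" for M N :: "('a, 'u) module"
  proof -
    interpret N: module R N by fact
    show ?thesis by (rule mod_hom_restrictI) (use that in auto)
  qed
  define P where "P = po \<lparr>centre = Z, lfoot = A, rfoot = B,
    lmap = (\<lambda>_\<in>carrier Z. \<zero>\<^bsub>A\<^esub>), rmap = (\<lambda>_\<in>carrier Z. \<zero>\<^bsub>B\<^esub>)\<rparr>"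
  have P: "pushout_square R Z A B (\<lambda>_\<in>carrier Z. \<zero>\<^bsub>A\<^esub>) (\<lambda>_\<in>carrier Z. \<zero>\<^bsub>B\<^esub>) (apex P) (lleg P) (rleg P)"
    unfolding P_def by (intro chosen_square Z assms zero_hom)
  obtain p where p: "p \<in> mod_hom R (apex P) A" "\<And>a. a \<in> carrier A \<Longrightarrow> p (lleg P a) = id_hom A a"
    "\<And>b. b \<in> carrier B \<Longrightarrow> p (rleg P b) = (\<lambda>_\<in>carrier B. \<zero>\<^bsub>A\<^esub>) b"
    by (rule pushout_square_lift[OF P assms(1) id_hom_mod_hom[OF assms(1)] zero_hom[OF assms(2,1)]]) auto
  obtain q where q: "q \<in> mod_hom R (apex P) B" "\<And>a. a \<in> carrier A \<Longrightarrow> q (lleg P a) = (\<lambda>_\<in>carrier A. \<zero>\<^bsub>B\<^esub>) a"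
    "\<And>b. b \<in> carrier B \<Longrightarrow> q (rleg P b) = id_hom B b"
    by (rule pushout_square_lift[OF P assms(2) zero_hom[OF assms(1,2)] id_hom_mod_hom[OF assms(2)]]) auto
  show ?thesis
    using pushout_squareD(3-5)[OF P] p q by (intro exI[of _ "apex P"] exI[of _ "lleg P"] exI[of _ "rleg P"] exI[of _ p] exI[of _ q]) auto
qed

text \<open>
  In a biproduct \<open>C\<close> of the two feet let \<open>N\<close> be the image of \<open>h \<mapsto> i (f h) - j (g h)\<close>, described by the
  two projections.  The maps into the quotient of \<open>C\<close> by \<open>N\<close> form a cocone which identifies \<open>a\<close> and
  \<open>b\<close> only if they come from a common element of \<open>H\<close>, and every cocone factors through the pushout.
\<close>

lemma pushout_square_kernel:
  fixes A :: "('a, 'u) module"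
  assumes P: "pushout_square R H A B f g P p q" and H: "module R H"
    and f: "f \<in> mod_hom R H A" and g: "g \<in> mod_hom R H B"
    and a: "a \<in> carrier A" and b: "b \<in> carrier B" and ab: "p a = q b"
  shows "\<exists>h\<in>carrier H. a = f h \<and> b = g h"
proof -
  note Pd = pushout_squareD[OF P]
  interpret H: module R H by fact
  interpret A: module R A by (fact Pd)
  interpret B: module R B by (fact Pd)
  obtain C :: "('a, 'u) module" and i j \<pi> \<rho> where C: "module R C" "i \<in> mod_hom R A C" "j \<in> mod_hom R B C"
    "\<pi> \<in> mod_hom R C A" "\<rho> \<in> mod_hom R C B"
    and proj: "\<And>a. a \<in> carrier A \<Longrightarrow> \<pi> (i a) = a" "\<And>a. a \<in> carrier A \<Longrightarrow> \<rho> (i a) = \<zero>\<^bsub>B\<^esub>"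
      "\<And>b. b \<in> carrier B \<Longrightarrow> \<pi> (j b) = \<zero>\<^bsub>A\<^esub>" "\<And>b. b \<in> carrier B \<Longrightarrow> \<rho> (j b) = b"
    using biproduct_exists[OF Pd(1,2)] by blast
  interpret C: module R C by fact
  note cl [simp] = mod_hom_closed[OF C(2)] mod_hom_closed[OF C(3)] mod_hom_closed[OF C(4)]
    mod_hom_closed[OF C(5)] mod_hom_closed[OF f] mod_hom_closed[OF g]
  define N where "N = {c \<in> carrier C. \<exists>h\<in>carrier H. \<pi> c = f h \<and> \<rho> c = \<ominus>\<^bsub>B\<^esub> g h}"
  have diff: "\<pi> (i a \<ominus>\<^bsub>C\<^esub> j b) = a" "\<rho> (i a \<ominus>\<^bsub>C\<^esub> j b) = \<ominus>\<^bsub>B\<^esub> b"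
    if "a \<in> carrier A" "b \<in> carrier B" for a b
    using that A.M.minus_equality[of "\<zero>\<^bsub>A\<^esub>" "\<zero>\<^bsub>A\<^esub>"]
    by (simp_all add: mod_hom_minus[OF C(1) Pd(1) C(4)] mod_hom_minus[OF C(1) Pd(2) C(5)] proj
        A.M.minus_eq B.M.minus_eq)
  have "\<ominus>\<^bsub>B\<^esub> \<zero>\<^bsub>B\<^esub> = \<zero>\<^bsub>B\<^esub>" by (rule B.M.minus_equality) auto
  note minus_zero = this[symmetric]
  have "submodule N R C"
  proof (rule C.submoduleI_smult)
    show "\<zero>\<^bsub>C\<^esub> \<in> N" unfolding N_def
      using mod_hom_zero[OF H Pd(1) f] mod_hom_zero[OF H Pd(2) g] mod_hom_zero[OF C(1) Pd(1) C(4)]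
        mod_hom_zero[OF C(1) Pd(2) C(5)] minus_zero
      by (auto intro!: bexI[of _ "\<zero>\<^bsub>H\<^esub>"])
  next
    fix x y assume "x \<in> N" "y \<in> N"
    then obtain h k where h: "x \<in> carrier C" "h \<in> carrier H" "\<pi> x = f h" "\<rho> x = \<ominus>\<^bsub>B\<^esub> g h"
      and k: "y \<in> carrier C" "k \<in> carrier H" "\<pi> y = f k" "\<rho> y = \<ominus>\<^bsub>B\<^esub> g k"
      unfolding N_def by blast
    then show "x \<oplus>\<^bsub>C\<^esub> y \<in> N" unfolding N_def
      by (auto simp: mod_hom_add[OF C(4)] mod_hom_add[OF C(5)] mod_hom_add[OF f] mod_hom_add[OF g]
          B.M.minus_add intro!: bexI[of _ "h \<oplus>\<^bsub>H\<^esub> k"])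
  next
    fix r x assume r: "r \<in> carrier R" and "x \<in> N"
    then obtain h where h: "x \<in> carrier C" "h \<in> carrier H" "\<pi> x = f h" "\<rho> x = \<ominus>\<^bsub>B\<^esub> g h"
      unfolding N_def by blast
    then show "r \<odot>\<^bsub>C\<^esub> x \<in> N" unfolding N_def using r
      by (auto simp: mod_hom_smult[OF C(4)] mod_hom_smult[OF C(5)] mod_hom_smult[OF f] mod_hom_smult[OF g]
          B.smult_r_minus intro!: bexI[of _ "r \<odot>\<^bsub>H\<^esub> h"])
  qed (auto simp: N_def)
  then obtain Q :: "('a, 'u) module" and t where Q: "module R Q" "t \<in> mod_hom R C Q"
    "\<And>c. c \<in> carrier C \<Longrightarrow> t c = \<zero>\<^bsub>Q\<^esub> \<longleftrightarrow> c \<in> N"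
    using quotient_exists[OF C(1)] by blast
  interpret Q: module R Q by fact
  have key: "t (i a) = t (j b) \<longleftrightarrow> (\<exists>h\<in>carrier H. a = f h \<and> b = g h)"
    if a: "a \<in> carrier A" and b: "b \<in> carrier B" for a b
  proof -
    have "t (i a) = t (j b) \<longleftrightarrow> t (i a \<ominus>\<^bsub>C\<^esub> j b) = \<zero>\<^bsub>Q\<^esub>"
      using that mod_hom_closed[OF Q(2)] Q.M.minus_eq_zero_iff by (simp add: mod_hom_minus[OF C(1) Q(1,2)])
    also have "\<dots> \<longleftrightarrow> (\<exists>h\<in>carrier H. a = f h \<and> \<ominus>\<^bsub>B\<^esub> b = \<ominus>\<^bsub>B\<^esub> g h)"
      using that Q(3)[of "i a \<ominus>\<^bsub>C\<^esub> j b"] by (simp add: N_def diff)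
    also have "\<dots> \<longleftrightarrow> (\<exists>h\<in>carrier H. a = f h \<and> b = g h)"
      using b by (metis B.M.minus_minus mod_hom_closed[OF g])
    finally show ?thesis .
  qed
  obtain u where u: "u \<in> mod_hom R P Q"
    "\<And>a. a \<in> carrier A \<Longrightarrow> u (p a) = compose (carrier A) t i a"
    "\<And>b. b \<in> carrier B \<Longrightarrow> u (q b) = compose (carrier B) t j b"
    by (rule pushout_square_lift[OF P Q(1) compose_mod_hom[OF C(2) Q(2) Pd(1)] compose_mod_hom[OF C(3) Q(2) Pd(2)]])
       (use key in auto)
  have "t (i a) = t (j b)" using u(2)[OF a] u(3)[OF b] a b ab by simp
  then show ?thesis using key[OF a b] by blast
qed

end

section \<open>Gluing pushout squares\<close>

lemma mod_isoI:
  assumes "\<phi> \<in> mod_hom R A B" "\<psi> \<in> mod_hom R B A"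
    and "\<And>a. a \<in> carrier A \<Longrightarrow> \<psi> (\<phi> a) = a" "\<And>b. b \<in> carrier B \<Longrightarrow> \<phi> (\<psi> b) = b"
  shows "\<phi> \<in> mod_iso R A B"
proof -
  have "bij_betw \<phi> (carrier A) (carrier B)"
    by (rule bij_betw_byWitness[where f' = \<psi>]) (use assms in \<open>auto simp: mod_hom_closed\<close>)
  then show ?thesis using assms(1) by (simp add: mod_iso_def)
qed

lemma mod_iso_mod_hom: "\<phi> \<in> mod_iso R A B \<Longrightarrow> \<phi> \<in> mod_hom R A B"
  by (simp add: mod_iso_def)

lemma mod_iso_inverse:
  assumes \<phi>: "\<phi> \<in> mod_iso R A B" and A: "module R A" and B: "module R B"
  shows "\<exists>\<psi>\<in>mod_iso R B A. (\<forall>a\<in>carrier A. \<psi> (\<phi> a) = a) \<and> (\<forall>b\<in>carrier B. \<phi> (\<psi> b) = b)"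
proof -
  interpret A: module R A by fact
  have hom: "\<phi> \<in> mod_hom R A B" and bij: "bij_betw \<phi> (carrier A) (carrier B)"
    using \<phi> by (auto simp: mod_iso_def)
  define \<psi> where "\<psi> = (\<lambda>b\<in>carrier B. inv_into (carrier A) \<phi> b)"
  have left: "\<psi> (\<phi> a) = a" if "a \<in> carrier A" for a
    using that bij mod_hom_closed[OF hom] by (simp add: \<psi>_def bij_betw_inv_into_left)
  have right: "\<phi> (\<psi> b) = b" if "b \<in> carrier B" for b
    using that bij by (simp add: \<psi>_def bij_betw_inv_into_right)
  have cl: "inv_into (carrier A) \<phi> b \<in> carrier A" if "b \<in> carrier B" for b
    using that bij by (metis bij_betw_def inv_into_into)
  have \<psi>: "\<psi> \<in> mod_hom R B A"
    unfolding \<psi>_def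
  proof (rule mod_hom_restrictI[OF cl _ _ B])
    fix x y assume xy: "x \<in> carrier B" "y \<in> carrier B"
    let ?z = "\<psi> x \<oplus>\<^bsub>A\<^esub> \<psi> y"
    have "\<phi> ?z = x \<oplus>\<^bsub>B\<^esub> y" using xy right cl by (simp add: mod_hom_add[OF hom] \<psi>_def)
    then have "\<psi> (x \<oplus>\<^bsub>B\<^esub> y) = ?z" using left[of ?z] xy cl by (simp add: \<psi>_def)
    then show "inv_into (carrier A) \<phi> (x \<oplus>\<^bsub>B\<^esub> y) = inv_into (carrier A) \<phi> x \<oplus>\<^bsub>A\<^esub> inv_into (carrier A) \<phi> y"
      using xy module.axioms(2)[OF B] abelian_group.axioms(1) abelian_monoid.a_closed
      by (fastforce simp: \<psi>_def)
  next
    fix r x assume rx: "r \<in> carrier R" "x \<in> carrier B"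
    let ?z = "r \<odot>\<^bsub>A\<^esub> \<psi> x"
    have "\<phi> ?z = r \<odot>\<^bsub>B\<^esub> x" using rx right cl by (simp add: mod_hom_smult[OF hom] \<psi>_def)
    then have "\<psi> (r \<odot>\<^bsub>B\<^esub> x) = ?z" using left[of ?z] rx cl by (simp add: \<psi>_def)
    then show "inv_into (carrier A) \<phi> (r \<odot>\<^bsub>B\<^esub> x) = r \<odot>\<^bsub>A\<^esub> inv_into (carrier A) \<phi> x"
      using rx module.smult_closed[OF B] by (simp add: \<psi>_def)
  qed
  have "\<psi> \<in> mod_iso R B A" using right left by (intro mod_isoI[OF \<psi> hom]) auto
  then show ?thesis using left right by blast
qed

lemma compose_mod_iso:
  assumes "\<phi> \<in> mod_iso R A B" "\<psi> \<in> mod_iso R B C" "module R A"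
  shows "compose (carrier A) \<psi> \<phi> \<in> mod_iso R A C"
  using assms unfolding mod_iso_def by (auto intro: compose_mod_hom bij_betw_compose)

lemma id_hom_mod_iso: "module R M \<Longrightarrow> id_hom M \<in> mod_iso R M M"
  by (intro mod_isoI[of _ _ _ _ "id_hom M"] id_hom_mod_hom) auto

lemma pushout_square_cong:
  assumes "pushout_square R H A B f g P p q"
    and "\<And>h. h \<in> carrier H \<Longrightarrow> f h = f' h" "\<And>h. h \<in> carrier H \<Longrightarrow> g h = g' h"
  shows "pushout_square R H A B f' g' P p q"
proof -
  have "f' \<in> carrier H \<rightarrow> carrier A" "g' \<in> carrier H \<rightarrow> carrier B"
    using assms pushout_squareD(8,9)[OF assms(1)] by (auto simp: Pi_def)
  then show ?thesis using assms unfolding pushout_square_def by simp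
qed

text \<open>
  Uniqueness for two composites out of a pushout.  With \<open>l\<close> and \<open>l'\<close> the maps from this pushout into
  a larger one, it lets equality on an iterated pushout be reduced to the modules glued.
\<close>

lemma pushout_square_comp_eqI:
  fixes P X Y Y' :: "('a, 'u) module"
  assumes P: "pushout_square R H A B f g P p q" and X: "module R X"
    and l: "l \<in> mod_hom R P Y" and u: "u \<in> mod_hom R Y X"
    and l': "l' \<in> mod_hom R P Y'" and v: "v \<in> mod_hom R Y' X"
    and "\<And>a. a \<in> carrier A \<Longrightarrow> u (l (p a)) = v (l' (p a))"
    and "\<And>b. b \<in> carrier B \<Longrightarrow> u (l (q b)) = v (l' (q b))"
    and x: "x \<in> carrier P"
  shows "u (l x) = v (l' x)"
proof -
  note Pd = pushout_squareD[OF P]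
  have "compose (carrier P) u l = compose (carrier P) v l'"
    by (rule pushout_square_eqI[OF P X]) (use assms Pd in \<open>auto intro: compose_mod_hom\<close>)
  then show ?thesis using x by (simp add: compose_eq_iff)
qed

lemma pushout_square_id:
  fixes P :: "('a, 'u) module"
  assumes P: "pushout_square R H A B f g P p q" and w: "w \<in> mod_hom R P P"
    and "\<And>a. a \<in> carrier A \<Longrightarrow> w (p a) = p a" "\<And>b. b \<in> carrier B \<Longrightarrow> w (q b) = q b"
  shows "w = id_hom P"
  by (rule pushout_square_eqI[OF P _ w id_hom_mod_hom]) (use assms pushout_squareD[OF P] in auto)

lemma pushout_square_unique:
  fixes P P' :: "('a, 'u) module"
  assumes P: "pushout_square R H A B f g P p q" and P': "pushout_square R H A B f g P' p' q'"
  shows "\<exists>\<phi>\<in>mod_iso R P P'. (\<forall>a\<in>carrier A. \<phi> (p a) = p' a) \<and> (\<forall>b\<in>carrier B. \<phi> (q b) = q' b)"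
proof -
  note Pd = pushout_squareD[OF P] and P'd = pushout_squareD[OF P']
  obtain u where u: "u \<in> mod_hom R P P'" "\<And>a. a \<in> carrier A \<Longrightarrow> u (p a) = p' a"
      "\<And>b. b \<in> carrier B \<Longrightarrow> u (q b) = q' b"
    by (rule pushout_square_lift[OF P P'd(3,4,5,10)]) auto
  obtain v where v: "v \<in> mod_hom R P' P" "\<And>a. a \<in> carrier A \<Longrightarrow> v (p' a) = p a"
      "\<And>b. b \<in> carrier B \<Longrightarrow> v (q' b) = q b"
    by (rule pushout_square_lift[OF P' Pd(3,4,5,10)]) auto
  have "compose (carrier P) v u = id_hom P"
    by (rule pushout_square_id[OF P compose_mod_hom[OF u(1) v(1) Pd(3)]]) (use u v Pd in auto)
  then have "v (u x) = x" if "x \<in> carrier P" for x using that by (metis compose_apply id_hom_apply)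
  moreover have "compose (carrier P') u v = id_hom P'"
    by (rule pushout_square_id[OF P' compose_mod_hom[OF v(1) u(1) P'd(3)]]) (use u v P'd in auto)
  then have "u (v x) = x" if "x \<in> carrier P'" for x using that by (metis compose_apply id_hom_apply)
  ultimately have "u \<in> mod_iso R P P'" by (intro mod_isoI[OF u(1) v(1)])
  then show ?thesis using u by blast
qed

text \<open>
  Replacing the feet of a span by isomorphic modules does not change its pushout; for the
  composition of isomorphism classes this is independence of the representatives.
\<close>

lemma pushout_square_transport:
  fixes A B A' B' P :: "('a, 'u) module"
  assumes P: "pushout_square R H A' B' f' g' P p q"
    and A: "module R A" and B: "module R B"
    and \<phi>: "\<phi> \<in> mod_iso R A A'" and \<psi>: "\<psi> \<in> mod_iso R B B'"
    and f: "\<And>h. h \<in> carrier H \<Longrightarrow> f h \<in> carrier A" "\<And>h. h \<in> carrier H \<Longrightarrow> \<phi> (f h) = f' h"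
    and g: "\<And>h. h \<in> carrier H \<Longrightarrow> g h \<in> carrier B" "\<And>h. h \<in> carrier H \<Longrightarrow> \<psi> (g h) = g' h"
  shows "pushout_square R H A B f g P (compose (carrier A) p \<phi>) (compose (carrier B) q \<psi>)"
proof -
  note Pd = pushout_squareD[OF P]
  note hom = mod_iso_mod_hom[OF \<phi>] mod_iso_mod_hom[OF \<psi>]
  note cl [simp] = mod_hom_closed[OF hom(1)] mod_hom_closed[OF hom(2)]
  obtain \<phi>' where \<phi>': "\<phi>' \<in> mod_hom R A' A" "\<And>a. a \<in> carrier A \<Longrightarrow> \<phi>' (\<phi> a) = a"
    "\<And>a. a \<in> carrier A' \<Longrightarrow> \<phi> (\<phi>' a) = a"
    using mod_iso_inverse[OF \<phi> A Pd(1)] mod_iso_mod_hom by blast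
  obtain \<psi>' where \<psi>': "\<psi>' \<in> mod_hom R B' B" "\<And>a. a \<in> carrier B \<Longrightarrow> \<psi>' (\<psi> a) = a"
    "\<And>a. a \<in> carrier B' \<Longrightarrow> \<psi> (\<psi>' a) = a"
    using mod_iso_inverse[OF \<psi> B Pd(2)] mod_iso_mod_hom by blast
  note cl' [simp] = mod_hom_closed[OF \<phi>'(1)] mod_hom_closed[OF \<psi>'(1)]
  show ?thesis unfolding pushout_square_def
  proof (intro conjI allI impI)
    fix X :: "('a, 'u) module" and x y
    assume X: "module R X" and x: "x \<in> mod_hom R A X" and y: "y \<in> mod_hom R B X"
      and xy: "\<forall>h\<in>carrier H. x (f h) = y (g h)"
    have "compose (carrier A') x \<phi>' (f' h) = compose (carrier B') y \<psi>' (g' h)" if "h \<in> carrier H" for h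
      using that Pd(8,9)[OF that] f g xy \<phi>' \<psi>' by (metis compose_apply)
    then obtain u where u: "u \<in> mod_hom R P X" "\<And>a. a \<in> carrier A' \<Longrightarrow> u (p a) = compose (carrier A') x \<phi>' a"
      "\<And>b. b \<in> carrier B' \<Longrightarrow> u (q b) = compose (carrier B') y \<psi>' b"
      by (rule pushout_square_lift[OF P X compose_mod_hom[OF \<phi>'(1) x Pd(1)] compose_mod_hom[OF \<psi>'(1) y Pd(2)]]) auto
    have "\<forall>a\<in>carrier A. u (compose (carrier A) p \<phi> a) = x a"
      "\<forall>b\<in>carrier B. u (compose (carrier B) q \<psi> b) = y b"
      using u(2,3) \<phi>'(2) \<psi>'(2) by simp_all
    then show "\<exists>u\<in>mod_hom R P X. (\<forall>a\<in>carrier A. u (compose (carrier A) p \<phi> a) = x a) \<and>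
      (\<forall>b\<in>carrier B. u (compose (carrier B) q \<psi> b) = y b)"
      using u(1) by blast
  next
    fix X :: "('a, 'u) module" and u v
    assume X: "module R X" and uv: "u \<in> mod_hom R P X" "v \<in> mod_hom R P X"
      and eq: "\<forall>a\<in>carrier A. u (compose (carrier A) p \<phi> a) = v (compose (carrier A) p \<phi> a)"
        "\<forall>b\<in>carrier B. u (compose (carrier B) q \<psi> b) = v (compose (carrier B) q \<psi> b)"
    show "u = v"
    proof (rule pushout_square_eqI[OF P X uv])
      fix a assume "a \<in> carrier A'"
      then show "u (p a) = v (p a)" using bspec[OF eq(1), of "\<phi>' a"] \<phi>'(3) by simp
    next
      fix b assume "b \<in> carrier B'"
      then show "u (q b) = v (q b)" using bspec[OF eq(2), of "\<psi>' b"] \<psi>'(3) by simp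
    qed
  qed (use A B Pd f g hom in \<open>auto intro: compose_mod_hom\<close>)
qed

text \<open>
  For \<open>A \<leftarrow> H \<rightarrow> B \<leftarrow> H' \<rightarrow> C\<close> both \<open>Q\<close> and \<open>Q'\<close> are colimits of the whole diagram: a cocone amounts to
  maps out of \<open>A\<close>, \<open>B\<close> and \<open>C\<close> agreeing on \<open>H\<close> and \<open>H'\<close>.  Each is constructed in two stages, hence the
  auxiliary maps \<open>u1\<close> and \<open>v1\<close> out of the intermediate pushouts.
\<close>

lemma pushout_square_assoc:
  fixes A B C BA CB Q Q' :: "('a, 'u) module"
  assumes BA: "pushout_square R H A B f g BA p q"
    and Q: "pushout_square R H' BA C (\<lambda>y. q (g' y)) h Q r s"
    and CB: "pushout_square R H' B C g' h CB p' q'"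
    and Q': "pushout_square R H A CB f (\<lambda>x. p' (g x)) Q' r' s'"
  shows "\<exists>\<phi>\<in>mod_iso R Q' Q. (\<forall>a\<in>carrier A. \<phi> (r' a) = r (p a)) \<and>
    (\<forall>b\<in>carrier B. \<phi> (s' (p' b)) = r (q b)) \<and> (\<forall>c\<in>carrier C. \<phi> (s' (q' c)) = s c)"
proof -
  note d1 = pushout_squareD[OF BA] and d2 = pushout_squareD[OF Q]
    and d3 = pushout_squareD[OF CB] and d4 = pushout_squareD[OF Q']
  note [simp] = d1(6-9) d2(6,7) d3(6-9) d4(6,7)
  obtain u1 where u1: "u1 \<in> mod_hom R BA Q'" "\<And>a. a \<in> carrier A \<Longrightarrow> u1 (p a) = r' a"
      "\<And>b. b \<in> carrier B \<Longrightarrow> u1 (q b) = compose (carrier B) s' p' b"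
    by (rule pushout_square_lift[OF BA d4(3,4) compose_mod_hom[OF d3(4) d4(5) d1(2)]]) (use d4(10) in auto)
  obtain u where u: "u \<in> mod_hom R Q Q'" "\<And>x. x \<in> carrier BA \<Longrightarrow> u (r x) = u1 x"
      "\<And>c. c \<in> carrier C \<Longrightarrow> u (s c) = compose (carrier C) s' q' c"
    by (rule pushout_square_lift[OF Q d4(3) u1(1) compose_mod_hom[OF d3(5) d4(5) d3(2)]])
       (use u1(3) d3(9,10) in auto)
  obtain v1 where v1: "v1 \<in> mod_hom R CB Q" "\<And>b. b \<in> carrier B \<Longrightarrow> v1 (p' b) = compose (carrier B) r q b"
      "\<And>c. c \<in> carrier C \<Longrightarrow> v1 (q' c) = s c"
    by (rule pushout_square_lift[OF CB d2(3) compose_mod_hom[OF d1(5) d2(4) d1(2)] d2(5)]) (use d2(10) in auto)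
  obtain v where v: "v \<in> mod_hom R Q' Q" "\<And>a. a \<in> carrier A \<Longrightarrow> v (r' a) = compose (carrier A) r p a"
      "\<And>x. x \<in> carrier CB \<Longrightarrow> v (s' x) = v1 x"
    by (rule pushout_square_lift[OF Q' d2(3) compose_mod_hom[OF d1(4) d2(4) d1(1)] v1(1)])
       (use v1(2) d1(10) in auto)
  note c = mod_hom_closed[OF u(1)] mod_hom_closed[OF v(1)]
  have vu: "compose (carrier Q) v u \<in> mod_hom R Q Q" and uv: "compose (carrier Q') u v \<in> mod_hom R Q' Q'"
    using compose_mod_hom u v d2 d4 by blast+
  have "compose (carrier Q) v u (r x) = id_hom Q (r x)" if "x \<in> carrier BA" for x
    by (rule pushout_square_comp_eqI[OF BA d2(3,4) vu d2(4) id_hom_mod_hom[OF d2(3)] _ _ that])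
       (use u u1 v v1 in simp_all)
  then have "compose (carrier Q) v u = id_hom Q"
    by (intro pushout_square_id[OF Q vu]) (use u v v1 in simp_all)
  then have 1: "v (u x) = x" if "x \<in> carrier Q" for x using that by (metis compose_apply id_hom_apply)
  have "compose (carrier Q') u v (s' x) = id_hom Q' (s' x)" if "x \<in> carrier CB" for x
    by (rule pushout_square_comp_eqI[OF CB d4(3,5) uv d4(5) id_hom_mod_hom[OF d4(3)] _ _ that])
       (use u u1 v v1 in simp_all)
  then have "compose (carrier Q') u v = id_hom Q'"
    by (intro pushout_square_id[OF Q' uv]) (use u u1 v in simp_all)
  then have 2: "u (v x) = x" if "x \<in> carrier Q'" for x using that by (metis compose_apply id_hom_apply)
  have "v \<in> mod_iso R Q' Q" using 1 2 by (intro mod_isoI[OF v(1) u(1)])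
  then show ?thesis using v v1 by (intro bexI[of _ v]) simp_all
qed

text \<open>
  The modules \<open>A\<close>, \<open>A'\<close>, \<open>B\<close>, \<open>B'\<close> form a grid: \<open>A\<close> and \<open>A'\<close> are glued along \<open>T\<close>, \<open>B\<close> and \<open>B'\<close> along \<open>T'\<close>,
  and the two pairs along \<open>H\<close>, which maps to both \<open>T\<close> and \<open>T'\<close>.  Gluing columns first and rows
  afterwards gives \<open>P\<close>, the other order gives \<open>Q\<close>; the seam of \<open>Q\<close> is the pushout \<open>TT\<close> of the seams
  \<open>T\<close> and \<open>T'\<close>.
\<close>

lemma pushout_square_interchange:
  fixes A A' B B' VA VB HA HA' TT P Q :: "('a, 'u) module"
  assumes VA: "pushout_square R T A A' a a' VA va va'"
    and VB: "pushout_square R T' B B' b b' VB vb vb'"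
    and P: "pushout_square R H VA VB (\<lambda>y. va (a (i y))) (\<lambda>y. vb (b (k y))) P l r"
    and HA: "pushout_square R H A B (\<lambda>y. a (i y)) (\<lambda>y. b (k y)) HA p q"
    and HA': "pushout_square R H A' B' (\<lambda>y. a' (i y)) (\<lambda>y. b' (k y)) HA' p' q'"
    and TT: "pushout_square R H T T' i k TT j j'"
    and Q: "pushout_square R TT HA HA' m m' Q s s'"
    and m: "m \<in> mod_hom R TT HA" "\<And>t. t \<in> carrier T \<Longrightarrow> m (j t) = p (a t)"
      "\<And>t. t \<in> carrier T' \<Longrightarrow> m (j' t) = q (b t)"
    and m': "m' \<in> mod_hom R TT HA'" "\<And>t. t \<in> carrier T \<Longrightarrow> m' (j t) = p' (a' t)"
      "\<And>t. t \<in> carrier T' \<Longrightarrow> m' (j' t) = q' (b' t)"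
  shows "\<exists>\<phi>\<in>mod_iso R P Q.
    (\<forall>x\<in>carrier A. \<phi> (l (va x)) = s (p x)) \<and> (\<forall>x\<in>carrier A'. \<phi> (l (va' x)) = s' (p' x)) \<and>
    (\<forall>x\<in>carrier B. \<phi> (r (vb x)) = s (q x)) \<and> (\<forall>x\<in>carrier B'. \<phi> (r (vb' x)) = s' (q' x))"
proof -
  note dVA = pushout_squareD[OF VA] and dVB = pushout_squareD[OF VB] and dP = pushout_squareD[OF P]
    and dHA = pushout_squareD[OF HA] and dHA' = pushout_squareD[OF HA'] and dTT = pushout_squareD[OF TT]
    and dQ = pushout_squareD[OF Q]
  note [simp] = dVA(6-9) dVB(6-9) dP(6,7) dHA(6,7) dHA'(6,7) dTT(6-9) dQ(6,7)
  have sj: "s (p (a t)) = s' (p' (a' t))" if "t \<in> carrier T" for t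
    using dQ(10)[of "j t"] m(2) m'(2) that by simp
  have sj': "s (q (b t)) = s' (q' (b' t))" if "t \<in> carrier T'" for t
    using dQ(10)[of "j' t"] m(3) m'(3) that by simp
  obtain uA where uA: "uA \<in> mod_hom R VA Q" "\<And>x. x \<in> carrier A \<Longrightarrow> uA (va x) = compose (carrier A) s p x"
      "\<And>x. x \<in> carrier A' \<Longrightarrow> uA (va' x) = compose (carrier A') s' p' x"
    by (rule pushout_square_lift[OF VA dQ(3) compose_mod_hom[OF dHA(4) dQ(4) dHA(1)]
          compose_mod_hom[OF dHA'(4) dQ(5) dHA'(1)]]) (use sj in auto)
  obtain uB where uB: "uB \<in> mod_hom R VB Q" "\<And>x. x \<in> carrier B \<Longrightarrow> uB (vb x) = compose (carrier B) s q x"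
      "\<And>x. x \<in> carrier B' \<Longrightarrow> uB (vb' x) = compose (carrier B') s' q' x"
    by (rule pushout_square_lift[OF VB dQ(3) compose_mod_hom[OF dHA(5) dQ(4) dHA(2)]
          compose_mod_hom[OF dHA'(5) dQ(5) dHA'(2)]]) (use sj' in auto)
  obtain u where u: "u \<in> mod_hom R P Q" "\<And>x. x \<in> carrier VA \<Longrightarrow> u (l x) = uA x"
      "\<And>x. x \<in> carrier VB \<Longrightarrow> u (r x) = uB x"
    by (rule pushout_square_lift[OF P dQ(3) uA(1) uB(1)]) (use uA uB dHA(10) in auto)
  obtain vA where vA: "vA \<in> mod_hom R HA P" "\<And>x. x \<in> carrier A \<Longrightarrow> vA (p x) = compose (carrier A) l va x"
      "\<And>x. x \<in> carrier B \<Longrightarrow> vA (q x) = compose (carrier B) r vb x"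
    by (rule pushout_square_lift[OF HA dP(3) compose_mod_hom[OF dVA(4) dP(4) dVA(1)]
          compose_mod_hom[OF dVB(4) dP(5) dVB(1)]]) (use dP(10) in auto)
  obtain vA' where vA': "vA' \<in> mod_hom R HA' P" "\<And>x. x \<in> carrier A' \<Longrightarrow> vA' (p' x) = compose (carrier A') l va' x"
      "\<And>x. x \<in> carrier B' \<Longrightarrow> vA' (q' x) = compose (carrier B') r vb' x"
    by (rule pushout_square_lift[OF HA' dP(3) compose_mod_hom[OF dVA(5) dP(4) dVA(2)]
          compose_mod_hom[OF dVB(5) dP(5) dVB(2)]]) (use dP(10) dVA(10) dVB(10) in auto)
  note [simp] = mod_hom_closed[OF m(1)] mod_hom_closed[OF m'(1)]
  have glue: "compose (carrier TT) vA m = compose (carrier TT) vA' m'"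
    by (rule pushout_square_eqI[OF TT dP(3) compose_mod_hom[OF m(1) vA(1) dTT(3)]
          compose_mod_hom[OF m'(1) vA'(1) dTT(3)]])
       (use m m' vA vA' dVA(10) dVB(10) in simp_all)
  obtain v where v: "v \<in> mod_hom R Q P" "\<And>x. x \<in> carrier HA \<Longrightarrow> v (s x) = vA x"
      "\<And>x. x \<in> carrier HA' \<Longrightarrow> v (s' x) = vA' x"
    by (rule pushout_square_lift[OF Q dP(3) vA(1) vA'(1)]) (use glue in \<open>auto simp: compose_eq_iff\<close>)
  have vu: "compose (carrier P) v u \<in> mod_hom R P P" and uv: "compose (carrier Q) u v \<in> mod_hom R Q Q"
    using compose_mod_hom u v dP dQ by blast+
  have "compose (carrier P) v u (l x) = id_hom P (l x)" if "x \<in> carrier VA" for x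
    by (rule pushout_square_comp_eqI[OF VA dP(3,4) vu dP(4) id_hom_mod_hom[OF dP(3)] _ _ that])
       (use u uA v vA vA' in simp_all)
  moreover have "compose (carrier P) v u (r x) = id_hom P (r x)" if "x \<in> carrier VB" for x
    by (rule pushout_square_comp_eqI[OF VB dP(3,5) vu dP(5) id_hom_mod_hom[OF dP(3)] _ _ that])
       (use u uB v vA vA' in simp_all)
  ultimately have "compose (carrier P) v u = id_hom P"
    by (intro pushout_square_id[OF P vu]) simp_all
  then have 1: "v (u x) = x" if "x \<in> carrier P" for x using that by (metis compose_apply id_hom_apply)
  have "compose (carrier Q) u v (s x) = id_hom Q (s x)" if "x \<in> carrier HA" for x
    by (rule pushout_square_comp_eqI[OF HA dQ(3,4) uv dQ(4) id_hom_mod_hom[OF dQ(3)] _ _ that])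
       (use u uA uB v vA in simp_all)
  moreover have "compose (carrier Q) u v (s' x) = id_hom Q (s' x)" if "x \<in> carrier HA'" for x
    by (rule pushout_square_comp_eqI[OF HA' dQ(3,5) uv dQ(5) id_hom_mod_hom[OF dQ(3)] _ _ that])
       (use u uA uB v vA' in simp_all)
  ultimately have "compose (carrier Q) u v = id_hom Q"
    by (intro pushout_square_id[OF Q uv]) simp_all
  then have 2: "u (v x) = x" if "x \<in> carrier Q" for x using that by (metis compose_apply id_hom_apply)
  have "u \<in> mod_iso R P Q" using 1 2 by (intro mod_isoI[OF u(1) v(1)])
  then show ?thesis using u uA uB by (intro bexI[of _ u]) simp_all
qed

section \<open>Vertical composition\<close>

definition cospan_iso ::
    "('a, 'r) ring_scheme \<Rightarrow> ('a, 'u) module \<Rightarrow> ('a, 'u) module \<Rightarrow>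
     ('a, 'u) cospan \<Rightarrow> ('a, 'u) cospan \<Rightarrow> bool" where
  "cospan_iso R M N A A' \<longleftrightarrow> (\<exists>\<phi>\<in>mod_iso R (apex A) (apex A').
     (\<forall>x\<in>carrier M. \<phi> (lleg A x) = lleg A' x) \<and> (\<forall>y\<in>carrier N. \<phi> (rleg A y) = rleg A' y))"

lemma cospan_isoI:
  assumes "\<phi> \<in> mod_iso R (apex A) (apex A')"
    and "\<And>x. x \<in> carrier M \<Longrightarrow> \<phi> (lleg A x) = lleg A' x"
    and "\<And>y. y \<in> carrier N \<Longrightarrow> \<phi> (rleg A y) = rleg A' y"
  shows "cospan_iso R M N A A'"
  using assms unfolding cospan_iso_def by blast

lemma cospan_iso_refl:
  assumes "is_cospan R M N A"
  shows "cospan_iso R M N A A"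
  by (rule cospan_isoI[OF id_hom_mod_iso])
     (use assms in \<open>auto simp: is_cospan_def mod_hom_closed\<close>)

lemma cospan_iso_sym:
  assumes A: "is_cospan R M N A" and A': "is_cospan R M N A'" and iso: "cospan_iso R M N A A'"
  shows "cospan_iso R M N A' A"
proof -
  obtain \<phi> where \<phi>: "\<phi> \<in> mod_iso R (apex A) (apex A')"
    "\<And>x. x \<in> carrier M \<Longrightarrow> \<phi> (lleg A x) = lleg A' x" "\<And>y. y \<in> carrier N \<Longrightarrow> \<phi> (rleg A y) = rleg A' y"
    using iso unfolding cospan_iso_def by blast
  obtain \<psi> where \<psi>: "\<psi> \<in> mod_iso R (apex A') (apex A)" "\<And>a. a \<in> carrier (apex A) \<Longrightarrow> \<psi> (\<phi> a) = a"
    using mod_iso_inverse[OF \<phi>(1)] A A' unfolding is_cospan_def by blast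
  have legs: "lleg A x \<in> carrier (apex A)" "rleg A y \<in> carrier (apex A)"
    if "x \<in> carrier M" "y \<in> carrier N" for x y
    using A that unfolding is_cospan_def by (auto intro: mod_hom_closed)
  have "\<psi> (lleg A' x) = lleg A x" if "x \<in> carrier M" for x
    using A that \<psi>(2)[of "lleg A x"] \<phi>(2)[OF that] mod_hom_closed unfolding is_cospan_def by metis
  moreover have "\<psi> (rleg A' x) = rleg A x" if "x \<in> carrier N" for x
    using A that \<psi>(2)[of "rleg A x"] \<phi>(3)[OF that] mod_hom_closed unfolding is_cospan_def by metis
  ultimately show ?thesis using \<psi>(1) by (intro cospan_isoI)
qed

lemma cospan_iso_trans:
  assumes A: "is_cospan R M N A" and "cospan_iso R M N A A'" and "cospan_iso R M N A' A''"
  shows "cospan_iso R M N A A''"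
proof -
  obtain \<phi> where \<phi>: "\<phi> \<in> mod_iso R (apex A) (apex A')"
    "\<And>x. x \<in> carrier M \<Longrightarrow> \<phi> (lleg A x) = lleg A' x" "\<And>y. y \<in> carrier N \<Longrightarrow> \<phi> (rleg A y) = rleg A' y"
    using assms(2) unfolding cospan_iso_def by blast
  obtain \<psi> where \<psi>: "\<psi> \<in> mod_iso R (apex A') (apex A'')"
    "\<And>x. x \<in> carrier M \<Longrightarrow> \<psi> (lleg A' x) = lleg A'' x" "\<And>y. y \<in> carrier N \<Longrightarrow> \<psi> (rleg A' y) = rleg A'' y"
    using assms(3) unfolding cospan_iso_def by blast
  have "compose (carrier (apex A)) \<psi> \<phi> \<in> mod_iso R (apex A) (apex A'')"
    using A \<phi> \<psi> by (intro compose_mod_iso) (auto simp: is_cospan_def)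
  then show ?thesis
    by (rule cospan_isoI) (use A \<phi> \<psi> in \<open>auto simp: is_cospan_def mod_hom_closed\<close>)
qed

lemma two_cospansD:
  assumes "A \<in> two_cospans R S T"
  shows "src1 S = src1 T" "tgt1 S = tgt1 T" "is_cospan R (mod1 S) (mod1 T) A"
    "module R (mod1 S)" "module R (mod1 T)" "module R (apex A)"
    "lleg A \<in> mod_hom R (mod1 S) (apex A)" "rleg A \<in> mod_hom R (mod1 T) (apex A)"
    "\<And>x. x \<in> carrier (mod1 S) \<Longrightarrow> lleg A x \<in> carrier (apex A)"
    "\<And>x. x \<in> carrier (mod1 T) \<Longrightarrow> rleg A x \<in> carrier (apex A)"
    "\<And>x. x \<in> carrier (umod (src1 T)) \<Longrightarrow> lleg A (lleg (csp S) x) = rleg A (lleg (csp T) x)"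
    "\<And>x. x \<in> carrier (umod (tgt1 T)) \<Longrightarrow> lleg A (rleg (csp S) x) = rleg A (rleg (csp T) x)"
  using assms unfolding two_cospans_def is_cospan_def by (auto simp: compose_eq_iff mod_hom_closed)

lemma two_cospansI:
  assumes "src1 S = src1 T" "tgt1 S = tgt1 T" "is_cospan R (mod1 S) (mod1 T) A"
    "\<And>x. x \<in> carrier (umod (src1 T)) \<Longrightarrow> lleg A (lleg (csp S) x) = rleg A (lleg (csp T) x)"
    "\<And>x. x \<in> carrier (umod (tgt1 T)) \<Longrightarrow> lleg A (rleg (csp S) x) = rleg A (rleg (csp T) x)"
  shows "A \<in> two_cospans R S T"
  using assms unfolding two_cospans_def by (auto simp: compose_eq_iff)

lemma in_iso_class_iff:
  "A' \<in> iso_class R S T A \<longleftrightarrow> A' \<in> two_cospans R S T \<and> cospan_iso R (mod1 S) (mod1 T) A A'"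
proof -
  have "(\<exists>f\<in>mod_iso R (apex A) (apex A'). cospan_map R (mod1 S) (mod1 T) A A' f) \<longleftrightarrow>
      cospan_iso R (mod1 S) (mod1 T) A A'" if "A' \<in> two_cospans R S T"
    using two_cospansD(7,8)[OF that]
    by (auto simp: cospan_iso_def cospan_map_def compose_eq_mod_hom_iff mod_iso_mod_hom)
  then show ?thesis unfolding iso_class_def by blast
qed

lemma iso_class_eqI:
  assumes "A \<in> two_cospans R S T" "A' \<in> two_cospans R S T" "cospan_iso R (mod1 S) (mod1 T) A A'"
  shows "iso_class R S T A = iso_class R S T A'"
  using assms two_cospansD(3) cospan_iso_sym cospan_iso_trans unfolding set_eq_iff in_iso_class_iff
  by meson

lemma two_cospan_class_eqI:
  assumes "A \<in> two_cospans R S T" "A' \<in> two_cospans R S T" "cospan_iso R (mod1 S) (mod1 T) A A'"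
  shows "two_cospan_class R S T A = two_cospan_class R S T A'"
  unfolding two_cospan_class_def by (simp add: iso_class_eqI[OF assms])

lemma two_cospan_class_in: "A \<in> two_cospans R S T \<Longrightarrow> two_cospan_class R S T A \<in> two_cospan_classes R S T"
  unfolding two_cospan_classes_def by (rule imageI)

lemma two_cospan_classesE:
  assumes "\<alpha> \<in> two_cospan_classes R S T"
  obtains A where "A \<in> two_cospans R S T" "\<alpha> = two_cospan_class R S T A"
  using assms unfolding two_cospan_classes_def by (rule imageE) (rule that)

text \<open>
  Composition and coherence of \<open>2\<close>-cospans are treated for arbitrary cospans between the underlying
  modules; Lagrangian cospans enter as a special case.
\<close>

definition cospan_mor ::
    "('a, 'r) ring_scheme \<Rightarrow> ('a, 'u) herm \<Rightarrow> ('a, 'u) herm \<Rightarrow> ('a, 'u) mor1 \<Rightarrow> bool" where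
  "cospan_mor R H H' T \<longleftrightarrow> src1 T = H \<and> tgt1 T = H' \<and> is_cospan R (umod H) (umod H') (csp T)"

lemma cospan_morD:
  assumes "cospan_mor R H H' T"
  shows "src1 T = H" "tgt1 T = H'" "module R (umod H)" "module R (umod H')" "module R (mod1 T)"
    "lleg (csp T) \<in> mod_hom R (umod H) (mod1 T)" "rleg (csp T) \<in> mod_hom R (umod H') (mod1 T)"
    "\<And>x. x \<in> carrier (umod H) \<Longrightarrow> lleg (csp T) x \<in> carrier (mod1 T)"
    "\<And>x. x \<in> carrier (umod H') \<Longrightarrow> rleg (csp T) x \<in> carrier (mod1 T)"
  using assms unfolding cospan_mor_def is_cospan_def by (auto intro: mod_hom_closed)

definition cospan_arrow ::
    "('a, 'r) ring_scheme \<Rightarrow> ('a, 'u) herm \<Rightarrow> ('a, 'u) herm \<Rightarrow> ('a, 'u) mor1 \<Rightarrow> ('a, 'u) mor1 \<Rightarrow>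
     ('u \<Rightarrow> 'u) \<Rightarrow> bool" where
  "cospan_arrow R H H' S T f \<longleftrightarrow> cospan_mor R H H' S \<and> cospan_mor R H H' T \<and>
     f \<in> mod_hom R (mod1 S) (mod1 T) \<and>
     (\<forall>x\<in>carrier (umod H). f (lleg (csp S) x) = lleg (csp T) x) \<and>
     (\<forall>x\<in>carrier (umod H'). f (rleg (csp S) x) = rleg (csp T) x)"

lemma cospan_arrowD:
  assumes "cospan_arrow R H H' S T f"
  shows "cospan_mor R H H' S" "cospan_mor R H H' T" "f \<in> mod_hom R (mod1 S) (mod1 T)"
    "\<And>x. x \<in> carrier (mod1 S) \<Longrightarrow> f x \<in> carrier (mod1 T)"
    "\<And>x. x \<in> carrier (umod H) \<Longrightarrow> f (lleg (csp S) x) = lleg (csp T) x"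
    "\<And>x. x \<in> carrier (umod H') \<Longrightarrow> f (rleg (csp S) x) = rleg (csp T) x"
  using assms unfolding cospan_arrow_def by (auto simp: mod_hom_closed)

lemma cospan_arrow_id: "cospan_mor R H H' T \<Longrightarrow> cospan_arrow R H H' T T (id_hom (mod1 T))"
  using cospan_morD[of R H H' T] unfolding cospan_arrow_def by (auto intro: id_hom_mod_hom)

lemma cospan_arrow_compose:
  assumes "cospan_arrow R H H' S T f" "cospan_arrow R H H' T U g"
  shows "cospan_arrow R H H' S U (compose (carrier (mod1 S)) g f)"
  unfolding cospan_arrow_def
  using cospan_arrowD[OF assms(1)] cospan_arrowD[OF assms(2)]
    cospan_morD[OF cospan_arrowD(1)[OF assms(1)]]
  by (auto intro!: compose_mod_hom)

definition map_cospan :: "('a, 'u) mor1 \<Rightarrow> ('u \<Rightarrow> 'u) \<Rightarrow> ('a, 'u) cospan" where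
  "map_cospan T f = \<lparr>apex = mod1 T, lleg = f, rleg = id_hom (mod1 T)\<rparr>"

lemma map_cospan_simps [simp]:
  "apex (map_cospan T f) = mod1 T" "lleg (map_cospan T f) = f" "rleg (map_cospan T f) = id_hom (mod1 T)"
  by (simp_all add: map_cospan_def)

lemma mor2_of_map_eq: "mor2_of_map R S T f = two_cospan_class R S T (map_cospan T f)"
  by (simp add: mor2_of_map_def map_cospan_def)

lemma map_cospan_in:
  assumes "cospan_arrow R H H' S T f"
  shows "map_cospan T f \<in> two_cospans R S T"
proof -
  note f = cospan_arrowD[OF assms]
  note S = cospan_morD[OF f(1)] and T = cospan_morD[OF f(2)]
  show ?thesis
    by (rule two_cospansI) (use f S T id_hom_mod_hom in \<open>auto simp: is_cospan_def\<close>)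
qed

lemma pushout_square_id_left:
  fixes B :: "('a, 'u) module"
  assumes "module R H" "module R B" and g: "g \<in> mod_hom R H B" and e: "\<And>h. h \<in> carrier H \<Longrightarrow> e h = h"
  shows "pushout_square R H H B e g B g (id_hom B)"
  unfolding pushout_square_def
proof (intro conjI allI impI)
  fix X :: "('a, 'u) module" and x y
  assume "y \<in> mod_hom R B X" "\<forall>h\<in>carrier H. x (e h) = y (g h)"
  then show "\<exists>u\<in>mod_hom R B X. (\<forall>a\<in>carrier H. u (g a) = x a) \<and> (\<forall>b\<in>carrier B. u (id_hom B b) = y b)"
    using e by (intro bexI[of _ y]) auto
next
  fix X :: "('a, 'u) module" and u v
  assume uv: "u \<in> mod_hom R B X" "v \<in> mod_hom R B X"
    and eq: "\<forall>b\<in>carrier B. u (id_hom B b) = v (id_hom B b)"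
  show "u = v" by (rule mod_hom_eqI[OF uv]) (use eq in simp)
qed (use assms in \<open>auto simp: mod_hom_closed intro: id_hom_mod_hom\<close>)

text \<open>
  A map out of \<open>P\<close> is the same as one out of \<open>A\<close>, and on \<open>B\<close> it is then determined, because every
  element of \<open>B\<close> comes from \<open>H\<close>.
\<close>

lemma pushout_square_iso_right:
  fixes A B P :: "('a, 'u) module"
  assumes mods: "module R H" "module R A" "module R B" "module R P"
    and f: "\<And>h. h \<in> carrier H \<Longrightarrow> f h \<in> carrier A" and g: "g \<in> mod_iso R H B"
    and p: "p \<in> mod_iso R A P" and q: "q \<in> mod_hom R B P"
    and pq: "\<And>h. h \<in> carrier H \<Longrightarrow> p (f h) = q (g h)"
  shows "pushout_square R H A B f g P p q"
proof -
  note g' = mod_iso_mod_hom[OF g] and p' = mod_iso_mod_hom[OF p]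
  obtain gi where gi: "gi \<in> mod_iso R B H" "\<And>b. b \<in> carrier B \<Longrightarrow> g (gi b) = b"
    using mod_iso_inverse[OF g mods(1,3)] by blast
  obtain pi where pi: "pi \<in> mod_iso R P A" "\<And>a. a \<in> carrier A \<Longrightarrow> pi (p a) = a"
      "\<And>a. a \<in> carrier P \<Longrightarrow> p (pi a) = a"
    using mod_iso_inverse[OF p mods(2,4)] by blast
  note cl [simp] = mod_hom_closed[OF g'] mod_hom_closed[OF p'] mod_hom_closed[OF mod_iso_mod_hom[OF gi(1)]]
    mod_hom_closed[OF mod_iso_mod_hom[OF pi(1)]] mod_hom_closed[OF q] f
  show ?thesis unfolding pushout_square_def
  proof (intro conjI allI impI)
    fix X :: "('a, 'u) module" and x y
    assume x: "x \<in> mod_hom R A X" and y: "y \<in> mod_hom R B X" and xy: "\<forall>h\<in>carrier H. x (f h) = y (g h)"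
    have "compose (carrier P) x pi (q b) = y b" if b: "b \<in> carrier B" for b
    proof -
      have "q b = p (f (gi b))" using pq[of "gi b"] gi(2) b by simp
      then have "compose (carrier P) x pi (q b) = x (f (gi b))" using pi b by simp
      then show ?thesis using xy gi(2) b by simp
    qed
    then show "\<exists>u\<in>mod_hom R P X. (\<forall>a\<in>carrier A. u (p a) = x a) \<and> (\<forall>b\<in>carrier B. u (q b) = y b)"
      using compose_mod_hom[OF mod_iso_mod_hom[OF pi(1)] x mods(4)] pi
      by (intro bexI[of _ "compose (carrier P) x pi"]) auto
  next
    fix X :: "('a, 'u) module" and u v
    assume uv: "u \<in> mod_hom R P X" "v \<in> mod_hom R P X" and eq: "\<forall>a\<in>carrier A. u (p a) = v (p a)"
    show "u = v"
    proof (rule mod_hom_eqI[OF uv])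
      fix x assume "x \<in> carrier P"
      then show "u x = v x" using bspec[OF eq, of "pi x"] pi(3) by simp
    qed
  qed (use assms p' g' in \<open>auto simp: mod_hom_closed\<close>)
qed

context chosen_pushouts
begin

abbreviation vcomp (infixl "\<star>" 65) where
  "\<beta> \<star> \<alpha> \<equiv> vcomp_mor2 R po \<beta> \<alpha>"

lemma vcomp_square:
  assumes A: "A \<in> two_cospans R S T" and B: "B \<in> two_cospans R T U"
  shows "pushout_square R (mod1 T) (apex A) (apex B) (rleg A) (lleg B)
    (apex (po (inner_span (mod1 T) B A))) (lleg (po (inner_span (mod1 T) B A)))
    (rleg (po (inner_span (mod1 T) B A)))"
  unfolding inner_span_def by (rule chosen_square) (use two_cospansD[OF A] two_cospansD[OF B] in auto)

lemma cospan_comp_simps [simp]: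
  "apex (cospan_comp po X Y Z B A) = apex (po (inner_span Y B A))"
  "x \<in> carrier X \<Longrightarrow> lleg (cospan_comp po X Y Z B A) x = lleg (po (inner_span Y B A)) (lleg A x)"
  "z \<in> carrier Z \<Longrightarrow> rleg (cospan_comp po X Y Z B A) z = rleg (po (inner_span Y B A)) (rleg B z)"
  by (simp_all add: cospan_comp_def Let_def)

lemma two_cospans_glue:
  assumes A: "A \<in> two_cospans R S T" and B: "B \<in> two_cospans R T U"
    and S: "cospan_mor R H H' S" and T: "cospan_mor R H H' T" and U: "cospan_mor R H H' U"
    and P: "pushout_square R (mod1 T) (apex A) (apex B) (rleg A) (lleg B) P p q"
  shows "\<lparr>apex = P, lleg = compose (carrier (mod1 S)) p (lleg A),
      rleg = compose (carrier (mod1 U)) q (rleg B)\<rparr> \<in> two_cospans R S U"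
proof (rule two_cospansI)
  note a = two_cospansD[OF A] and b = two_cospansD[OF B] and d = pushout_squareD[OF P]
    and s = cospan_morD[OF S] and t = cospan_morD[OF T] and u = cospan_morD[OF U]
  show "is_cospan R (mod1 S) (mod1 U) \<lparr>apex = P, lleg = compose (carrier (mod1 S)) p (lleg A),
      rleg = compose (carrier (mod1 U)) q (rleg B)\<rparr>"
    using compose_mod_hom[OF a(7) d(4) a(4)] compose_mod_hom[OF b(8) d(5) b(5)] a b d
    by (simp add: is_cospan_def)
qed (use two_cospansD[OF A] two_cospansD[OF B] pushout_squareD[OF P] cospan_morD[OF S]
      cospan_morD[OF T] cospan_morD[OF U] in \<open>simp_all add: compose_eq\<close>)

lemma vcomp_cospan_in:
  assumes "A \<in> two_cospans R S T" "B \<in> two_cospans R T U"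
    and "cospan_mor R H H' S" "cospan_mor R H H' T" "cospan_mor R H H' U"
  shows "cospan_comp po (mod1 S) (mod1 T) (mod1 U) B A \<in> two_cospans R S U"
  using two_cospans_glue[OF assms vcomp_square[OF assms(1,2)]] by (simp add: cospan_comp_def Let_def)

text \<open>
  Any pushout square over the inner legs computes the composite, and not only the chosen one for
  the given representatives.  This contains that the composite is a single isomorphism class.
\<close>

lemma vcomp_class:
  assumes A: "A \<in> two_cospans R S T" and B: "B \<in> two_cospans R T U"
    and mor: "cospan_mor R H H' S" "cospan_mor R H H' T" "cospan_mor R H H' U"
    and P: "pushout_square R (mod1 T) (apex A) (apex B) (rleg A) (lleg B) (apex C) p q"
    and C: "C \<in> two_cospans R S U"
      "\<And>x. x \<in> carrier (mod1 S) \<Longrightarrow> lleg C x = p (lleg A x)"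
      "\<And>x. x \<in> carrier (mod1 U) \<Longrightarrow> rleg C x = q (rleg B x)"
  shows "two_cospan_class R T U B \<star> two_cospan_class R S T A = two_cospan_class R S U C"
proof -
  have rep: "iso_class R S U (cospan_comp po (mod1 S) (mod1 T) (mod1 U) B' A') = iso_class R S U C"
    if A': "A' \<in> iso_class R S T A" and B': "B' \<in> iso_class R T U B" for A' B'
  proof -
    have in': "A' \<in> two_cospans R S T" "B' \<in> two_cospans R T U" using A' B' by (auto simp: in_iso_class_iff)
    note a = two_cospansD[OF A] and b = two_cospansD[OF B]
      and a' = two_cospansD[OF in'(1)] and b' = two_cospansD[OF in'(2)]
    obtain \<phi> where \<phi>: "\<phi> \<in> mod_iso R (apex A) (apex A')"
      "\<And>x. x \<in> carrier (mod1 S) \<Longrightarrow> \<phi> (lleg A x) = lleg A' x"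
      "\<And>x. x \<in> carrier (mod1 T) \<Longrightarrow> \<phi> (rleg A x) = rleg A' x"
      using A' unfolding in_iso_class_iff cospan_iso_def by blast
    obtain \<psi> where \<psi>: "\<psi> \<in> mod_iso R (apex B) (apex B')"
      "\<And>x. x \<in> carrier (mod1 T) \<Longrightarrow> \<psi> (lleg B x) = lleg B' x"
      "\<And>x. x \<in> carrier (mod1 U) \<Longrightarrow> \<psi> (rleg B x) = rleg B' x"
      using B' unfolding in_iso_class_iff cospan_iso_def by blast
    note P' = pushout_square_transport[OF vcomp_square[OF in'] a(6) b(6) \<phi>(1) \<psi>(1) a(10) \<phi>(3) b(9) \<psi>(2)]
    obtain \<chi> where \<chi>: "\<chi> \<in> mod_iso R (apex C) (apex (po (inner_span (mod1 T) B' A')))"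
      "\<And>x. x \<in> carrier (apex A) \<Longrightarrow> \<chi> (p x) = lleg (po (inner_span (mod1 T) B' A')) (\<phi> x)"
      "\<And>x. x \<in> carrier (apex B) \<Longrightarrow> \<chi> (q x) = rleg (po (inner_span (mod1 T) B' A')) (\<psi> x)"
      using pushout_square_unique[OF P P'] by auto
    have "cospan_iso R (mod1 S) (mod1 U) C (cospan_comp po (mod1 S) (mod1 T) (mod1 U) B' A')"
      by (rule cospan_isoI[of \<chi>]) (use \<chi> \<phi> \<psi> C a b in simp_all)
    then show ?thesis using iso_class_eqI[OF C(1) vcomp_cospan_in[OF in' mor]] by simp
  qed
  have "A \<in> iso_class R S T A" "B \<in> iso_class R T U B"
    using A B cospan_iso_refl[OF two_cospansD(3)[OF A]] cospan_iso_refl[OF two_cospansD(3)[OF B]]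
    by (simp_all add: in_iso_class_iff)
  then have "(\<Union>A'\<in>iso_class R S T A. \<Union>B'\<in>iso_class R T U B.
      iso_class R S U (cospan_comp po (mod1 S) (mod1 T) (mod1 U) B' A')) = iso_class R S U C"
    using rep by auto
  then show ?thesis by (simp add: vcomp_mor2_def two_cospan_class_def)
qed

lemma vcomp_class_chosen:
  assumes "A \<in> two_cospans R S T" "B \<in> two_cospans R T U"
    and "cospan_mor R H H' S" "cospan_mor R H H' T" "cospan_mor R H H' U"
  shows "two_cospan_class R T U B \<star> two_cospan_class R S T A =
    two_cospan_class R S U (cospan_comp po (mod1 S) (mod1 T) (mod1 U) B A)"
  by (rule vcomp_class[OF assms(1-5)]) (use vcomp_square[OF assms(1,2)] vcomp_cospan_in[OF assms] in simp_all)

lemma vcomp_cell: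
  assumes "\<alpha> \<in> two_cospan_classes R S T" "\<beta> \<in> two_cospan_classes R T U"
    and "cospan_mor R H H' S" "cospan_mor R H H' T" "cospan_mor R H H' U"
  shows "(\<beta> \<star> \<alpha>) \<in> two_cospan_classes R S U"
proof -
  obtain A where A: "A \<in> two_cospans R S T" "\<alpha> = two_cospan_class R S T A"
    using assms(1) by (rule two_cospan_classesE)
  obtain B where B: "B \<in> two_cospans R T U" "\<beta> = two_cospan_class R T U B"
    using assms(2) by (rule two_cospan_classesE)
  show ?thesis unfolding A(2) B(2) vcomp_class_chosen[OF A(1) B(1) assms(3-5)]
    by (intro two_cospan_class_in vcomp_cospan_in[OF A(1) B(1) assms(3-5)])
qed

lemma vcomp_assoc:
  assumes "\<alpha> \<in> two_cospan_classes R S T" "\<beta> \<in> two_cospan_classes R T U" "\<gamma> \<in> two_cospan_classes R U V"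
    and mor: "cospan_mor R H H' S" "cospan_mor R H H' T" "cospan_mor R H H' U" "cospan_mor R H H' V"
  shows "(\<gamma> \<star> \<beta>) \<star> \<alpha> = \<gamma> \<star> (\<beta> \<star> \<alpha>)"
proof -
  obtain A where A: "A \<in> two_cospans R S T" "\<alpha> = two_cospan_class R S T A"
    using assms(1) by (rule two_cospan_classesE)
  obtain B where B: "B \<in> two_cospans R T U" "\<beta> = two_cospan_class R T U B"
    using assms(2) by (rule two_cospan_classesE)
  obtain C where C: "C \<in> two_cospans R U V" "\<gamma> = two_cospan_class R U V C"
    using assms(3) by (rule two_cospan_classesE)
  let ?BA = "cospan_comp po (mod1 S) (mod1 T) (mod1 U) B A"
  let ?CB = "cospan_comp po (mod1 T) (mod1 U) (mod1 V) C B"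
  let ?Q = "cospan_comp po (mod1 S) (mod1 U) (mod1 V) C ?BA"
  let ?Q' = "cospan_comp po (mod1 S) (mod1 T) (mod1 V) ?CB A"
  let ?pCB = "po (inner_span (mod1 U) C B)"
    and ?pBA = "po (inner_span (mod1 T) B A)"
    and ?pQ' = "po (inner_span (mod1 T) ?CB A)"
    and ?pQ = "po (inner_span (mod1 U) C ?BA)"
  have BA: "?BA \<in> two_cospans R S U" and CB: "?CB \<in> two_cospans R T V"
    using A B C mor by (blast intro: vcomp_cospan_in)+
  have Q: "?Q \<in> two_cospans R S V" and Q': "?Q' \<in> two_cospans R S V"
    using A BA CB C mor by (blast intro: vcomp_cospan_in)+
  note a = two_cospansD[OF A(1)] and b = two_cospansD[OF B(1)] and c = two_cospansD[OF C(1)]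
  note sBA = vcomp_square[OF A(1) B(1)] and sCB = vcomp_square[OF B(1) C(1)]
  have sQ: "pushout_square R (mod1 U) (apex ?BA) (apex C)
      (\<lambda>y. rleg ?pBA (rleg B y)) (lleg C) (apex ?Q)
      (lleg ?pQ) (rleg ?pQ)"
    using vcomp_square[OF BA C(1)] by (auto elim: pushout_square_cong)
  have sQ': "pushout_square R (mod1 T) (apex A) (apex ?CB) (rleg A)
      (\<lambda>y. lleg ?pCB (lleg B y)) (apex ?Q')
      (lleg ?pQ') (rleg ?pQ')"
    using vcomp_square[OF A(1) CB] by (auto elim: pushout_square_cong)
  obtain \<phi> where \<phi>: "\<phi> \<in> mod_iso R (apex ?Q') (apex ?Q)"
    "\<And>x. x \<in> carrier (apex A) \<Longrightarrow> \<phi> (lleg ?pQ' x) =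
      lleg ?pQ (lleg ?pBA x)"
    "\<And>x. x \<in> carrier (apex C) \<Longrightarrow> \<phi> (rleg ?pQ'
      (rleg ?pCB x)) = rleg ?pQ x"
    using pushout_square_assoc[OF sBA sQ[unfolded cospan_comp_simps(1)] sCB sQ'[unfolded cospan_comp_simps(1)]]
    unfolding cospan_comp_simps(1) by blast
  have "cospan_iso R (mod1 S) (mod1 V) ?Q' ?Q"
    by (rule cospan_isoI[OF \<phi>(1)]) (use \<phi> a b c in simp_all)
  then have "two_cospan_class R S V ?Q' = two_cospan_class R S V ?Q" by (rule two_cospan_class_eqI[OF Q' Q])
  then show ?thesis
    unfolding A(2) B(2) C(2) vcomp_class_chosen[OF A(1) B(1) mor(1-3)] vcomp_class_chosen[OF B(1) C(1) mor(2-4)]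
      vcomp_class_chosen[OF A(1) CB mor(1,2,4)] vcomp_class_chosen[OF BA C(1) mor(1,3,4)] .
qed

text \<open>
  All naturality axioms have this form.  Composition with the map \<open>f\<close> on the right precomposes
  the left leg with \<open>f\<close>, and composition with the isomorphism \<open>g\<close> on the left can be computed with
  the pushout square whose parallel sides are \<open>g\<close> and \<open>\<phi>\<close>; both sides are then represented by
  the apex of \<open>A'\<close> with legs \<open>lleg A' \<circ> f\<close> and \<open>rleg A'\<close>.
\<close>

lemma vcomp_natural:
  assumes f: "cospan_arrow R H H' S S' f" and g: "cospan_arrow R H H' T T' g"
    and g_iso: "g \<in> mod_iso R (mod1 T) (mod1 T')"
    and A: "A \<in> two_cospans R S T" and A': "A' \<in> two_cospans R S' T'"
    and \<phi>: "\<phi> \<in> mod_iso R (apex A) (apex A')"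
      "\<And>x. x \<in> carrier (mod1 S) \<Longrightarrow> \<phi> (lleg A x) = lleg A' (f x)"
      "\<And>x. x \<in> carrier (mod1 T) \<Longrightarrow> \<phi> (rleg A x) = rleg A' (g x)"
  shows "mor2_of_map R T T' g \<star> two_cospan_class R S T A =
    two_cospan_class R S' T' A' \<star> mor2_of_map R S S' f"
proof -
  note fd = cospan_arrowD[OF f] and gd = cospan_arrowD[OF g]
    and a = two_cospansD[OF A] and a' = two_cospansD[OF A']
  let ?C = "\<lparr>apex = apex A', lleg = compose (carrier (mod1 S)) (lleg A') f, rleg = rleg A'\<rparr>"
  have C: "?C \<in> two_cospans R S T'"
    by (rule two_cospansI)
       (use fd gd a a' cospan_morD[OF fd(1)] cospan_morD[OF fd(2)] cospan_morD[OF gd(2)] in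
         \<open>auto simp: is_cospan_def intro: compose_mod_hom\<close>)
  have 1: "pushout_square R (mod1 T) (apex A) (mod1 T') (rleg A) g (apex A') \<phi> (rleg A')"
    by (rule pushout_square_iso_right) (use a a' g_iso \<phi> in auto)
  have "mor2_of_map R T T' g \<star> two_cospan_class R S T A = two_cospan_class R S T' ?C"
    unfolding mor2_of_map_eq
    by (rule vcomp_class[OF A map_cospan_in[OF g] fd(1) gd(1,2) _ C, of \<phi> "rleg A'"])
       (use 1 \<phi> in auto)
  moreover have 2: "pushout_square R (mod1 S') (mod1 S') (apex A') (id_hom (mod1 S')) (lleg A')
      (apex A') (lleg A') (id_hom (apex A'))"
    by (rule pushout_square_id_left) (use a' in auto)
  have "two_cospan_class R S' T' A' \<star> mor2_of_map R S S' f = two_cospan_class R S T' ?C"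
    unfolding mor2_of_map_eq
    by (rule vcomp_class[OF map_cospan_in[OF f] A' fd(1,2) gd(2) _ C, of "lleg A'" "id_hom (apex A')"])
       (use 2 a' in auto)
  ultimately show ?thesis by simp
qed

lemma vcomp_id_right:
  assumes "\<alpha> \<in> two_cospan_classes R S T" and mor: "cospan_mor R H H' S" "cospan_mor R H H' T"
  shows "\<alpha> \<star> id_mor2 R S = \<alpha>"
proof -
  obtain A where A: "A \<in> two_cospans R S T" "\<alpha> = two_cospan_class R S T A"
    using assms(1) by (rule two_cospan_classesE)
  note a = two_cospansD[OF A(1)]
  have "pushout_square R (mod1 S) (mod1 S) (apex A) (id_hom (mod1 S)) (lleg A)
      (apex A) (lleg A) (id_hom (apex A))"
    by (rule pushout_square_id_left) (use a in auto)
  then show ?thesis unfolding A(2) id_mor2_def mor2_of_map_eq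
    by (intro vcomp_class[OF map_cospan_in[OF cospan_arrow_id[OF mor(1)]] A(1) mor(1) mor _ A(1),
        of "lleg A" "id_hom (apex A)"]) (use a in auto)
qed

lemma vcomp_id_left:
  assumes "\<alpha> \<in> two_cospan_classes R S T" and mor: "cospan_mor R H H' S" "cospan_mor R H H' T"
  shows "id_mor2 R T \<star> \<alpha> = \<alpha>"
proof -
  obtain A where A: "A \<in> two_cospans R S T" "\<alpha> = two_cospan_class R S T A"
    using assms(1) by (rule two_cospan_classesE)
  note a = two_cospansD[OF A(1)]
  have "pushout_square R (mod1 T) (apex A) (mod1 T) (rleg A) (id_hom (mod1 T))
      (apex A) (id_hom (apex A)) (rleg A)"
    by (rule pushout_square_iso_right) (use a id_hom_mod_iso in auto)
  then show ?thesis unfolding A(2) id_mor2_def mor2_of_map_eq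
    by (intro vcomp_class[OF A(1) map_cospan_in[OF cospan_arrow_id[OF mor(2)]] mor mor(2) _ A(1),
        of "id_hom (apex A)" "rleg A"]) (use a in auto)
qed

lemma id_mor2_cell: "cospan_mor R H H' T \<Longrightarrow> id_mor2 R T \<in> two_cospan_classes R T T"
  unfolding id_mor2_def mor2_of_map_eq by (intro two_cospan_class_in map_cospan_in cospan_arrow_id)

lemma vcomp_map:
  assumes f: "cospan_arrow R H H' S T f" and g: "cospan_arrow R H H' T U g"
  shows "mor2_of_map R T U g \<star> mor2_of_map R S T f =
    mor2_of_map R S U (compose (carrier (mod1 S)) g f)"
proof -
  note fd = cospan_arrowD[OF f] and gd = cospan_arrowD[OF g]
  note s = cospan_morD[OF fd(1)] and t = cospan_morD[OF gd(1)] and u = cospan_morD[OF gd(2)]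
  have "pushout_square R (mod1 T) (mod1 T) (mod1 U) (id_hom (mod1 T)) g (mod1 U) g (id_hom (mod1 U))"
    by (rule pushout_square_id_left) (use s t u gd in auto)
  then show ?thesis unfolding mor2_of_map_eq
    by (intro vcomp_class[OF map_cospan_in[OF f] map_cospan_in[OF g] fd(1) gd(1,2)
          _ map_cospan_in[OF cospan_arrow_compose[OF f g]], of g "id_hom (mod1 U)"]) auto
qed

lemma iso_arrow_map:
  assumes f: "cospan_arrow R H H' S T f" and iso: "f \<in> mod_iso R (mod1 S) (mod1 T)"
  shows "iso_arrow (two_cospan_classes R) (id_mor2 R) (vcomp_mor2 R po) S T (mor2_of_map R S T f)"
proof -
  note fd = cospan_arrowD[OF f]
  note s = cospan_morD[OF fd(1)] and t = cospan_morD[OF fd(2)]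
  obtain g where g: "g \<in> mod_iso R (mod1 T) (mod1 S)" "\<And>x. x \<in> carrier (mod1 S) \<Longrightarrow> g (f x) = x"
      "\<And>x. x \<in> carrier (mod1 T) \<Longrightarrow> f (g x) = x"
    using mod_iso_inverse[OF iso] s t by blast
  note ghom = mod_iso_mod_hom[OF g(1)]
  have "g (lleg (csp T) x) = lleg (csp S) x" if "x \<in> carrier (umod H)" for x
    using fd(5)[OF that] g(2) s(8)[OF that] by metis
  moreover have "g (rleg (csp T) x) = rleg (csp S) x" if "x \<in> carrier (umod H')" for x
    using fd(6)[OF that] g(2) s(9)[OF that] by metis
  ultimately have g_arrow: "cospan_arrow R H H' T S g" using fd ghom unfolding cospan_arrow_def by simp
  have "compose (carrier (mod1 S)) g f = id_hom (mod1 S)" "compose (carrier (mod1 T)) f g = id_hom (mod1 T)"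
    using g by (auto simp: compose_def id_hom_def intro!: restrict_ext)
  then show ?thesis
    unfolding iso_arrow_def using vcomp_map[OF f g_arrow] vcomp_map[OF g_arrow f]
      map_cospan_in[OF f] map_cospan_in[OF g_arrow]
    by (auto simp: id_mor2_def mor2_of_map_eq intro!: two_cospan_class_in bexI[of _ "mor2_of_map R T S g"])
qed

end

section \<open>Horizontal composition\<close>

lemma cospan_mor_id:
  assumes "module R (umod H)"
  shows "cospan_mor R H H (id_mor1 H)"
  using assms by (simp add: cospan_mor_def id_mor1_def is_cospan_def id_hom_mod_hom)

lemma id_mor1_simps [simp]:
  "src1 (id_mor1 H) = H" "tgt1 (id_mor1 H) = H" "mod1 (id_mor1 H) = umod H"
  "lleg (csp (id_mor1 H)) = id_hom (umod H)" "rleg (csp (id_mor1 H)) = id_hom (umod H)"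
  by (simp_all add: id_mor1_def)

context chosen_pushouts
begin

abbreviation comp1 (infixl "\<cdot>" 75) where
  "T \<cdot> S \<equiv> comp_mor1 po T S"

abbreviation hcomp (infixl "\<bullet>" 70) where
  "\<beta> \<bullet> \<alpha> \<equiv> hcomp_mor2 R po \<beta> \<alpha>"

text \<open>
  The pushout maps \<open>S \<rightarrow> T \<cdot> S \<leftarrow> T\<close>.
\<close>

abbreviation jl :: "('a, 'u) mor1 \<Rightarrow> ('a, 'u) mor1 \<Rightarrow> 'u \<Rightarrow> 'u" where
  "jl T S \<equiv> lleg (po (mor1_span T S))"

abbreviation jr :: "('a, 'u) mor1 \<Rightarrow> ('a, 'u) mor1 \<Rightarrow> 'u \<Rightarrow> 'u" where
  "jr T S \<equiv> rleg (po (mor1_span T S))"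

lemma comp_mor1_simps [simp]:
  "src1 (T \<cdot> S) = src1 S" "tgt1 (T \<cdot> S) = tgt1 T"
  by (simp_all add: comp_mor1_def)

lemma mod1_comp_mor1: "mod1 (T \<cdot> S) = apex (po (mor1_span T S))"
  by (simp add: comp_mor1_def mor1_span_def)

lemma comp_mor1_legs:
  "x \<in> carrier (umod (src1 S)) \<Longrightarrow> lleg (csp (T \<cdot> S)) x = jl T S (lleg (csp S) x)"
  "z \<in> carrier (umod (tgt1 T)) \<Longrightarrow> rleg (csp (T \<cdot> S)) z = jr T S (rleg (csp T) z)"
  by (simp_all add: comp_mor1_def mor1_span_def)

lemma comp_square:
  assumes S: "cospan_mor R H H' S" and T: "cospan_mor R H' H'' T"
  shows "pushout_square R (umod H') (mod1 S) (mod1 T) (rleg (csp S)) (lleg (csp T))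
    (mod1 (T \<cdot> S)) (jl T S) (jr T S)"
  unfolding mod1_comp_mor1 mor1_span_def inner_span_def cospan_morD(2)[OF S]
  by (rule chosen_square) (use cospan_morD[OF S] cospan_morD[OF T] in auto)

lemma comp_cospan_mor:
  assumes S: "cospan_mor R H H' S" and T: "cospan_mor R H' H'' T"
  shows "cospan_mor R H H'' (T \<cdot> S)"
proof -
  note s = cospan_morD[OF S] and t = cospan_morD[OF T] and d = pushout_squareD[OF comp_square[OF S T]]
  have "lleg (csp (T \<cdot> S)) = compose (carrier (umod H)) (jl T S) (lleg (csp S))"
    "rleg (csp (T \<cdot> S)) = compose (carrier (umod H'')) (jr T S) (rleg (csp T))"
    using s t by (simp_all add: comp_mor1_def cospan_comp_def mor1_span_def Let_def)
  then show ?thesis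
    unfolding cospan_mor_def is_cospan_def using s t d by (auto intro: compose_mod_hom)
qed

lemma comp_induced:
  assumes S: "cospan_mor R H H' S" and T: "cospan_mor R H' H'' T"
    and X: "module R X" "x \<in> mod_hom R (mod1 S) X" "y \<in> mod_hom R (mod1 T) X"
      "\<And>h. h \<in> carrier (umod H') \<Longrightarrow> x (rleg (csp S) h) = y (lleg (csp T) h)"
  defines "u \<equiv> induced_map R po (mor1_span T S) \<lparr>apex = X, lleg = x, rleg = y\<rparr>"
  shows "u \<in> mod_hom R (mod1 (T \<cdot> S)) X"
    "\<And>a. a \<in> carrier (mod1 S) \<Longrightarrow> u (jl T S a) = x a"
    "\<And>b. b \<in> carrier (mod1 T) \<Longrightarrow> u (jr T S b) = y b"
proof -
  note s = cospan_morD[OF S] and t = cospan_morD[OF T]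
  show "u \<in> mod_hom R (mod1 (T \<cdot> S)) X"
    "\<And>a. a \<in> carrier (mod1 S) \<Longrightarrow> u (jl T S a) = x a"
    "\<And>b. b \<in> carrier (mod1 T) \<Longrightarrow> u (jr T S b) = y b"
    unfolding u_def mod1_comp_mor1 mor1_span_def inner_span_def s(2)
    by (rule induced_map_props[OF s(4) s(5) t(5) s(7) t(6) X]; assumption)+
qed

text \<open>
  A threefold composite is generated by its three factors.
\<close>

lemma comp3_eqI:
  fixes X :: "('a, 'u) module"
  assumes S: "cospan_mor R a b S" and T: "cospan_mor R b c T" and U: "cospan_mor R c d U"
    and X: "module R X"
    and u: "u \<in> mod_hom R (mod1 ((U \<cdot> T) \<cdot> S)) X"
    and v: "v \<in> mod_hom R (mod1 ((U \<cdot> T) \<cdot> S)) X"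
    and gen: "\<And>x. x \<in> carrier (mod1 S) \<Longrightarrow>
        u (jl (U \<cdot> T) S x) = v (jl (U \<cdot> T) S x)"
      "\<And>y. y \<in> carrier (mod1 T) \<Longrightarrow>
        u (jr (U \<cdot> T) S (jl U T y)) = v (jr (U \<cdot> T) S (jl U T y))"
      "\<And>z. z \<in> carrier (mod1 U) \<Longrightarrow>
        u (jr (U \<cdot> T) S (jr U T z)) = v (jr (U \<cdot> T) S (jr U T z))"
  shows "u = v"
proof (rule pushout_square_eqI[OF comp_square[OF S comp_cospan_mor[OF T U]] X u v gen(1)])
  note d = pushout_squareD[OF comp_square[OF S comp_cospan_mor[OF T U]]]
  fix w assume w: "w \<in> carrier (mod1 (U \<cdot> T))"
  show "u (jr (U \<cdot> T) S w) = v (jr (U \<cdot> T) S w)"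
    by (rule pushout_square_comp_eqI[OF comp_square[OF T U] X d(5) u d(5) v _ _ w])
       (use gen in simp_all)
qed

text \<open>
  The isomorphism supplied by \<open>pushout_square_assoc\<close> has the same values on the three factors as the
  canonical map, hence equals it.
\<close>

lemma assoc_map_props:
  assumes S: "cospan_mor R a b S" and T: "cospan_mor R b c T" and U: "cospan_mor R c d U"
  shows "cospan_arrow R a d ((U \<cdot> T) \<cdot> S) (U \<cdot> (T \<cdot> S))
      (assoc_map R po U T S)"
    and "assoc_map R po U T S \<in> mod_iso R (mod1 ((U \<cdot> T) \<cdot> S))
      (mod1 (U \<cdot> (T \<cdot> S)))"
    and "\<And>x. x \<in> carrier (mod1 S) \<Longrightarrow> assoc_map R po U T S (jl (U \<cdot> T) S x) =
      jl U (T \<cdot> S) (jl T S x)"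
    and "\<And>y. y \<in> carrier (mod1 T) \<Longrightarrow> assoc_map R po U T S (jr (U \<cdot> T) S (jl U T y)) =
      jl U (T \<cdot> S) (jr T S y)"
    and "\<And>z. z \<in> carrier (mod1 U) \<Longrightarrow> assoc_map R po U T S (jr (U \<cdot> T) S (jr U T z)) =
      jr U (T \<cdot> S) z"
proof -
  let ?TS = "T \<cdot> S" and ?UT = "U \<cdot> T"
  note TS = comp_cospan_mor[OF S T] and UT = comp_cospan_mor[OF T U]
  note L = comp_cospan_mor[OF S UT] and K = comp_cospan_mor[OF TS U]
  note sqTS = comp_square[OF S T] and sqUT = comp_square[OF T U]
    and sqL = comp_square[OF S UT] and sqK = comp_square[OF TS U]
  note s = cospan_morD[OF S] and t = cospan_morD[OF T] and u = cospan_morD[OF U]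
    and ts = pushout_squareD[OF sqTS] and ut = pushout_squareD[OF sqUT]
    and l = pushout_squareD[OF sqL] and k = pushout_squareD[OF sqK]
  define v where "v = induced_map R po (mor1_span U T)
    \<lparr>apex = mod1 (U \<cdot> ?TS), lleg = compose (carrier (mod1 T)) (jl U ?TS) (jr T S), rleg = jr U ?TS\<rparr>"
  have v: "v \<in> mod_hom R (mod1 ?UT) (mod1 (U \<cdot> ?TS))"
    "\<And>y. y \<in> carrier (mod1 T) \<Longrightarrow> v (jl U T y) = jl U ?TS (jr T S y)"
    "\<And>z. z \<in> carrier (mod1 U) \<Longrightarrow> v (jr U T z) = jr U ?TS z"
  proof -
    have glue: "compose (carrier (mod1 T)) (jl U ?TS) (jr T S) (rleg (csp T) h) = jr U ?TS (lleg (csp U) h)"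
      if "h \<in> carrier (umod c)" for h
      using k(10)[OF that] that t by (simp add: comp_mor1_legs)
    note P = comp_induced[OF T U k(3) compose_mod_hom[OF ts(5) k(4) t(5)] k(5) glue, folded v_def]
    show "v \<in> mod_hom R (mod1 ?UT) (mod1 (U \<cdot> ?TS))"
      "\<And>y. y \<in> carrier (mod1 T) \<Longrightarrow> v (jl U T y) = jl U ?TS (jr T S y)"
      "\<And>z. z \<in> carrier (mod1 U) \<Longrightarrow> v (jr U T z) = jr U ?TS z"
      using P by simp_all
  qed
  have eq: "assoc_map R po U T S = induced_map R po (mor1_span ?UT S)
     \<lparr>apex = mod1 (U \<cdot> ?TS), lleg = compose (carrier (mod1 S)) (jl U ?TS) (jl T S), rleg = v\<rparr>"
    by (simp add: assoc_map_def v_def Let_def mod1_comp_mor1)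
  have glue: "compose (carrier (mod1 S)) (jl U ?TS) (jl T S) (rleg (csp S) h) = v (lleg (csp ?UT) h)"
    if "h \<in> carrier (umod b)" for h
    using that s t ts(10)[OF that] v by (simp add: comp_mor1_legs)
  note P = comp_induced[OF S UT k(3) compose_mod_hom[OF ts(4) k(4) s(5)] v(1) glue, folded eq]
  show 1: "assoc_map R po U T S (jl ?UT S x) = jl U ?TS (jl T S x)" if "x \<in> carrier (mod1 S)" for x
    using P(2) that by simp
  show 2: "assoc_map R po U T S (jr ?UT S (jl U T y)) = jl U ?TS (jr T S y)" if "y \<in> carrier (mod1 T)" for y
    using P(3) v(2) ut that by simp
  show 3: "assoc_map R po U T S (jr ?UT S (jr U T z)) = jr U ?TS z" if "z \<in> carrier (mod1 U)" for z
    using P(3) v(3) ut that by simp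
  show "cospan_arrow R a d (?UT \<cdot> S) (U \<cdot> ?TS) (assoc_map R po U T S)"
    unfolding cospan_arrow_def using L K P(1) s t u 1 3 by (simp add: comp_mor1_legs)
  have sqK': "pushout_square R (umod c) (mod1 ?TS) (mod1 U) (\<lambda>y. jr T S (rleg (csp T) y)) (lleg (csp U))
      (mod1 (U \<cdot> ?TS)) (jl U ?TS) (jr U ?TS)"
    using sqK t by (auto elim!: pushout_square_cong simp: comp_mor1_legs)
  have sqL': "pushout_square R (umod b) (mod1 S) (mod1 ?UT) (rleg (csp S)) (\<lambda>y. jl U T (lleg (csp T) y))
      (mod1 (?UT \<cdot> S)) (jl ?UT S) (jr ?UT S)"
    using sqL t by (auto elim!: pushout_square_cong simp: comp_mor1_legs)
  obtain \<phi> where \<phi>: "\<phi> \<in> mod_iso R (mod1 (?UT \<cdot> S)) (mod1 (U \<cdot> ?TS))"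
    "\<And>x. x \<in> carrier (mod1 S) \<Longrightarrow> \<phi> (jl ?UT S x) = jl U ?TS (jl T S x)"
    "\<And>y. y \<in> carrier (mod1 T) \<Longrightarrow> \<phi> (jr ?UT S (jl U T y)) = jl U ?TS (jr T S y)"
    "\<And>z. z \<in> carrier (mod1 U) \<Longrightarrow> \<phi> (jr ?UT S (jr U T z)) = jr U ?TS z"
    using pushout_square_assoc[OF sqTS sqK' sqUT sqL'] by blast
  have "assoc_map R po U T S = \<phi>"
    by (rule comp3_eqI[OF S T U k(3) P(1) mod_iso_mod_hom[OF \<phi>(1)]]) (use 1 2 3 \<phi> in simp_all)
  then show "assoc_map R po U T S \<in> mod_iso R (mod1 (?UT \<cdot> S)) (mod1 (U \<cdot> ?TS))"
    using \<phi>(1) by simp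
qed

definition lunit_map :: "('a, 'u) mor1 \<Rightarrow> 'u \<Rightarrow> 'u" where
  "lunit_map T = induced_map R po (mor1_span (id_mor1 (tgt1 T)) T)
       \<lparr>apex = mod1 T, lleg = id_hom (mod1 T), rleg = rleg (csp T)\<rparr>"

definition runit_map :: "('a, 'u) mor1 \<Rightarrow> 'u \<Rightarrow> 'u" where
  "runit_map T = induced_map R po (mor1_span T (id_mor1 (src1 T)))
       \<lparr>apex = mod1 T, lleg = lleg (csp T), rleg = id_hom (mod1 T)\<rparr>"

text \<open>
  Gluing along an identity changes nothing: \<open>T\<close> itself is a pushout of the span that defines
  \<open>I \<cdot> T\<close>.
\<close>

lemma lunit_map_props:
  assumes T: "cospan_mor R H H' T"
  shows "cospan_arrow R H H' (id_mor1 H' \<cdot> T) T (lunit_map T)"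
    and "lunit_map T \<in> mod_iso R (mod1 (id_mor1 H' \<cdot> T)) (mod1 T)"
    and "\<And>x. x \<in> carrier (mod1 T) \<Longrightarrow> lunit_map T (jl (id_mor1 H') T x) = x"
    and "\<And>y. y \<in> carrier (umod H') \<Longrightarrow> lunit_map T (jr (id_mor1 H') T y) = rleg (csp T) y"
proof -
  note t = cospan_morD[OF T]
  note I = cospan_mor_id[OF t(4)]
  note sq = comp_square[OF T I] and IT = comp_cospan_mor[OF T I]
  note d = pushout_squareD[OF sq]
  have glue: "id_hom (mod1 T) (rleg (csp T) h) = rleg (csp T) (lleg (csp (id_mor1 H')) h)"
    if "h \<in> carrier (umod H')" for h using that t by simp
  have r: "rleg (csp T) \<in> mod_hom R (mod1 (id_mor1 H')) (mod1 T)" using t by simp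
  have eq: "lunit_map T = induced_map R po (mor1_span (id_mor1 H') T)
       \<lparr>apex = mod1 T, lleg = id_hom (mod1 T), rleg = rleg (csp T)\<rparr>"
    using t by (simp add: lunit_map_def)
  note P = comp_induced[OF T I t(5) id_hom_mod_hom[OF t(5)] r glue, folded eq]
  show 1: "lunit_map T (jl (id_mor1 H') T x) = x" if "x \<in> carrier (mod1 T)" for x
    using P(2) that by simp
  show 2: "lunit_map T (jr (id_mor1 H') T y) = rleg (csp T) y" if "y \<in> carrier (umod H')" for y
    using P(3) that by simp
  show "cospan_arrow R H H' (id_mor1 H' \<cdot> T) T (lunit_map T)"
    unfolding cospan_arrow_def using T IT P(1) t 1 2 by (simp add: comp_mor1_legs)
  have "pushout_square R (umod H') (mod1 T) (mod1 (id_mor1 H')) (rleg (csp T)) (lleg (csp (id_mor1 H')))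
      (mod1 T) (id_hom (mod1 T)) (rleg (csp T))"
    using t by (intro pushout_square_iso_right) (auto intro: id_hom_mod_iso)
  from pushout_square_unique[OF sq this] obtain \<phi> where \<phi>:
    "\<phi> \<in> mod_iso R (mod1 (id_mor1 H' \<cdot> T)) (mod1 T)"
    "\<And>x. x \<in> carrier (mod1 T) \<Longrightarrow> \<phi> (jl (id_mor1 H') T x) = x"
    "\<And>y. y \<in> carrier (umod H') \<Longrightarrow> \<phi> (jr (id_mor1 H') T y) = rleg (csp T) y" by auto
  have "lunit_map T = \<phi>"
    by (rule pushout_square_eqI[OF sq t(5) P(1) mod_iso_mod_hom[OF \<phi>(1)]]) (use 1 2 \<phi> in simp_all)
  then show "lunit_map T \<in> mod_iso R (mod1 (id_mor1 H' \<cdot> T)) (mod1 T)" using \<phi>(1) by simp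
qed

lemma runit_map_props:
  assumes T: "cospan_mor R H H' T"
  shows "cospan_arrow R H H' (T \<cdot> id_mor1 H) T (runit_map T)"
    and "runit_map T \<in> mod_iso R (mod1 (T \<cdot> id_mor1 H)) (mod1 T)"
    and "\<And>x. x \<in> carrier (umod H) \<Longrightarrow> runit_map T (jl T (id_mor1 H) x) = lleg (csp T) x"
    and "\<And>y. y \<in> carrier (mod1 T) \<Longrightarrow> runit_map T (jr T (id_mor1 H) y) = y"
proof -
  note t = cospan_morD[OF T]
  note I = cospan_mor_id[OF t(3)]
  note sq = comp_square[OF I T] and TI = comp_cospan_mor[OF I T]
  note d = pushout_squareD[OF sq]
  have glue: "lleg (csp T) (rleg (csp (id_mor1 H)) h) = id_hom (mod1 T) (lleg (csp T) h)"
    if "h \<in> carrier (umod H)" for h using that t by simp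
  have r: "lleg (csp T) \<in> mod_hom R (mod1 (id_mor1 H)) (mod1 T)" using t by simp
  have eq: "runit_map T = induced_map R po (mor1_span T (id_mor1 H))
       \<lparr>apex = mod1 T, lleg = lleg (csp T), rleg = id_hom (mod1 T)\<rparr>"
    using t by (simp add: runit_map_def)
  note P = comp_induced[OF I T t(5) r id_hom_mod_hom[OF t(5)] glue, folded eq]
  show 1: "runit_map T (jl T (id_mor1 H) x) = lleg (csp T) x" if "x \<in> carrier (umod H)" for x
    using P(2) that by simp
  show 2: "runit_map T (jr T (id_mor1 H) y) = y" if "y \<in> carrier (mod1 T)" for y
    using P(3) that by simp
  show "cospan_arrow R H H' (T \<cdot> id_mor1 H) T (runit_map T)"
    unfolding cospan_arrow_def using T TI P(1) t 1 2 by (simp add: comp_mor1_legs)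
  have "pushout_square R (umod H) (umod H) (mod1 T) (id_hom (umod H)) (lleg (csp T))
      (mod1 T) (lleg (csp T)) (id_hom (mod1 T))"
    using t by (intro pushout_square_id_left) auto
  then have "pushout_square R (umod H) (mod1 (id_mor1 H)) (mod1 T) (rleg (csp (id_mor1 H))) (lleg (csp T))
      (mod1 T) (lleg (csp T)) (id_hom (mod1 T))" by simp
  from pushout_square_unique[OF sq this] obtain \<phi> where \<phi>:
    "\<phi> \<in> mod_iso R (mod1 (T \<cdot> id_mor1 H)) (mod1 T)"
    "\<And>x. x \<in> carrier (umod H) \<Longrightarrow> \<phi> (jl T (id_mor1 H) x) = lleg (csp T) x"
    "\<And>y. y \<in> carrier (mod1 T) \<Longrightarrow> \<phi> (jr T (id_mor1 H) y) = y" by auto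
  have "runit_map T = \<phi>"
    by (rule pushout_square_eqI[OF sq t(5) P(1) mod_iso_mod_hom[OF \<phi>(1)]]) (use 1 2 \<phi> in simp_all)
  then show "runit_map T \<in> mod_iso R (mod1 (T \<cdot> id_mor1 H)) (mod1 T)" using \<phi>(1) by simp
qed

lemma lunit_mor2_eq:
  "cospan_mor R H H' T \<Longrightarrow> lunit_mor2 R po T = mor2_of_map R (id_mor1 H' \<cdot> T) T (lunit_map T)"
  using cospan_morD(2)[of R H H' T] by (simp add: lunit_mor2_def lunit_map_def)

lemma runit_mor2_eq:
  "cospan_mor R H H' T \<Longrightarrow> runit_mor2 R po T = mor2_of_map R (T \<cdot> id_mor1 H) T (runit_map T)"
  using cospan_morD(1)[of R H H' T] by (simp add: runit_mor2_def runit_map_def)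

text \<open>
  The cospan \<open>C\<close> is a horizontal composite of \<open>A\<close> and \<open>B\<close> formed with the pushout square \<open>(p, q)\<close>.  Its legs
  start at composites of \<open>1\<close>-morphisms and are described by their restrictions to the two factors.
\<close>

definition hcomp_presents ::
    "('a, 'u) mor1 \<Rightarrow> ('a, 'u) mor1 \<Rightarrow> ('a, 'u) mor1 \<Rightarrow> ('a, 'u) mor1 \<Rightarrow> ('a, 'u) cospan \<Rightarrow>
     ('a, 'u) cospan \<Rightarrow> ('a, 'u) cospan \<Rightarrow> ('u \<Rightarrow> 'u) \<Rightarrow> ('u \<Rightarrow> 'u) \<Rightarrow> bool" where
  "hcomp_presents S S' T T' A B C p q \<longleftrightarrow>
     pushout_square R (umod (tgt1 S)) (apex A) (apex B) (\<lambda>y. rleg A (rleg (csp S') y))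
       (\<lambda>y. lleg B (lleg (csp T) y)) (apex C) p q \<and>
     is_cospan R (mod1 (T \<cdot> S)) (mod1 (T' \<cdot> S')) C \<and>
     (\<forall>x\<in>carrier (mod1 S). lleg C (jl T S x) = p (lleg A x)) \<and>
     (\<forall>y\<in>carrier (mod1 T). lleg C (jr T S y) = q (lleg B y)) \<and>
     (\<forall>x\<in>carrier (mod1 S'). rleg C (jl T' S' x) = p (rleg A x)) \<and>
     (\<forall>y\<in>carrier (mod1 T'). rleg C (jr T' S' y) = q (rleg B y))"

lemma hcomp_presentsD:
  assumes "hcomp_presents S S' T T' A B C p q"
  shows "pushout_square R (umod (tgt1 S)) (apex A) (apex B) (\<lambda>y. rleg A (rleg (csp S') y))
       (\<lambda>y. lleg B (lleg (csp T) y)) (apex C) p q"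
    "is_cospan R (mod1 (T \<cdot> S)) (mod1 (T' \<cdot> S')) C"
    "\<And>x. x \<in> carrier (mod1 S) \<Longrightarrow> lleg C (jl T S x) = p (lleg A x)"
    "\<And>y. y \<in> carrier (mod1 T) \<Longrightarrow> lleg C (jr T S y) = q (lleg B y)"
    "\<And>x. x \<in> carrier (mod1 S') \<Longrightarrow> rleg C (jl T' S' x) = p (rleg A x)"
    "\<And>y. y \<in> carrier (mod1 T') \<Longrightarrow> rleg C (jr T' S' y) = q (rleg B y)"
  using assms unfolding hcomp_presents_def by blast+

lemma hcomp_presents_in:
  assumes mor: "cospan_mor R H H' S" "cospan_mor R H H' S'" "cospan_mor R H' H'' T" "cospan_mor R H' H'' T'"
    and A: "A \<in> two_cospans R S S'" and B: "B \<in> two_cospans R T T'"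
    and C: "hcomp_presents S S' T T' A B C p q"
  shows "C \<in> two_cospans R (T \<cdot> S) (T' \<cdot> S')"
proof (rule two_cospansI)
  note m = cospan_morD[OF mor(1)] cospan_morD[OF mor(2)] cospan_morD[OF mor(3)] cospan_morD[OF mor(4)]
  note c = hcomp_presentsD[OF C] and a = two_cospansD[OF A] and b = two_cospansD[OF B]
  show "is_cospan R (mod1 (T \<cdot> S)) (mod1 (T' \<cdot> S')) C" by (rule c(2))
  show "src1 (T \<cdot> S) = src1 (T' \<cdot> S')" using a by simp
  show "tgt1 (T \<cdot> S) = tgt1 (T' \<cdot> S')" using b by simp
  show "lleg C (lleg (csp (T \<cdot> S)) x) = rleg C (lleg (csp (T' \<cdot> S')) x)"
    if "x \<in> carrier (umod (src1 (T' \<cdot> S')))" for x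
    using that m a c by (simp add: comp_mor1_legs)
  show "lleg C (rleg (csp (T \<cdot> S)) x) = rleg C (rleg (csp (T' \<cdot> S')) x)"
    if "x \<in> carrier (umod (tgt1 (T' \<cdot> S')))" for x
    using that m b c by (simp add: comp_mor1_legs)
qed

definition hcomp_po ::
    "('a, 'u) mor1 \<Rightarrow> ('a, 'u) mor1 \<Rightarrow> ('a, 'u) mor1 \<Rightarrow> ('a, 'u) cospan \<Rightarrow> ('a, 'u) cospan \<Rightarrow> ('a, 'u) cospan" where
  "hcomp_po S S' T B A = po \<lparr>centre = umod (tgt1 S), lfoot = apex A, rfoot = apex B,
     lmap = compose (carrier (umod (tgt1 S))) (rleg A) (rleg (csp S')),
     rmap = compose (carrier (umod (tgt1 S))) (lleg B) (lleg (csp T))\<rparr>"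

lemma hcomp_cospan_presents:
  assumes mor: "cospan_mor R H H' S" "cospan_mor R H H' S'" "cospan_mor R H' H'' T" "cospan_mor R H' H'' T'"
    and A: "A \<in> two_cospans R S S'" and B: "B \<in> two_cospans R T T'"
  shows "hcomp_presents S S' T T' A B (hcomp_cospan R po S S' T T' B A)
    (lleg (hcomp_po S S' T B A)) (rleg (hcomp_po S S' T B A))"
proof -
  note s = cospan_morD[OF mor(1)] and s' = cospan_morD[OF mor(2)]
    and t = cospan_morD[OF mor(3)] and t' = cospan_morD[OF mor(4)]
  note a = two_cospansD[OF A] and b = two_cospansD[OF B]
  let ?P = "hcomp_po S S' T B A"
  have "pushout_square R (umod H') (apex A) (apex B) (compose (carrier (umod H')) (rleg A) (rleg (csp S')))
      (compose (carrier (umod H')) (lleg B) (lleg (csp T))) (apex ?P) (lleg ?P) (rleg ?P)"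
    unfolding hcomp_po_def s(2)
    by (rule chosen_square) (use s s' t t' a b in \<open>auto intro: compose_mod_hom\<close>)
  then have sq: "pushout_square R (umod H') (apex A) (apex B) (\<lambda>y. rleg A (rleg (csp S') y))
       (\<lambda>y. lleg B (lleg (csp T) y)) (apex ?P) (lleg ?P) (rleg ?P)"
    by (rule pushout_square_cong) simp_all
  note d = pushout_squareD[OF sq]
  have glue: "compose (carrier (mod1 S)) (lleg ?P) (lleg A) (rleg (csp S) h) =
      compose (carrier (mod1 T)) (rleg ?P) (lleg B) (lleg (csp T) h)" if "h \<in> carrier (umod H')" for h
    using that d(10)[OF that] s s' t a by simp
  have glue': "compose (carrier (mod1 S')) (lleg ?P) (rleg A) (rleg (csp S') h) =
      compose (carrier (mod1 T')) (rleg ?P) (rleg B) (lleg (csp T') h)" if "h \<in> carrier (umod H')" for h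
    using that d(10)[OF that] s s' t t' a b by simp
  note L = comp_induced[OF mor(1,3) d(3) compose_mod_hom[OF a(7) d(4) a(4)]
      compose_mod_hom[OF b(7) d(5) b(4)] glue]
  note L' = comp_induced[OF mor(2,4) d(3) compose_mod_hom[OF a(8) d(4) a(5)]
      compose_mod_hom[OF b(8) d(5) b(5)] glue']
  note sqs = pushout_squareD(3)[OF comp_square[OF mor(1,3)]] pushout_squareD(3)[OF comp_square[OF mor(2,4)]]
  have C: "apex (hcomp_cospan R po S S' T T' B A) = apex ?P"
    "lleg (hcomp_cospan R po S S' T T' B A) = induced_map R po (mor1_span T S)
       \<lparr>apex = apex ?P, lleg = compose (carrier (mod1 S)) (lleg ?P) (lleg A),
        rleg = compose (carrier (mod1 T)) (rleg ?P) (lleg B)\<rparr>"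
    "rleg (hcomp_cospan R po S S' T T' B A) = induced_map R po (mor1_span T' S')
       \<lparr>apex = apex ?P, lleg = compose (carrier (mod1 S')) (lleg ?P) (rleg A),
        rleg = compose (carrier (mod1 T')) (rleg ?P) (rleg B)\<rparr>"
    by (simp_all add: hcomp_cospan_def hcomp_po_def Let_def)
  show ?thesis
    unfolding hcomp_presents_def is_cospan_def C s(2) using sq d(3) L L' sqs by simp
qed

text \<open>
  The horizontal counterpart of \<open>vcomp_class\<close>.  The legs of two such composites are compared on the
  factors of their domains, where they are given by the maps of the pushout squares.
\<close>

lemma hcomp_class:
  assumes mor: "cospan_mor R H H' S" "cospan_mor R H H' S'" "cospan_mor R H' H'' T" "cospan_mor R H' H'' T'"
    and A: "A \<in> two_cospans R S S'" and B: "B \<in> two_cospans R T T'"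
    and C: "hcomp_presents S S' T T' A B C p q"
  shows "two_cospan_class R T T' B \<bullet> two_cospan_class R S S' A =
    two_cospan_class R (T \<cdot> S) (T' \<cdot> S') C"
proof -
  let ?TS = "T \<cdot> S" and ?TS' = "T' \<cdot> S'"
  note s = cospan_morD[OF mor(1)] and s' = cospan_morD[OF mor(2)]
    and t = cospan_morD[OF mor(3)] and t' = cospan_morD[OF mor(4)]
  note Cin = hcomp_presents_in[OF mor A B C] and c = hcomp_presentsD[OF C]
  note sqTS = comp_square[OF mor(1,3)] and sqTS' = comp_square[OF mor(2,4)]
  have rep: "iso_class R ?TS ?TS' (hcomp_cospan R po S S' T T' B' A') = iso_class R ?TS ?TS' C"
    if A': "A' \<in> iso_class R S S' A" and B': "B' \<in> iso_class R T T' B" for A' B'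
  proof -
    let ?C' = "hcomp_cospan R po S S' T T' B' A'"
    have in': "A' \<in> two_cospans R S S'" "B' \<in> two_cospans R T T'" using A' B' by (auto simp: in_iso_class_iff)
    note a = two_cospansD[OF A] and b = two_cospansD[OF B]
      and a' = two_cospansD[OF in'(1)] and b' = two_cospansD[OF in'(2)]
    note C' = hcomp_cospan_presents[OF mor in']
    note c' = hcomp_presentsD[OF C'] and C'in = hcomp_presents_in[OF mor in' C']
    obtain \<phi> where \<phi>: "\<phi> \<in> mod_iso R (apex A) (apex A')"
      "\<And>x. x \<in> carrier (mod1 S) \<Longrightarrow> \<phi> (lleg A x) = lleg A' x"
      "\<And>x. x \<in> carrier (mod1 S') \<Longrightarrow> \<phi> (rleg A x) = rleg A' x"
      using A' unfolding in_iso_class_iff cospan_iso_def by blast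
    obtain \<psi> where \<psi>: "\<psi> \<in> mod_iso R (apex B) (apex B')"
      "\<And>x. x \<in> carrier (mod1 T) \<Longrightarrow> \<psi> (lleg B x) = lleg B' x"
      "\<And>x. x \<in> carrier (mod1 T') \<Longrightarrow> \<psi> (rleg B x) = rleg B' x"
      using B' unfolding in_iso_class_iff cospan_iso_def by blast
    have "pushout_square R (umod (tgt1 S)) (apex A) (apex B) (\<lambda>y. rleg A (rleg (csp S') y))
       (\<lambda>y. lleg B (lleg (csp T) y)) (apex ?C')
       (compose (carrier (apex A)) (lleg (hcomp_po S S' T B' A')) \<phi>)
       (compose (carrier (apex B)) (rleg (hcomp_po S S' T B' A')) \<psi>)"
      by (rule pushout_square_transport[OF c'(1) a(6) b(6) \<phi>(1) \<psi>(1)]) (use s(2) s'(9) t(8) a(10) b(9) \<phi>(3) \<psi>(2) in simp_all)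
    from pushout_square_unique[OF c(1) this]
    obtain \<chi> where \<chi>: "\<chi> \<in> mod_iso R (apex C) (apex ?C')"
      "\<And>x. x \<in> carrier (apex A) \<Longrightarrow> \<chi> (p x) = lleg (hcomp_po S S' T B' A') (\<phi> x)"
      "\<And>x. x \<in> carrier (apex B) \<Longrightarrow> \<chi> (q x) = rleg (hcomp_po S S' T B' A') (\<psi> x)"
      by auto
    note Cd = two_cospansD[OF Cin] and C'd = two_cospansD[OF C'in]
    note \<chi>hom = mod_iso_mod_hom[OF \<chi>(1)]
    have idl: "id_hom (apex ?C') \<in> mod_hom R (apex ?C') (apex ?C')" by (rule id_hom_mod_hom) (rule C'd)
    have 1: "\<chi> (lleg C x) = id_hom (apex ?C') (lleg ?C' x)" if "x \<in> carrier (mod1 ?TS)" for x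
      by (rule pushout_square_comp_eqI[OF sqTS C'd(6) Cd(7) \<chi>hom C'd(7) idl _ _ that])
         (use c(3,4) c'(3,4) \<chi> \<phi> \<psi> a(9) b(9) a'(9) b'(9) pushout_squareD(6,7)[OF c'(1)] in simp_all)
    have 2: "\<chi> (rleg C x) = id_hom (apex ?C') (rleg ?C' x)" if "x \<in> carrier (mod1 ?TS')" for x
      by (rule pushout_square_comp_eqI[OF sqTS' C'd(6) Cd(8) \<chi>hom C'd(8) idl _ _ that])
         (use c(5,6) c'(5,6) \<chi> \<phi> \<psi> a(10) b(10) a'(10) b'(10) pushout_squareD(6,7)[OF c'(1)] in simp_all)
    have "cospan_iso R (mod1 ?TS) (mod1 ?TS') C ?C'"
      by (rule cospan_isoI[OF \<chi>(1)]) (use 1 2 C'd in simp_all)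
    then show ?thesis using iso_class_eqI[OF Cin C'in] by simp
  qed
  have "A \<in> iso_class R S S' A" "B \<in> iso_class R T T' B"
    using A B cospan_iso_refl[OF two_cospansD(3)[OF A]] cospan_iso_refl[OF two_cospansD(3)[OF B]]
    by (simp_all add: in_iso_class_iff)
  then have "(\<Union>A'\<in>iso_class R S S' A. \<Union>B'\<in>iso_class R T T' B.
      iso_class R ?TS ?TS' (hcomp_cospan R po S S' T T' B' A')) = iso_class R ?TS ?TS' C"
    using rep by auto
  then show ?thesis by (simp add: hcomp_mor2_def two_cospan_class_def Let_def)
qed

lemma hcomp_cell:
  assumes mor: "cospan_mor R H H' S" "cospan_mor R H H' S'" "cospan_mor R H' H'' T" "cospan_mor R H' H'' T'"
    and "\<alpha> \<in> two_cospan_classes R S S'" "\<beta> \<in> two_cospan_classes R T T'"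
  shows "(\<beta> \<bullet> \<alpha>) \<in> two_cospan_classes R (T \<cdot> S) (T' \<cdot> S')"
proof -
  obtain A where A: "A \<in> two_cospans R S S'" "\<alpha> = two_cospan_class R S S' A"
    using assms(5) by (rule two_cospan_classesE)
  obtain B where B: "B \<in> two_cospans R T T'" "\<beta> = two_cospan_class R T T' B"
    using assms(6) by (rule two_cospan_classesE)
  note C = hcomp_cospan_presents[OF mor A(1) B(1)]
  show ?thesis unfolding A(2) B(2) hcomp_class[OF mor A(1) B(1) C]
    by (rule two_cospan_class_in[OF hcomp_presents_in[OF mor A(1) B(1) C]])
qed

text \<open>
  For \<open>2\<close>-cospans coming from maps \<open>f\<close> and \<open>k\<close>, the span to be glued is formed by the inner legs of
  \<open>S'\<close> and \<open>T'\<close>, so the composite \<open>T' \<cdot> S'\<close> is itself a horizontal composite; its right leg is the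
  identity.
\<close>

lemma hcomp_map:
  assumes f: "cospan_arrow R H H' S S' f" and k: "cospan_arrow R H' H'' T T' k"
  obtains m where "cospan_arrow R H H'' (T \<cdot> S) (T' \<cdot> S') m"
    "\<And>x. x \<in> carrier (mod1 S) \<Longrightarrow> m (jl T S x) = jl T' S' (f x)"
    "\<And>y. y \<in> carrier (mod1 T) \<Longrightarrow> m (jr T S y) = jr T' S' (k y)"
    "mor2_of_map R T T' k \<bullet> mor2_of_map R S S' f =
      mor2_of_map R (T \<cdot> S) (T' \<cdot> S') m"
proof -
  note fd = cospan_arrowD[OF f] and kd = cospan_arrowD[OF k]
  note s = cospan_morD[OF fd(1)] and s' = cospan_morD[OF fd(2)]
    and t = cospan_morD[OF kd(1)] and t' = cospan_morD[OF kd(2)]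
  note sq = comp_square[OF fd(1) kd(1)] and sq' = comp_square[OF fd(2) kd(2)]
  note d = pushout_squareD[OF sq] and d' = pushout_squareD[OF sq']
  note TS = comp_cospan_mor[OF fd(1) kd(1)] and TS' = comp_cospan_mor[OF fd(2) kd(2)]
  obtain m where m: "m \<in> mod_hom R (mod1 (T \<cdot> S)) (mod1 (T' \<cdot> S'))"
    "\<And>x. x \<in> carrier (mod1 S) \<Longrightarrow> m (jl T S x) = compose (carrier (mod1 S)) (jl T' S') f x"
    "\<And>y. y \<in> carrier (mod1 T) \<Longrightarrow> m (jr T S y) = compose (carrier (mod1 T)) (jr T' S') k y"
    by (rule pushout_square_lift[OF sq d'(3) compose_mod_hom[OF fd(3) d'(4) s(5)]
          compose_mod_hom[OF kd(3) d'(5) t(5)]]) (use d d' fd kd s t in auto)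
  have arrow: "cospan_arrow R H H'' (T \<cdot> S) (T' \<cdot> S') m"
    unfolding cospan_arrow_def using TS TS' m fd kd s s' t t' by (simp add: comp_mor1_legs)
  have "pushout_square R (umod H') (mod1 S') (mod1 T') (\<lambda>y. id_hom (mod1 S') (rleg (csp S') y))
       (\<lambda>y. k (lleg (csp T) y)) (mod1 (T' \<cdot> S')) (jl T' S') (jr T' S')"
    by (rule pushout_square_cong[OF sq']) (use s' kd in simp_all)
  then have "hcomp_presents S S' T T' (map_cospan S' f) (map_cospan T' k)
      (map_cospan (T' \<cdot> S') m) (jl T' S') (jr T' S')"
    unfolding hcomp_presents_def using m s d' two_cospansD(3)[OF map_cospan_in[OF arrow]] by simp
  from hcomp_class[OF fd(1,2) kd(1,2) map_cospan_in[OF f] map_cospan_in[OF k] this]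
  show ?thesis using that[OF arrow] m by (simp add: mor2_of_map_eq)
qed

end

section \<open>The bicategory axioms\<close>

context chosen_pushouts
begin

lemma hcomp_id2:
  assumes S: "cospan_mor R H H' S" and T: "cospan_mor R H' H'' T"
  shows "id_mor2 R T \<bullet> id_mor2 R S = id_mor2 R (T \<cdot> S)"
proof -
  note s = cospan_morD[OF S] and t = cospan_morD[OF T]
  note sq = comp_square[OF S T]
  note d = pushout_squareD[OF sq]
  obtain m where m: "cospan_arrow R H H'' (T \<cdot> S) (T \<cdot> S) m"
    "\<And>x. x \<in> carrier (mod1 S) \<Longrightarrow> m (jl T S x) = jl T S (id_hom (mod1 S) x)"
    "\<And>y. y \<in> carrier (mod1 T) \<Longrightarrow> m (jr T S y) = jr T S (id_hom (mod1 T) y)"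
    "mor2_of_map R T T (id_hom (mod1 T)) \<bullet> mor2_of_map R S S (id_hom (mod1 S)) =
      mor2_of_map R (T \<cdot> S) (T \<cdot> S) m"
    using hcomp_map[OF cospan_arrow_id[OF S] cospan_arrow_id[OF T]] by blast
  have "m = id_hom (mod1 (T \<cdot> S))"
    by (rule pushout_square_id[OF sq cospan_arrowD(3)[OF m(1)]]) (use m in simp_all)
  then show ?thesis using m(4) by (simp add: id_mor2_def)
qed

text \<open>
  The compatibility of \<open>2\<close>-cospans with the legs of the \<open>1\<close>-morphisms allows all maps out of \<open>H'\<close> to be
  routed through the middle \<open>1\<close>-morphisms \<open>S'\<close> and \<open>T'\<close>; the two sides then form the grid of
  \<open>pushout_square_interchange\<close>.
\<close>

lemma hcomp_interchange:
  assumes S: "cospan_mor R H H' S" "cospan_mor R H H' S'" "cospan_mor R H H' S''"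
    and T: "cospan_mor R H' H'' T" "cospan_mor R H' H'' T'" "cospan_mor R H' H'' T''"
    and \<alpha>: "\<alpha> \<in> two_cospan_classes R S S'" "\<alpha>' \<in> two_cospan_classes R S' S''"
    and \<beta>: "\<beta> \<in> two_cospan_classes R T T'" "\<beta>' \<in> two_cospan_classes R T' T''"
  shows "(\<beta>' \<star> \<beta>) \<bullet> (\<alpha>' \<star> \<alpha>) =
    (\<beta>' \<bullet> \<alpha>') \<star> (\<beta> \<bullet> \<alpha>)"
proof -
  obtain A where A: "A \<in> two_cospans R S S'" "\<alpha> = two_cospan_class R S S' A"
    using \<alpha>(1) by (rule two_cospan_classesE)
  obtain A' where A': "A' \<in> two_cospans R S' S''" "\<alpha>' = two_cospan_class R S' S'' A'"
    using \<alpha>(2) by (rule two_cospan_classesE)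
  obtain B where B: "B \<in> two_cospans R T T'" "\<beta> = two_cospan_class R T T' B"
    using \<beta>(1) by (rule two_cospan_classesE)
  obtain B' where B': "B' \<in> two_cospans R T' T''" "\<beta>' = two_cospan_class R T' T'' B'"
    using \<beta>(2) by (rule two_cospan_classesE)
  note s = cospan_morD[OF S(1)] and s' = cospan_morD[OF S(2)] and s'' = cospan_morD[OF S(3)]
    and t = cospan_morD[OF T(1)] and t' = cospan_morD[OF T(2)] and t'' = cospan_morD[OF T(3)]
  let ?TS = "T \<cdot> S" and ?TS' = "T' \<cdot> S'" and ?TS'' = "T'' \<cdot> S''"
  note TS = comp_cospan_mor[OF S(1) T(1)] comp_cospan_mor[OF S(2) T(2)] comp_cospan_mor[OF S(3) T(3)]
  let ?VA = "cospan_comp po (mod1 S) (mod1 S') (mod1 S'') A' A"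
  let ?VB = "cospan_comp po (mod1 T) (mod1 T') (mod1 T'') B' B"
  let ?HA = "hcomp_cospan R po S S' T T' B A"
  let ?HA' = "hcomp_cospan R po S' S'' T' T'' B' A'"
  let ?P = "hcomp_cospan R po S S'' T T'' ?VB ?VA"
  let ?Q = "cospan_comp po (mod1 ?TS) (mod1 ?TS') (mod1 ?TS'') ?HA' ?HA"
  let ?hA' = "hcomp_po S' S'' T' B' A'"
    and ?hA = "hcomp_po S S' T B A"
    and ?hP = "hcomp_po S S'' T ?VB ?VA"
  note VA = vcomp_cospan_in[OF A(1) A'(1) S] and VB = vcomp_cospan_in[OF B(1) B'(1) T]
  note pHA = hcomp_cospan_presents[OF S(1,2) T(1,2) A(1) B(1)]
    and pHA' = hcomp_cospan_presents[OF S(2,3) T(2,3) A'(1) B'(1)]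
    and pP = hcomp_cospan_presents[OF S(1,3) T(1,3) VA VB]
  note HA = hcomp_presents_in[OF S(1,2) T(1,2) A(1) B(1) pHA]
    and HA' = hcomp_presents_in[OF S(2,3) T(2,3) A'(1) B'(1) pHA']
    and P = hcomp_presents_in[OF S(1,3) T(1,3) VA VB pP]
  note Q = vcomp_cospan_in[OF HA HA' TS]
  note dP = hcomp_presentsD[OF pP] and dHA = hcomp_presentsD[OF pHA] and dHA' = hcomp_presentsD[OF pHA']
  note a = two_cospansD[OF A(1)] and a' = two_cospansD[OF A'(1)] and b = two_cospansD[OF B(1)]
    and b' = two_cospansD[OF B'(1)] and ha = two_cospansD[OF HA] and ha' = two_cospansD[OF HA']
    and p = two_cospansD[OF P] and q = two_cospansD[OF Q]
  let ?pa = "po (inner_span (mod1 S') A' A)" and ?pb = "po (inner_span (mod1 T') B' B)"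
    and ?ph = "po (inner_span (mod1 ?TS') ?HA' ?HA)"
  note sqVA = vcomp_square[OF A(1) A'(1)] and sqVB = vcomp_square[OF B(1) B'(1)]
    and sqQ = vcomp_square[OF HA HA']
  note va = pushout_squareD(6,7,10)[OF sqVA] and vb = pushout_squareD(6,7,10)[OF sqVB]
    and vq = pushout_squareD(6,7,10)[OF sqQ]
  have c1: "rleg A' (rleg (csp S'') y) = lleg A' (rleg (csp S') y)" if "y \<in> carrier (umod H')" for y
    using a'(12) s''(2) that by simp
  have c2: "lleg B (lleg (csp T) y) = rleg B (lleg (csp T') y)" if "y \<in> carrier (umod H')" for y
    using b(11) t'(1) that by simp
  have sqP: "pushout_square R (umod H') (apex ?pa) (apex ?pb)
      (\<lambda>y. lleg ?pa (rleg A (rleg (csp S') y))) (\<lambda>y. rleg ?pb (lleg B' (lleg (csp T') y))) (apex ?P)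
      (lleg ?hP) (rleg ?hP)"
    by (rule pushout_square_cong[OF dP(1)[unfolded s(2) cospan_comp_simps(1)]])
       (use c1 c2 va(3) vb(3) s'(9) s''(9) t(8) t'(8) in simp_all)
  then have sqP: "pushout_square R (umod H') (apex ?pa) (apex ?pb)
      (\<lambda>y. lleg ?pa (rleg A (rleg (csp S') y))) (\<lambda>y. lleg ?pb (rleg B (lleg (csp T') y))) (apex ?P)
      (lleg ?hP) (rleg ?hP)"
    by (rule pushout_square_cong) (use vb(3) t'(8) in simp_all)
  have sqHA: "pushout_square R (umod H') (apex A) (apex B)
      (\<lambda>y. rleg A (rleg (csp S') y)) (\<lambda>y. rleg B (lleg (csp T') y)) (apex ?HA)
      (lleg ?hA) (rleg ?hA)"
    by (rule pushout_square_cong[OF dHA(1)[unfolded s(2)]]) (use c2 in simp_all)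
  have sqHA': "pushout_square R (umod H') (apex A') (apex B')
      (\<lambda>y. lleg A' (rleg (csp S') y)) (\<lambda>y. lleg B' (lleg (csp T') y)) (apex ?HA')
      (lleg ?hA') (rleg ?hA')"
    by (rule pushout_square_cong[OF dHA'(1)[unfolded s'(2)]]) (use c1 in simp_all)
  obtain \<phi> where \<phi>: "\<phi> \<in> mod_iso R (apex ?P) (apex ?ph)"
    "\<And>x. x \<in> carrier (apex A) \<Longrightarrow> \<phi> (lleg ?hP (lleg ?pa x)) =
      lleg ?ph (lleg ?hA x)"
    "\<And>x. x \<in> carrier (apex A') \<Longrightarrow> \<phi> (lleg ?hP (rleg ?pa x)) =
      rleg ?ph (lleg ?hA' x)"
    "\<And>x. x \<in> carrier (apex B) \<Longrightarrow> \<phi> (rleg ?hP (lleg ?pb x)) =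
      lleg ?ph (rleg ?hA x)"
    "\<And>x. x \<in> carrier (apex B') \<Longrightarrow> \<phi> (rleg ?hP (rleg ?pb x)) =
      rleg ?ph (rleg ?hA' x)"
    using pushout_square_interchange[OF sqVA sqVB sqP sqHA sqHA' comp_square[OF S(2) T(2)] sqQ
        ha(8) dHA(5,6) ha'(7) dHA'(3,4)] by blast
  note \<phi>hom = mod_iso_mod_hom[OF \<phi>(1)]
  note idl = id_hom_mod_hom[OF q(6), unfolded cospan_comp_simps(1)]
  note mQ = q(6)[unfolded cospan_comp_simps(1)]
  note qlegs = q(7,8)[unfolded cospan_comp_simps(1)]
  note d1 = pushout_squareD[OF comp_square[OF S(1) T(1)]]
    and d3 = pushout_squareD[OF comp_square[OF S(3) T(3)]]
  have 1: "\<phi> (lleg ?P x) = id_hom (apex ?ph) (lleg ?Q x)" if "x \<in> carrier (mod1 ?TS)" for x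
    by (rule pushout_square_comp_eqI[OF comp_square[OF S(1) T(1)] mQ p(7) \<phi>hom qlegs(1) idl _ _ that])
       (use \<phi> a(9) b(9) dP(3,4) dHA(3,4) d1(6,7) vq(1) pushout_squareD(6,7)[OF sqHA] in simp_all)
  have 2: "\<phi> (rleg ?P x) = id_hom (apex ?ph) (rleg ?Q x)" if "x \<in> carrier (mod1 ?TS'')" for x
    by (rule pushout_square_comp_eqI[OF comp_square[OF S(3) T(3)] mQ p(8) \<phi>hom qlegs(2) idl _ _ that])
       (use \<phi> a'(10) b'(10) dP(5,6) dHA'(5,6) d3(6,7) vq(2) pushout_squareD(6,7)[OF sqHA'] in simp_all)
  have "cospan_iso R (mod1 ?TS) (mod1 ?TS'') ?P ?Q"
    by (rule cospan_isoI[of \<phi>]) (use \<phi>(1) 1 2 ha(9) ha'(10) vq in simp_all)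
  then have "two_cospan_class R ?TS ?TS'' ?P = two_cospan_class R ?TS ?TS'' ?Q"
    by (rule two_cospan_class_eqI[OF P Q])
  then show ?thesis
    unfolding A(2) B(2) A'(2) B'(2) vcomp_class_chosen[OF A(1) A'(1) S] vcomp_class_chosen[OF B(1) B'(1) T]
      hcomp_class[OF S(1,2) T(1,2) A(1) B(1) pHA] hcomp_class[OF S(2,3) T(2,3) A'(1) B'(1) pHA']
      hcomp_class[OF S(1,3) T(1,3) VA VB pP] vcomp_class_chosen[OF HA HA' TS] .
qed

text \<open>
  The apexes of both composites are colimits of \<open>A \<leftarrow> umod b \<rightarrow> B \<leftarrow> umod c \<rightarrow> C\<close>.
\<close>

lemma assoc_natural:
  assumes S: "cospan_mor R a b S" "cospan_mor R a b S'"
    and T: "cospan_mor R b c T" "cospan_mor R b c T'"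
    and U: "cospan_mor R c d U" "cospan_mor R c d U'"
    and \<alpha>: "\<alpha> \<in> two_cospan_classes R S S'" and \<beta>: "\<beta> \<in> two_cospan_classes R T T'"
    and \<gamma>: "\<gamma> \<in> two_cospan_classes R U U'"
  shows "assoc_mor2 R po U' T' S' \<star> ((\<gamma> \<bullet> \<beta>) \<bullet> \<alpha>) =
    (\<gamma> \<bullet> (\<beta> \<bullet> \<alpha>)) \<star> assoc_mor2 R po U T S"
proof -
  obtain A where A: "A \<in> two_cospans R S S'" "\<alpha> = two_cospan_class R S S' A"
    using \<alpha> by (rule two_cospan_classesE)
  obtain B where B: "B \<in> two_cospans R T T'" "\<beta> = two_cospan_class R T T' B"
    using \<beta> by (rule two_cospan_classesE)
  obtain C where C: "C \<in> two_cospans R U U'" "\<gamma> = two_cospan_class R U U' C"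
    using \<gamma> by (rule two_cospan_classesE)
  note s = cospan_morD[OF S(1)] and s' = cospan_morD[OF S(2)] and t = cospan_morD[OF T(1)]
    and t' = cospan_morD[OF T(2)] and u = cospan_morD[OF U(1)] and u' = cospan_morD[OF U(2)]
  let ?TS = "T \<cdot> S" and ?TS' = "T' \<cdot> S'"
    and ?UT = "U \<cdot> T" and ?UT' = "U' \<cdot> T'"
  note TS = comp_cospan_mor[OF S(1) T(1)] comp_cospan_mor[OF S(2) T(2)]
    and UT = comp_cospan_mor[OF T(1) U(1)] comp_cospan_mor[OF T(2) U(2)]
  let ?BA = "hcomp_cospan R po S S' T T' B A" and ?CB = "hcomp_cospan R po T T' U U' C B"
  let ?Q = "hcomp_cospan R po ?TS ?TS' U U' C ?BA" and ?Q' = "hcomp_cospan R po S S' ?UT ?UT' ?CB A"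
  let ?hCB = "hcomp_po T T' U C B"
    and ?hBA = "hcomp_po S S' T B A"
    and ?hQ' = "hcomp_po S S' ?UT ?CB A"
    and ?hQ = "hcomp_po ?TS ?TS' U C ?BA"
  note pBA = hcomp_cospan_presents[OF S T A(1) B(1)] and pCB = hcomp_cospan_presents[OF T U B(1) C(1)]
  note BA = hcomp_presents_in[OF S T A(1) B(1) pBA] and CB = hcomp_presents_in[OF T U B(1) C(1) pCB]
  note pQ = hcomp_cospan_presents[OF TS U BA C(1)] and pQ' = hcomp_cospan_presents[OF S UT A(1) CB]
  note Q = hcomp_presents_in[OF TS U BA C(1) pQ] and Q' = hcomp_presents_in[OF S UT A(1) CB pQ']
  note dBA = hcomp_presentsD[OF pBA] and dCB = hcomp_presentsD[OF pCB]
    and dQ = hcomp_presentsD[OF pQ] and dQ' = hcomp_presentsD[OF pQ']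
  note la = two_cospansD[OF A(1)] and lb = two_cospansD[OF B(1)] and lc = two_cospansD[OF C(1)]
    and q = two_cospansD[OF Q] and q' = two_cospansD[OF Q']
  have tgt: "tgt1 S = b" "tgt1 T = c" "tgt1 ?TS = c" using s t by simp_all
  have sqQ: "pushout_square R (umod c) (apex ?BA) (apex C)
      (\<lambda>y. rleg ?hBA (rleg B (rleg (csp T') y))) (\<lambda>y. lleg C (lleg (csp U) y)) (apex ?Q)
      (lleg ?hQ) (rleg ?hQ)"
    by (rule pushout_square_cong[OF dQ(1)[unfolded tgt]]) (use dBA(6) t'(2,9) in \<open>simp_all add: comp_mor1_legs\<close>)
  have sqQ': "pushout_square R (umod b) (apex A) (apex ?CB)
      (\<lambda>y. rleg A (rleg (csp S') y)) (\<lambda>y. lleg ?hCB (lleg B (lleg (csp T) y))) (apex ?Q')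
      (lleg ?hQ') (rleg ?hQ')"
    by (rule pushout_square_cong[OF dQ'(1)[unfolded tgt]]) (use dCB(3) t(1,8) in \<open>simp_all add: comp_mor1_legs\<close>)
  obtain \<phi> where \<phi>: "\<phi> \<in> mod_iso R (apex ?Q') (apex ?Q)"
    "\<And>x. x \<in> carrier (apex A) \<Longrightarrow> \<phi> (lleg ?hQ' x) =
      lleg ?hQ (lleg ?hBA x)"
    "\<And>x. x \<in> carrier (apex B) \<Longrightarrow> \<phi> (rleg ?hQ' (lleg ?hCB x)) =
      lleg ?hQ (rleg ?hBA x)"
    "\<And>x. x \<in> carrier (apex C) \<Longrightarrow> \<phi> (rleg ?hQ' (rleg ?hCB x)) =
      rleg ?hQ x"
    using pushout_square_assoc[OF dBA(1)[unfolded tgt] sqQ dCB(1)[unfolded tgt] sqQ'] by blast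
  note \<phi>hom = mod_iso_mod_hom[OF \<phi>(1)]
  note as = assoc_map_props[OF S(1) T(1) U(1)] and as' = assoc_map_props[OF S(2) T(2) U(2)]
  note L = comp_cospan_mor[OF S(1) UT(1)] comp_cospan_mor[OF S(2) UT(2)]
  note dUT = pushout_squareD[OF comp_square[OF T(1) U(1)]] and dUT' = pushout_squareD[OF comp_square[OF T(2) U(2)]]
    and dTS = pushout_squareD[OF comp_square[OF S(1) T(1)]] and dTS' = pushout_squareD[OF comp_square[OF S(2) T(2)]]
    and dL = pushout_squareD[OF comp_square[OF S(1) UT(1)]] and dL' = pushout_squareD[OF comp_square[OF S(2) UT(2)]]
  have "compose (carrier (mod1 (?UT \<cdot> S))) \<phi> (lleg ?Q') =
      compose (carrier (mod1 (?UT \<cdot> S))) (lleg ?Q) (assoc_map R po U T S)"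
    by (rule comp3_eqI[OF S(1) T(1) U(1) q(6) compose_mod_hom[OF q'(7) \<phi>hom q'(4)]
          compose_mod_hom[OF cospan_arrowD(3)[OF as(1)] q(7) q'(4)]])
       (use as(3-5) \<phi>(2-4) dQ(3,4) dQ'(3,4) dBA(3,4) dCB(3,4) la(9) lb(9) lc(9) dUT(6,7) dTS(6,7) dL(6,7) in simp_all)
  then have 1: "\<phi> (lleg ?Q' x) = lleg ?Q (assoc_map R po U T S x)"
    if "x \<in> carrier (mod1 (?UT \<cdot> S))" for x using that by (simp add: compose_eq_iff)
  have "compose (carrier (mod1 (?UT' \<cdot> S'))) \<phi> (rleg ?Q') =
      compose (carrier (mod1 (?UT' \<cdot> S'))) (rleg ?Q) (assoc_map R po U' T' S')"
    by (rule comp3_eqI[OF S(2) T(2) U(2) q(6) compose_mod_hom[OF q'(8) \<phi>hom q'(5)]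
          compose_mod_hom[OF cospan_arrowD(3)[OF as'(1)] q(8) q'(5)]])
       (use as'(3-5) \<phi>(2-4) dQ(5,6) dQ'(5,6) dBA(5,6) dCB(5,6) la(10) lb(10) lc(10) dUT'(6,7) dTS'(6,7) dL'(6,7) in simp_all)
  then have 2: "\<phi> (rleg ?Q' x) = rleg ?Q (assoc_map R po U' T' S' x)"
    if "x \<in> carrier (mod1 (?UT' \<cdot> S'))" for x using that by (simp add: compose_eq_iff)
  show ?thesis
    unfolding A(2) B(2) C(2) hcomp_class[OF S T A(1) B(1) pBA] hcomp_class[OF T U B(1) C(1) pCB]
      hcomp_class[OF TS U BA C(1) pQ] hcomp_class[OF S UT A(1) CB pQ'] assoc_mor2_def
    by (rule vcomp_natural[OF as(1) as'(1,2) Q' Q \<phi>(1) 1 2])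
qed

text \<open>
  The apex of \<open>A\<close> is a pushout of the span defining \<open>I \<bullet> A\<close>, and the legs of the composite
  become those of \<open>A\<close> precomposed with the unit isomorphisms.
\<close>

lemma lunit_natural:
  assumes S: "cospan_mor R H H' S" "cospan_mor R H H' S'" and \<alpha>: "\<alpha> \<in> two_cospan_classes R S S'"
  shows "lunit_mor2 R po S' \<star> (id_mor2 R (id_mor1 H') \<bullet> \<alpha>) =
    \<alpha> \<star> lunit_mor2 R po S"
proof -
  obtain A where A: "A \<in> two_cospans R S S'" "\<alpha> = two_cospan_class R S S' A"
    using \<alpha> by (rule two_cospan_classesE)
  note s = cospan_morD[OF S(1)] and s' = cospan_morD[OF S(2)] and a = two_cospansD[OF A(1)]
  let ?I = "id_mor1 H'"
  note I = cospan_mor_id[OF s(4)]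
  note l = lunit_map_props[OF S(1)] and l' = lunit_map_props[OF S(2)]
  let ?C = "\<lparr>apex = apex A, lleg = compose (carrier (mod1 (?I \<cdot> S))) (lleg A) (lunit_map S),
    rleg = compose (carrier (mod1 (?I \<cdot> S'))) (rleg A) (lunit_map S')\<rparr>"
  let ?q = "compose (carrier (umod H')) (rleg A) (rleg (csp S'))"
  note d = pushout_squareD[OF comp_square[OF S(1) I]] and d' = pushout_squareD[OF comp_square[OF S(2) I]]
  have "pushout_square R (umod H') (apex A) (umod H') (\<lambda>y. rleg A (rleg (csp S') y))
      (id_hom (umod H')) (apex A) (id_hom (apex A)) ?q"
    by (rule pushout_square_iso_right)
       (use s s'(7,9) a in \<open>auto intro: id_hom_mod_iso compose_mod_hom\<close>)
  then have sq: "pushout_square R (umod H') (apex A) (umod H') (\<lambda>y. rleg A (rleg (csp S') y))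
      (\<lambda>y. id_hom (umod H') (id_hom (umod H') y)) (apex A) (id_hom (apex A)) ?q"
    by (rule pushout_square_cong) simp_all
  have compat: "lleg A (rleg (csp S) y) = rleg A (rleg (csp S') y)" if "y \<in> carrier (umod H')" for y
    using a(12) s'(2) that by simp
  have pC: "hcomp_presents S S' ?I ?I A (map_cospan ?I (id_hom (mod1 ?I))) ?C (id_hom (apex A)) ?q"
    unfolding hcomp_presents_def is_cospan_def
    using sq compose_mod_hom[OF cospan_arrowD(3)[OF l(1)] a(7) d(3)]
      compose_mod_hom[OF cospan_arrowD(3)[OF l'(1)] a(8) d'(3)] a(6,9,10) d(3,6,7) d'(3,6,7) l(3,4) l'(3,4) s(2) compat
    by simp
  note Iin = map_cospan_in[OF cospan_arrow_id[OF I]]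
  note C = hcomp_presents_in[OF S I I A(1) Iin pC]
  note lm = cospan_arrowD(4)[OF l(1)] and lm' = cospan_arrowD(4)[OF l'(1)]
  show ?thesis
    unfolding A(2) id_mor2_def mor2_of_map_eq[of R ?I] hcomp_class[OF S I I A(1) Iin pC]
      lunit_mor2_eq[OF S(1)] lunit_mor2_eq[OF S(2)]
    by (rule vcomp_natural[OF l(1) l'(1,2) C A(1), of "id_hom (apex A)"])
       (use a(6,9,10) lm lm' in \<open>auto intro: id_hom_mod_iso\<close>)
qed

lemma runit_natural:
  assumes S: "cospan_mor R H H' S" "cospan_mor R H H' S'" and \<alpha>: "\<alpha> \<in> two_cospan_classes R S S'"
  shows "runit_mor2 R po S' \<star> (\<alpha> \<bullet> id_mor2 R (id_mor1 H)) =
    \<alpha> \<star> runit_mor2 R po S"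
proof -
  obtain A where A: "A \<in> two_cospans R S S'" "\<alpha> = two_cospan_class R S S' A"
    using \<alpha> by (rule two_cospan_classesE)
  note s = cospan_morD[OF S(1)] and s' = cospan_morD[OF S(2)] and a = two_cospansD[OF A(1)]
  let ?I = "id_mor1 H"
  note I = cospan_mor_id[OF s(3)]
  note l = runit_map_props[OF S(1)] and l' = runit_map_props[OF S(2)]
  let ?C = "\<lparr>apex = apex A, lleg = compose (carrier (mod1 (S \<cdot> ?I))) (lleg A) (runit_map S),
    rleg = compose (carrier (mod1 (S' \<cdot> ?I))) (rleg A) (runit_map S')\<rparr>"
  let ?p = "compose (carrier (umod H)) (lleg A) (lleg (csp S))"
  note d = pushout_squareD[OF comp_square[OF I S(1)]] and d' = pushout_squareD[OF comp_square[OF I S(2)]]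
  have "pushout_square R (umod H) (umod H) (apex A) (id_hom (umod H)) ?p
      (apex A) ?p (id_hom (apex A))"
    by (rule pushout_square_id_left)
       (use s a in \<open>auto intro: compose_mod_hom\<close>)
  then have sq: "pushout_square R (umod H) (umod H) (apex A) (\<lambda>y. id_hom (umod H) (id_hom (umod H) y))
      (\<lambda>y. lleg A (lleg (csp S) y)) (apex A) ?p (id_hom (apex A))"
    by (rule pushout_square_cong) simp_all
  have compat: "lleg A (lleg (csp S) y) = rleg A (lleg (csp S') y)" if "y \<in> carrier (umod H)" for y
    using a(11) s'(1) that by simp
  have pC: "hcomp_presents ?I ?I S S' (map_cospan ?I (id_hom (mod1 ?I))) A ?C ?p (id_hom (apex A))"
    unfolding hcomp_presents_def is_cospan_def
    using sq compose_mod_hom[OF cospan_arrowD(3)[OF l(1)] a(7) d(3)]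
      compose_mod_hom[OF cospan_arrowD(3)[OF l'(1)] a(8) d'(3)] a(6,9,10) d(3,6,7) d'(3,6,7) l(3,4) l'(3,4) compat
    by simp
  note Iin = map_cospan_in[OF cospan_arrow_id[OF I]]
  note C = hcomp_presents_in[OF I I S Iin A(1) pC]
  note lm = cospan_arrowD(4)[OF l(1)] and lm' = cospan_arrowD(4)[OF l'(1)]
  show ?thesis
    unfolding A(2) id_mor2_def mor2_of_map_eq[of R ?I] hcomp_class[OF I I S Iin A(1) pC]
      runit_mor2_eq[OF S(1)] runit_mor2_eq[OF S(2)]
    by (rule vcomp_natural[OF l(1) l'(1,2) C A(1), of "id_hom (apex A)"])
       (use a(6,9,10) lm lm' in \<open>auto intro: id_hom_mod_iso\<close>)
qed

lemma triangle:
  assumes S: "cospan_mor R a b S" and T: "cospan_mor R b c T"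
  shows "(id_mor2 R T \<bullet> lunit_mor2 R po S) \<star> assoc_mor2 R po T (id_mor1 b) S =
    runit_mor2 R po T \<bullet> id_mor2 R S"
proof -
  note s = cospan_morD[OF S] and t = cospan_morD[OF T]
  let ?I = "id_mor1 b"
  note I = cospan_mor_id[OF s(4)]
  note l = lunit_map_props[OF S] and r = runit_map_props[OF T] and as = assoc_map_props[OF S I T]
  let ?L = "(T \<cdot> ?I) \<cdot> S" and ?M = "T \<cdot> (?I \<cdot> S)"
    and ?N = "T \<cdot> S"
  obtain m where m: "cospan_arrow R a c ?M ?N m"
    "\<And>x. x \<in> carrier (mod1 (?I \<cdot> S)) \<Longrightarrow> m (jl T (?I \<cdot> S) x) = jl T S (lunit_map S x)"
    "\<And>y. y \<in> carrier (mod1 T) \<Longrightarrow> m (jr T (?I \<cdot> S) y) = jr T S (id_hom (mod1 T) y)"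
    "id_mor2 R T \<bullet> lunit_mor2 R po S = mor2_of_map R ?M ?N m"
    using hcomp_map[OF l(1) cospan_arrow_id[OF T]] unfolding id_mor2_def lunit_mor2_eq[OF S] by blast
  obtain n where n: "cospan_arrow R a c ?L ?N n"
    "\<And>x. x \<in> carrier (mod1 S) \<Longrightarrow> n (jl (T \<cdot> ?I) S x) = jl T S (id_hom (mod1 S) x)"
    "\<And>y. y \<in> carrier (mod1 (T \<cdot> ?I)) \<Longrightarrow> n (jr (T \<cdot> ?I) S y) = jr T S (runit_map T y)"
    "runit_mor2 R po T \<bullet> id_mor2 R S = mor2_of_map R ?L ?N n"
    using hcomp_map[OF cospan_arrow_id[OF S] r(1)] unfolding id_mor2_def runit_mor2_eq[OF T] by blast
  note arr = cospan_arrow_compose[OF as(1) m(1)]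
  note dN = pushout_squareD[OF comp_square[OF S T]]
    and d1 = pushout_squareD[OF comp_square[OF S I]] and d2 = pushout_squareD[OF comp_square[OF I T]]
    and d3 = pushout_squareD[OF comp_square[OF S comp_cospan_mor[OF I T]]]
  have "compose (carrier (mod1 ?L)) m (assoc_map R po T ?I S) = n"
    by (rule comp3_eqI[OF S I T dN(3) cospan_arrowD(3)[OF arr] cospan_arrowD(3)[OF n(1)]])
       (use as(3-5) m(2,3) n(2,3) l(3,4) r(3,4) dN(10) d1(6,7) d2(6,7) d3(6,7) in simp_all)
  then show ?thesis
    unfolding m(4) n(4) assoc_mor2_def vcomp_map[OF as(1) m(1)] by simp
qed

text \<open>
  Both sides are \<open>2\<close>-morphisms of maps out of the composite of four factors, and each map sends every
  factor to its copy in the target.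
\<close>

lemma pentagon:
  assumes S: "cospan_mor R a b S" and T: "cospan_mor R b c T" and U: "cospan_mor R c d U"
    and V: "cospan_mor R d e V"
  shows "assoc_mor2 R po V U (T \<cdot> S) \<star> assoc_mor2 R po (V \<cdot> U) T S =
    ((id_mor2 R V \<bullet> assoc_mor2 R po U T S) \<star> assoc_mor2 R po V (U \<cdot> T) S) \<star> (assoc_mor2 R po V U T \<bullet> id_mor2 R S)"
proof -
  note TS = comp_cospan_mor[OF S T] and UT = comp_cospan_mor[OF T U] and VU = comp_cospan_mor[OF U V]
  let ?TS = "T \<cdot> S" and ?UT = "U \<cdot> T" and ?VU = "V \<cdot> U"
  note a1 = assoc_map_props[OF TS U V] and a2 = assoc_map_props[OF S T VU]
    and a3 = assoc_map_props[OF S T U] and a4 = assoc_map_props[OF S UT V] and a5 = assoc_map_props[OF T U V]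
  obtain m where m: "cospan_arrow R a e (V \<cdot> (?UT \<cdot> S)) (V \<cdot> (U \<cdot> ?TS)) m"
    "\<And>x. x \<in> carrier (mod1 (?UT \<cdot> S)) \<Longrightarrow> m (jl V (?UT \<cdot> S) x) =
      jl V (U \<cdot> ?TS) (assoc_map R po U T S x)"
    "\<And>y. y \<in> carrier (mod1 V) \<Longrightarrow> m (jr V (?UT \<cdot> S) y) =
      jr V (U \<cdot> ?TS) (id_hom (mod1 V) y)"
    "id_mor2 R V \<bullet> assoc_mor2 R po U T S =
      mor2_of_map R (V \<cdot> (?UT \<cdot> S)) (V \<cdot> (U \<cdot> ?TS)) m"
    using hcomp_map[OF a3(1) cospan_arrow_id[OF V]] unfolding id_mor2_def assoc_mor2_def by blast
  obtain n where n: "cospan_arrow R a e ((?VU \<cdot> T) \<cdot> S) ((V \<cdot> ?UT) \<cdot> S) n"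
    "\<And>x. x \<in> carrier (mod1 S) \<Longrightarrow> n (jl (?VU \<cdot> T) S x) =
      jl (V \<cdot> ?UT) S (id_hom (mod1 S) x)"
    "\<And>y. y \<in> carrier (mod1 (?VU \<cdot> T)) \<Longrightarrow> n (jr (?VU \<cdot> T) S y) =
      jr (V \<cdot> ?UT) S (assoc_map R po V U T y)"
    "assoc_mor2 R po V U T \<bullet> id_mor2 R S =
      mor2_of_map R ((?VU \<cdot> T) \<cdot> S) ((V \<cdot> ?UT) \<cdot> S) n"
    using hcomp_map[OF cospan_arrow_id[OF S] a5(1)] unfolding id_mor2_def assoc_mor2_def by blast
  note L = cospan_arrow_compose[OF a2(1) a1(1)]
  note M1 = cospan_arrow_compose[OF a4(1) m(1)]
  note M = cospan_arrow_compose[OF n(1) M1]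
  note [simp] = pushout_squareD(6,7)[OF comp_square[OF S T]] pushout_squareD(6,7)[OF comp_square[OF T U]]
    pushout_squareD(6,7)[OF comp_square[OF U V]] pushout_squareD(6,7)[OF comp_square[OF TS U]]
    pushout_squareD(6,7)[OF comp_square[OF S UT]] pushout_squareD(6,7)[OF comp_square[OF T VU]]
    pushout_squareD(6,7)[OF comp_square[OF UT V]]
    pushout_squareD(6,7)[OF comp_square[OF S comp_cospan_mor[OF T VU]]]
    pushout_squareD(6,7)[OF comp_square[OF S comp_cospan_mor[OF UT V]]]
    a1(3-5) a2(3-5) a3(3-5) a4(3-5) a5(3-5) m(2,3) n(2,3)
  let ?l = "compose (carrier (mod1 ((?VU \<cdot> T) \<cdot> S))) (assoc_map R po V U ?TS) (assoc_map R po ?VU T S)"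
  let ?r = "compose (carrier (mod1 ((?VU \<cdot> T) \<cdot> S)))
    (compose (carrier (mod1 ((V \<cdot> ?UT) \<cdot> S))) m (assoc_map R po V ?UT S)) n"
  note X = cospan_morD(5)[OF cospan_arrowD(2)[OF M]]
  note l = cospan_arrowD(3)[OF L] and r = cospan_arrowD(3)[OF M]
  note dVT = pushout_squareD[OF comp_square[OF T VU]]
    and dS = pushout_squareD[OF comp_square[OF S comp_cospan_mor[OF T VU]]]
  have gen: "?l (jr (?VU \<cdot> T) S (jr ?VU T w)) = ?r (jr (?VU \<cdot> T) S (jr ?VU T w))"
    if "w \<in> carrier (mod1 ?VU)" for w
  proof -
    note j = compose_mod_hom[OF dVT(5) dS(5) cospan_morD(5)[OF VU]]
    have "?l (compose (carrier (mod1 ?VU)) (jr (?VU \<cdot> T) S) (jr ?VU T) w) =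
        ?r (compose (carrier (mod1 ?VU)) (jr (?VU \<cdot> T) S) (jr ?VU T) w)"
      by (rule pushout_square_comp_eqI[OF comp_square[OF U V] X j l j r _ _ that]) simp_all
    then show ?thesis using that by (simp only: compose_apply)
  qed
  have "?l = ?r"
    by (rule comp3_eqI[OF S T VU X l r _ _ gen]) simp_all
  then show ?thesis
    unfolding m(4)[unfolded assoc_mor2_def] n(4)[unfolded assoc_mor2_def] assoc_mor2_def
      vcomp_map[OF a2(1) a1(1)] vcomp_map[OF a4(1) m(1)]
      vcomp_map[OF n(1) M1] by simp
qed

end

lemma submodule_cospan_relation:
  assumes "is_cospan R X Y C"
  shows "submodule (cospan_relation X Y C) R (mod_sum X Y)"
proof -
  have m: "module R X" "module R Y" "module R (apex C)" and l: "lleg C \<in> mod_hom R X (apex C)"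
    and r: "rleg C \<in> mod_hom R Y (apex C)" using assms by (auto simp: is_cospan_def)
  interpret X: module R X by fact
  interpret Y: module R Y by fact
  interpret S: module R "mod_sum X Y" by (intro module_mod_sum m)
  show ?thesis
    by (rule S.submoduleI_smult)
       (auto simp: cospan_relation_def mod_hom_zero[OF m(1,3) l] mod_hom_zero[OF m(2,3) r]
          mod_hom_add[OF l] mod_hom_add[OF r] mod_hom_smult[OF l] mod_hom_smult[OF r])
qed

lemma (in chosen_pushouts) cospan_relation_comp:
  assumes S: "cospan_mor R H H' S" and T: "cospan_mor R H' H'' T"
  shows "cospan_relation (umod H) (umod H'') (csp (T \<cdot> S)) =
    cospan_relation (umod H) (umod H') (csp S) O cospan_relation (umod H') (umod H'') (csp T)"
proof -
  note s = cospan_morD[OF S] and t = cospan_morD[OF T]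
  note sq = comp_square[OF S T]
  have glued: "jr T S (rleg (csp T) z) = jl T S (lleg (csp S) x) \<longleftrightarrow>
      (\<exists>y\<in>carrier (umod H'). rleg (csp S) y = lleg (csp S) x \<and> rleg (csp T) z = lleg (csp T) y)"
    if "x \<in> carrier (umod H)" "z \<in> carrier (umod H'')" for x z
  proof
    assume "jr T S (rleg (csp T) z) = jl T S (lleg (csp S) x)"
    then show "\<exists>y\<in>carrier (umod H'). rleg (csp S) y = lleg (csp S) x \<and> rleg (csp T) z = lleg (csp T) y"
      using pushout_square_kernel[OF sq s(4) s(7) t(6), of "lleg (csp S) x" "rleg (csp T) z"] s(8) t(9) that
      by auto
  qed (use pushout_squareD(10)[OF sq] in force)
  have composite: "(x, z) \<in> cospan_relation (umod H) (umod H'') (csp (T \<cdot> S)) \<longleftrightarrow>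
      x \<in> carrier (umod H) \<and> z \<in> carrier (umod H'') \<and>
      jr T S (rleg (csp T) z) = jl T S (lleg (csp S) x)" for x z
    using s(1) t(2) by (simp add: cospan_relation_def comp_mor1_legs cong: conj_cong)
  have relcomp: "(x, z) \<in> cospan_relation (umod H) (umod H') (csp S) O
        cospan_relation (umod H') (umod H'') (csp T) \<longleftrightarrow>
      x \<in> carrier (umod H) \<and> z \<in> carrier (umod H'') \<and>
      (\<exists>y\<in>carrier (umod H'). rleg (csp S) y = lleg (csp S) x \<and> rleg (csp T) z = lleg (csp T) y)" for x z
    unfolding cospan_relation_def relcomp_unfold by blast
  have "(x, z) \<in> cospan_relation (umod H) (umod H'') (csp (T \<cdot> S)) \<longleftrightarrow>
      (x, z) \<in> cospan_relation (umod H) (umod H') (csp S) O cospan_relation (umod H') (umod H'') (csp T)" for x z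
    unfolding composite relcomp using glued by blast
  then show ?thesis by (intro subset_antisym subrelI) simp_all
qed

locale lagrangian_setting = chosen_pushouts R po
  for R :: "('a, 'r) ring_scheme" (structure) and po :: "('a, 'u) span \<Rightarrow> ('a, 'u) cospan" +
  fixes bar :: "'a \<Rightarrow> 'a"
  assumes dom: "domain R" and invol: "ring_involution R bar"
begin

lemma lagrangian_cospans_mor: "T \<in> lagrangian_cospans R bar H H' \<Longrightarrow> cospan_mor R H H' T"
  unfolding lagrangian_cospans_def cospan_mor_def by blast

lemma id_mor1_lagrangian:
  assumes H: "H \<in> hermitian_modules R bar"
  shows "id_mor1 H \<in> lagrangian_cospans R bar H H"
proof -
  have "module R (umod H)" using H unfolding hermitian_modules_def by blast
  then have mor: "cospan_mor R H H (id_mor1 H)" by (rule cospan_mor_id)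
  have "cospan_relation (umod H) (umod H) (csp (id_mor1 H)) = Id_on (carrier (umod H))"
    by (auto simp: cospan_relation_def)
  then show ?thesis
    using lagrangian_diagonal[OF dom invol H] mor H
    unfolding lagrangian_cospans_def cospan_mor_def umod_herm_sum_opp by simp
qed

lemma comp_mor1_lagrangian:
  assumes S: "S \<in> lagrangian_cospans R bar H H'" and T: "T \<in> lagrangian_cospans R bar H' H''"
  shows "(T \<cdot> S) \<in> lagrangian_cospans R bar H H''"
proof -
  note mor = lagrangian_cospans_mor[OF S] lagrangian_cospans_mor[OF T]
  have H: "H \<in> hermitian_modules R bar" "H' \<in> hermitian_modules R bar" "H'' \<in> hermitian_modules R bar"
    using S T unfolding lagrangian_cospans_def by blast+
  have "lagrangian R (herm_sum R (herm_opp R H) H'')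
      (saturation R (mod_sum (umod H) (umod H''))
        (cospan_relation (umod H) (umod H'') (csp (T \<cdot> S))))"
    unfolding cospan_relation_comp[OF mor]
    by (rule lagrangian_relcomp[OF dom invol H])
       (use S T in \<open>auto simp: lagrangian_cospans_def umod_herm_sum_opp intro: submodule_cospan_relation\<close>)
  then show ?thesis
    using comp_cospan_mor[OF mor] H unfolding lagrangian_cospans_def cospan_mor_def umod_herm_sum_opp by simp
qed

end

theorem corollary3p3:
  fixes R :: "('a, 'r) ring_scheme"
    and bar :: "'a \<Rightarrow> 'a"
    and po :: "('a, 'u) span \<Rightarrow> ('a, 'u) cospan"
  assumes "domain R"
    and "ring_involution R bar"
    and "pushout_choice R po"
  shows "bicategory
    (hermitian_modules R bar :: ('a, 'u) herm set)
    (lagrangian_cospans R bar)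
    (two_cospan_classes R)
    id_mor1
    (comp_mor1 po)
    (id_mor2 R)
    (vcomp_mor2 R po)
    (hcomp_mor2 R po)
    (assoc_mor2 R po)
    (lunit_mor2 R po)
    (runit_mor2 R po)"
proof -
  interpret lagrangian_setting R po bar
    using assms by (simp add: lagrangian_setting_def lagrangian_setting_axioms_def
        chosen_pushouts_def chosen_pushouts_axioms_def domain_def)
  note mor = lagrangian_cospans_mor
  show ?thesis
  proof (unfold_locales, goal_cases)
    (* Cases 1 to 5 are the axioms of the hom-categories, the others those of a bicategory in order. *)
    case (1 a b x) then show ?case using mor id_mor2_cell by blast
  next
    case (2 a b x y z f g) then show ?case using mor vcomp_cell by metis
  next
    case (3 a b x y f) then show ?case using mor vcomp_id_right by metis
  next
    case (4 a b x y f) then show ?case using mor vcomp_id_left by metis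
  next
    case (5 a b w x y z f g h) then show ?case using vcomp_assoc[OF 5(7,8,9)] mor by metis
  next
    case (6 a) then show ?case by (rule id_mor1_lagrangian)
  next
    case (7 a b c f g) then show ?case using comp_mor1_lagrangian by blast
  next
    case (8 a b c f f' g g' \<alpha> \<beta>)
    then show ?case using hcomp_cell[OF mor[OF 8(4)] mor[OF 8(5)] mor[OF 8(6)] mor[OF 8(7)] 8(8,9)] by simp
  next
    case (9 a b c f g) then show ?case using hcomp_id2 mor by blast
  next
    case (10 a b c f f' f'' g g' g'' \<alpha> \<alpha>' \<beta> \<beta>')
    show ?case by (rule hcomp_interchange[OF mor[OF 10(4)] mor[OF 10(5)] mor[OF 10(6)]
          mor[OF 10(7)] mor[OF 10(8)] mor[OF 10(9)] 10(10-13)])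
  next
    case (11 a b c d f g h)
    note as = assoc_map_props[OF mor[OF 11(5)] mor[OF 11(6)] mor[OF 11(7)]]
    show ?case unfolding assoc_mor2_def by (rule iso_arrow_map[OF as(1,2)])
  next
    case (12 a b c d f f' g g' h h' \<alpha> \<beta> \<gamma>)
    show ?case by (rule assoc_natural[OF mor[OF 12(5)] mor[OF 12(6)] mor[OF 12(7)]
          mor[OF 12(8)] mor[OF 12(9)] mor[OF 12(10)] 12(11-13)])
  next
    case (13 a b f)
    note l = lunit_map_props[OF mor[OF 13(3)]]
    show ?case unfolding lunit_mor2_eq[OF mor[OF 13(3)]] by (rule iso_arrow_map[OF l(1,2)])
  next
    case (14 a b f f' \<alpha>)
    show ?case by (rule lunit_natural[OF mor[OF 14(3)] mor[OF 14(4)] 14(5)])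
  next
    case (15 a b f)
    note l = runit_map_props[OF mor[OF 15(3)]]
    show ?case unfolding runit_mor2_eq[OF mor[OF 15(3)]] by (rule iso_arrow_map[OF l(1,2)])
  next
    case (16 a b f f' \<alpha>)
    show ?case by (rule runit_natural[OF mor[OF 16(3)] mor[OF 16(4)] 16(5)])
  next
    case (17 a b c d e f g h k)
    show ?case by (rule pentagon[OF mor[OF 17(6)] mor[OF 17(7)] mor[OF 17(8)] mor[OF 17(9)]])
  next
    case (18 a b c f g)
    show ?case by (rule triangle[OF mor[OF 18(4)] mor[OF 18(5)]])
  qed
qed

end
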